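(* Let $F_{\mathbb N}=\{f_n\}_{n\in\mathbb N}$ be a sequence of centred, uniformly contracting inner functions, i.e. $f_n(0)=0$ and $|f_n'(0)|\le\alpha<1$ for all $n\in\mathbb N$; let $F_n=f_n\circ\cdots\circ f_1$. Let $\{B(z_n,r_n)\}_{n\in\mathbb N}$ be a sequence of balls in the unit circle $\partial\mathbb D$ with centres $z_n$ and decreasing radii $r_n>0$. Then, for any given $\varepsilon>0$, $$\#\{1\le n\le N:F_n(z)\in B(z_n,r_n)\}=\Phi(N)+O\Bigl(\Phi^{1/2}(N)\,(\log\Phi(N))^{3/2+\varepsilon}\Bigr)$$ for $\lambda$-almost every $z\in\partial\mathbb D$, where $\Phi(N):=\sum_{n=1}^N r_n$. In particular, the set $\mathcal W(F_{\mathbb N},\{z_n,r_n\}):=\{z\in\partial\mathbb D:F_n(z)\in B(z_n,r_n)\text{ for infinitely many }n\in\mathbb N\}$ satisfies $$\lambda\bigl(\mathcal W(F_{\mathbb N},\{z_n,r_n\})\bigr)=\begin{cases}0&\text{if }\sum_{n=1}^\infty r_n<\infty,\\1&\text{if }\sum_{n=1}^\infty r_n=\infty.\end{cases}$$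
   Context: $\mathbb D$ is the open unit disk in $\mathbb C$, $\partial\mathbb D$ its boundary, $\lambda$ is normalised Lebesgue measure on $\partial\mathbb D$, and the metric $d$ on $\partial\mathbb D$ is normalised arc length. An inner function is a holomorphic map $f:\mathbb D\to\mathbb D$ such that for $\lambda$-almost every $e^{i\theta}\in\partial\mathbb D$ the radial limit $\lim_{r\to1^-}f(re^{i\theta})$ exists and belongs to $\partial\mathbb D$; the resulting ($\lambda$-a.e. defined) boundary map is also denoted $f$.
   Formalization: Arc length is normalised so that the circle has diameter 1 and B(z,r) has measure r; the counting formula assumes some r_n ≤ 1 (it fails for r_n = 2), and log Φ(N) in the error term is read as max(1, log Φ(N)), since its power is undefined for Φ(N) < 1. *)

theory Defs
  imports "HOL-Complex_Analysis.Complex_Analysis" "HOL-Library.Landau_Symbols"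
begin

text \<open>
  Normalised Lebesgue measure on the unit circle. It is completed, so that an arbitrary choice of
  values on a null set does not affect measurability.
\<close>

definition circle_measure :: "complex measure" where
  "circle_measure =
     completion (distr (uniform_measure lborel {0..1}) (restrict_space borel (sphere 0 1))
       (\<lambda>t. cis (2 * pi * t)))"

text \<open>
  Arc length normalised so that the circle has diameter 1. For this normalisation an arc of
  centre \<open>c\<close> and radius \<open>\<rho> \<le> 1\<close> has normalised Lebesgue measure exactly \<open>\<rho>\<close>.
  (Division by \<open>2 * pi\<close> instead would give it measure \<open>2 * \<rho>\<close>.)
\<close>

definition circle_dist :: "complex \<Rightarrow> complex \<Rightarrow> real" where
  "circle_dist z w = \<bar>Arg (z / w)\<bar> / pi"

definition circle_ball :: "complex \<Rightarrow> real \<Rightarrow> complex set" where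
  "circle_ball c \<rho> = {w \<in> sphere 0 1. circle_dist c w < \<rho>}"

definition inner_function :: "(complex \<Rightarrow> complex) \<Rightarrow> bool" where
  "inner_function f \<longleftrightarrow>
     f holomorphic_on ball 0 1 \<and> f ` ball 0 1 \<subseteq> ball 0 1 \<and>
     (AE z in circle_measure.
        \<exists>w \<in> sphere 0 1. ((\<lambda>t. f (complex_of_real t * z)) \<longlongrightarrow> w) (at_left 1))"

text \<open>
  The radial limit; \<^const>\<open>Lim\<close> has an unspecified value at points where the limit does not exist,
  which for an inner function form a null set.
\<close>

definition boundary_map :: "(complex \<Rightarrow> complex) \<Rightarrow> complex \<Rightarrow> complex" where
  "boundary_map f z = Lim (at_left 1) (\<lambda>t. f (complex_of_real t * z))"

text \<open>\<open>f n \<circ> \<dots> \<circ> f 1\<close>; the function \<open>f 0\<close> is not used.\<close>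

primrec forward_comp :: "(nat \<Rightarrow> complex \<Rightarrow> complex) \<Rightarrow> nat \<Rightarrow> complex \<Rightarrow> complex" where
  "forward_comp f 0 = id"
| "forward_comp f (Suc n) = f (Suc n) \<circ> forward_comp f n"

definition hits :: "(nat \<Rightarrow> complex \<Rightarrow> complex) \<Rightarrow> (nat \<Rightarrow> complex) \<Rightarrow> (nat \<Rightarrow> real) \<Rightarrow> complex \<Rightarrow> nat set" where
  "hits f c r z = {n. 1 \<le> n \<and> boundary_map (forward_comp f n) z \<in> circle_ball (c n) (r n)}"

definition hitting_count ::
  "(nat \<Rightarrow> complex \<Rightarrow> complex) \<Rightarrow> (nat \<Rightarrow> complex) \<Rightarrow> (nat \<Rightarrow> real) \<Rightarrow> complex \<Rightarrow> nat \<Rightarrow> nat" where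
  "hitting_count f c r z N = card (hits f c r z \<inter> {1..N})"

definition shrinking_target_set ::
  "(nat \<Rightarrow> complex \<Rightarrow> complex) \<Rightarrow> (nat \<Rightarrow> complex) \<Rightarrow> (nat \<Rightarrow> real) \<Rightarrow> complex set" where
  "shrinking_target_set f c r = {z \<in> sphere 0 1. infinite (hits f c r z)}"

definition radius_sum :: "(nat \<Rightarrow> real) \<Rightarrow> nat \<Rightarrow> real" where
  "radius_sum r N = (\<Sum>n=1..N. r n)"

text \<open>
  The logarithm in error terms: it agrees with \<^const>\<open>ln\<close> from \<open>exp 1\<close> on, and keeps
  real powers of it meaningful, and bounded away from 0, for small arguments.
\<close>

definition log_err :: "real \<Rightarrow> real" where
  "log_err x = max 1 (ln x)"

end

theory Submission
  imports Defs "HOL-Probability.Probability"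
begin


text \<open>
  A boundary map \<open>g\<close> of an inner function \<open>f\<close> carries the harmonic measure at \<open>a\<close> to the harmonic
  measure at \<open>f a\<close>; this is tested on Poisson kernels, which are real parts of bounded holomorphic
  functions. Together with Fatou's theorem it identifies the radial limits of a composition with
  the composition of the boundary maps. By the Schwarz--Pick lemma the quantity
  \<open>\<bar>z\<bar> / (1 - \<bar>z\<bar>)\<close> shrinks by the factor \<open>(1 + \<alpha>) / 2\<close> under every \<open>f n\<close>, so a pole at distance
  \<open>\<delta>\<close> from the circle is moved after \<open>k\<close> steps to distance at most \<open>((1 + \<alpha>) / 2) ^ k / \<delta>\<close> from 0,
  where the Poisson kernel is nearly constant. Sandwiching the indicator of an arc between
  superpositions of Poisson kernels with \<open>\<delta>\<close> exponentially small in \<open>k\<close> gives exponential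
  decorrelation of the events \<open>F\<^sub>n z \<in> B(z\<^sub>n, r\<^sub>n)\<close>, hence a variance bound linear in \<open>\<Phi>\<close>, and a
  dyadic chaining argument turns this into the almost sure asymptotics.
\<close>

section \<open>Harmonic measure and the Poisson formula\<close>

text \<open>Boundary maps exist only almost everywhere, and an inner function carries a radius to a
  curve that need not be radial. Therefore each boundary map is replaced by a Borel representative,
  and compositions are handled through Poisson integrals instead of image curves. The variance must
  be linear in \<Phi>, not in the number of steps; so the decorrelation error has to be proportional
  to the measure of the later target, which is why harmonic and Lebesgue measure are compared up to
  a factor near 1. The scales are balanced by one parameter y: poles lie at distance y^3 from the
  circle and arcs are enlarged by y. Kernel mass leaking across the gap is of order y^3 / y^2 = y,
  and a contraction by y^6 moves the poles to within y^6 / y^3 = y^3 of 0; taking y^6 = ((1 +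
  \<alpha>) / 2)^k explains the sixth root. The exponent 3/2 + \<epsilon> is half of 3 + 2
  \<epsilon>: the chaining costs a logarithm for Cauchy-Schwarz, one for the number of dyadic
  levels, and 1 + 2 \<epsilon> powers for summability over scales. Radii above 1 are capped, such a
  target being the whole circle.\<close>

text \<open>
  The measure lives on the whole plane, so that measurability with respect to it is Borel
  measurability; by \<open>AE_circle_measure_iff\<close> below it has the same almost sure statements as
  \<^const>\<open>circle_measure\<close>.
\<close>

definition circ :: "complex measure" where
  "circ = distr (uniform_measure lborel {0..1}) borel (\<lambda>t. cis (2 * pi * t))"

definition poisson :: "complex \<Rightarrow> complex \<Rightarrow> real" where
  "poisson a z = (1 - (norm a)\<^sup>2) / (norm (z - a))\<^sup>2"

lemma space_circ [simp]: "space circ = UNIV"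
  and sets_circ [simp, measurable_cong]: "sets circ = sets borel"
  by (simp_all add: circ_def)

lemma measurable_cis [measurable]: "(\<lambda>t. cis (2 * pi * t)) \<in> borel_measurable borel"
  by (intro borel_measurable_continuous_onI continuous_intros)

lemma uniform_Icc_eq: "uniform_measure lborel {0..1::real} = density lborel (\<lambda>x. ennreal (indicator {0..1} x))"
  by (simp add: uniform_measure_def ennreal_indicator divide_ennreal_def)

interpretation circ: prob_space circ
  unfolding circ_def
  by (intro prob_space.prob_space_distr prob_space_uniform_measure) auto

lemma AE_circ_iff:
  assumes "Measurable.pred borel P"
  shows "(AE z in circ. P z) \<longleftrightarrow> (AE t in lborel. t \<in> {0..1} \<longrightarrow> P (cis (2 * pi * t)))"
proof -
  have "{x \<in> space borel. P x} \<in> sets borel" using assms by simp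
  thus ?thesis unfolding circ_def
    by (subst AE_distr_iff) (auto simp: AE_uniform_measure)
qed

lemma AE_circ_norm: "AE z in circ. norm z = 1"
  by (subst AE_circ_iff) auto

lemma integral_circ:
  fixes h :: "complex \<Rightarrow> 'b::{banach, second_countable_topology}"
  assumes [measurable]: "h \<in> borel_measurable borel"
  shows "(LINT z|circ. h z) = (LINT t:{0..1}|lborel. h (cis (2 * pi * t)))"
  unfolding circ_def uniform_Icc_eq
  by (subst integral_distr, simp, simp, subst integral_density)
     (auto simp: set_lebesgue_integral_def)

lemma emeasure_circ:
  assumes [measurable]: "A \<in> sets borel"
  shows "emeasure circ A = emeasure lborel {t\<in>{0..1}. cis (2 * pi * t) \<in> A}"
proof -
  have "emeasure circ A = emeasure (uniform_measure lborel {0..1::real}) ((\<lambda>t. cis (2 * pi * t)) -` A)"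
    unfolding circ_def by (subst emeasure_distr) auto
  also have "\<dots> = emeasure lborel ({0..1} \<inter> (\<lambda>t. cis (2 * pi * t)) -` A)"
    by (subst emeasure_uniform_measure)
       (auto simp: divide_ennreal_def intro!: measurable_sets_borel[OF measurable_cis])
  also have "{0..1} \<inter> (\<lambda>t. cis (2 * pi * t)) -` A = {t\<in>{0..1}. cis (2 * pi * t) \<in> A}"
    by auto
  finally show ?thesis .
qed

text \<open>Completion leaves almost sure statements unchanged, and \<open>circ\<close> has no mass
  off the sphere, so exceptional sets pass between the two spaces by intersection with the
  sphere.\<close>

lemma AE_circle_measure_iff: "(AE z in circle_measure. P z) \<longleftrightarrow> (AE z in circ. P z)"
proof -
  let ?U = "uniform_measure lborel {0..1::real}"
  let ?g = "\<lambda>t. cis (2 * pi * t)"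
  let ?R = "distr ?U (restrict_space borel (sphere 0 1)) ?g"
  have g: "?g \<in> ?U \<rightarrow>\<^sub>M restrict_space borel (sphere 0 1)"
    by (intro measurable_restrict_space2) auto
  have em: "emeasure circ N = emeasure ?R N" if "N \<in> sets borel" "N \<subseteq> sphere 0 1" for N
    using that g unfolding circ_def
    by (subst (1 2) emeasure_distr) (auto simp: sets_restrict_space_iff)
  have "(AE z in circle_measure. P z) \<longleftrightarrow> (AE z in ?R. P z)"
    unfolding circle_measure_def by (rule AE_completion_iff)
  also have "\<dots> \<longleftrightarrow> (AE z in circ. P z)"
  proof
    assume "AE z in ?R. P z"
    then obtain N where N: "{z \<in> space ?R. \<not> P z} \<subseteq> N" "N \<in> sets ?R" "emeasure ?R N = 0"
      by (auto elim!: AE_E)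
    have N': "N \<in> sets borel" "N \<subseteq> sphere 0 1"
      using N(2) by (auto simp: sets_restrict_space_iff)
    have "N \<in> null_sets circ"
      using N N' em by (intro null_setsI) auto
    hence "AE z in circ. z \<notin> N" by (rule AE_not_in)
    thus "AE z in circ. P z"
      using AE_circ_norm by eventually_elim (use N(1) in \<open>auto simp: space_restrict_space\<close>)
  next
    assume "AE z in circ. P z"
    then obtain N where N: "{z \<in> space circ. \<not> P z} \<subseteq> N" "N \<in> sets circ" "emeasure circ N = 0"
      by (auto elim!: AE_E)
    have "emeasure circ (N \<inter> sphere 0 1) = 0"
      using N emeasure_mono[of "N \<inter> sphere 0 1" N circ] by auto
    hence "N \<inter> sphere 0 1 \<in> null_sets ?R"
      using N em[of "N \<inter> sphere 0 1"] by (intro null_setsI) (auto simp: sets_restrict_space_iff)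
    thus "AE z in ?R. P z"
      by (rule AE_I') (use N(1) in \<open>auto simp: space_restrict_space\<close>)
  qed
  finally show ?thesis .
qed

lemma poisson_nonneg: "norm a < 1 \<Longrightarrow> 0 \<le> poisson a z"
  unfolding poisson_def by (intro divide_nonneg_nonneg) (auto simp: power_le_one)

lemma poisson_measurable [measurable]:
  "(\<lambda>x. poisson (f x) (g x)) \<in> borel_measurable M"
  if [measurable]: "f \<in> borel_measurable M" "g \<in> borel_measurable M"
  unfolding poisson_def by measurable

lemma poisson_le:
  assumes "norm a < 1" "norm z = 1"
  shows "poisson a z \<le> (1 + norm a) / (1 - norm a)"
proof -
  have "1 - norm a \<le> norm (z - a)" using norm_triangle_ineq2[of z a] assms by simp
  hence "(1 - norm a)\<^sup>2 \<le> (norm (z - a))\<^sup>2" using assms by (intro power_mono) auto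
  hence "poisson a z \<le> (1 - (norm a)\<^sup>2) / (1 - norm a)\<^sup>2"
    unfolding poisson_def using assms by (intro divide_left_mono mult_pos_pos) (auto simp: power_le_one)
  also have "\<dots> = (1 + norm a) / (1 - norm a)"
  proof -
    have "1 - (norm a)\<^sup>2 = (1 + norm a) * (1 - norm a)"
      by (simp add: power2_eq_square algebra_simps)
    thus ?thesis using assms by (simp add: power2_eq_square)
  qed
  finally show ?thesis .
qed

text \<open>For unimodular z and w both squared distances equal 1 + s^2 - 2 s Re (z cnj w). The
  symmetry lets pole direction and integration variable change places in Fubini arguments.\<close>

lemma poisson_swap:
  assumes "norm z = 1" "norm w = 1"
  shows "poisson (of_real s * w) z = poisson (of_real s * z) w"
proof -
  have "(norm (z - of_real s * w))\<^sup>2 = (norm (w - of_real s * z))\<^sup>2"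
  proof -
    have "Re z^2 + Im z^2 = 1" "Re w^2 + Im w^2 = 1"
      using assms by (auto simp: cmod_def)
    thus ?thesis unfolding cmod_power2 by (simp add: power2_eq_square) algebra
  qed
  thus ?thesis using assms by (simp add: poisson_def norm_mult)
qed

text \<open>On the circle cnj z = 1 / z, so the kernel is a rational function of z there; in this
  form Cauchy's integral formula applies to it.\<close>

lemma poisson_circle_eq:
  assumes "norm z = 1" "norm a < 1"
  shows "of_real (poisson a z) = z * (1 - (norm a)\<^sup>2) / ((z - a) * (1 - cnj a * z))"
proof -
  have zz: "z * cnj z = 1" using assms by (simp add: complex_norm_square[symmetric])
  have "1 - cnj a * z = z * cnj (z - a)" using zz by (simp add: algebra_simps)
  moreover have "z \<noteq> 0" "z \<noteq> a" using assms by auto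
  moreover have "complex_of_real ((norm (z - a))\<^sup>2) = (z - a) * cnj (z - a)"
    by (simp only: complex_norm_square)
  ultimately show ?thesis
    unfolding poisson_def by (simp add: divide_simps del: complex_cnj_diff)
qed

lemma one_minus_cnj_mult_nonzero:
  assumes "norm a < 1" "norm z \<le> 1" shows "1 - cnj a * z \<noteq> 0"
proof
  assume "1 - cnj a * z = 0"
  hence "norm (cnj a * z) = 1" by simp
  moreover have "norm (cnj a * z) \<le> norm a" using assms by (simp add: norm_mult mult_left_le)
  ultimately show False using assms by simp
qed

text \<open>Cauchy's formula for \<open>g\<close>, whose denominator has no zero in the closed disc.
  The factor z in \<open>poisson_circle_eq\<close> is supplied by the derivative of the circle path,
  and \<open>g a = f a\<close>.\<close>

lemma poisson_formula:
  assumes cont: "continuous_on (cball 0 1) f" and hol: "f holomorphic_on ball 0 1"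
    and [measurable]: "f \<in> borel_measurable borel" and a: "norm a < 1"
  shows "(LINT z|circ. of_real (poisson a z) * f z) = f a"
proof -
  define g where "g = (\<lambda>z. f z * (1 - (norm a)\<^sup>2) / (1 - cnj a * z))"
  have "((\<lambda>u. g u / (u - a)) has_contour_integral (2 * of_real pi * \<i> * g a)) (circlepath 0 1)"
  proof (rule Cauchy_integral_circlepath)
    show "continuous_on (cball 0 1) g"
      unfolding g_def using a one_minus_cnj_mult_nonzero[of a]
      by (intro continuous_intros cont) auto
    show "g holomorphic_on ball 0 1"
      unfolding g_def using a one_minus_cnj_mult_nonzero[of a]
      by (intro holomorphic_intros hol) auto
  qed (use a in auto)
  hence "((\<lambda>x. g (circlepath 0 1 x) / (circlepath 0 1 x - a) * vector_derivative (circlepath 0 1) (at x))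
            has_integral (2 * of_real pi * \<i> * g a)) {0..1}"
    by (simp add: has_contour_integral)
  also have "(\<lambda>x. g (circlepath 0 1 x) / (circlepath 0 1 x - a) * vector_derivative (circlepath 0 1) (at x))
     = (\<lambda>t. 2 * of_real pi * \<i> * (of_real (poisson a (cis (2 * pi * t))) * f (cis (2 * pi * t))))"
  proof
    fix t :: real
    have c: "exp (2 * of_real pi * \<i> * of_real t) = cis (2 * pi * t)"
      by (simp add: cis_conv_exp mult_ac)
    show "g (circlepath 0 1 t) / (circlepath 0 1 t - a) * vector_derivative (circlepath 0 1) (at t) =
       2 * of_real pi * \<i> * (of_real (poisson a (cis (2 * pi * t))) * f (cis (2 * pi * t)))"
      unfolding vector_derivative_circlepath unfolding circlepath c
      using a by (simp add: poisson_circle_eq g_def divide_inverse inverse_mult_distrib mult_ac)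
  qed
  finally have "((\<lambda>t. 2 * of_real pi * \<i> * (of_real (poisson a (cis (2 * pi * t))) * f (cis (2 * pi * t))))
            has_integral (2 * of_real pi * \<i> * g a)) {0..1}" .
  from has_integral_mult_right[OF this, of "1 / (2 * of_real pi * \<i>)"]
  have *: "((\<lambda>t. of_real (poisson a (cis (2 * pi * t))) * f (cis (2 * pi * t))) has_integral g a) {0..1}"
    by simp
  have ga: "g a = f a"
  proof -
    have "complex_of_real ((norm a)\<^sup>2) = cnj a * a" by (simp only: complex_norm_square mult.commute)
    thus ?thesis using one_minus_cnj_mult_nonzero[of a a] a by (simp add: g_def)
  qed
  have "set_integrable lborel {0..1} (\<lambda>t. of_real (poisson a (cis (2 * pi * t))) * f (cis (2 * pi * t)))"
  proof (rule borel_integrable_atLeastAtMost')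
    show "continuous_on {0..1} (\<lambda>t. complex_of_real (poisson a (cis (2 * pi * t))) * f (cis (2 * pi * t)))"
      unfolding poisson_def using a
      by (intro continuous_intros continuous_on_compose2[OF cont]) auto
  qed
  from set_borel_integral_eq_integral(2)[OF this] show ?thesis
    using * ga by (subst integral_circ) (auto simp: integral_unique)
qed

text \<open>Radii approach 1 along a sequence, because dominated convergence and limits of Borel
  functions are used for sequences.\<close>

lemma eventually_at_left_1_subseq:
  "filterlim (\<lambda>n. 1 - 1 / real (n + 2)) (at_left 1) sequentially"
proof (rule filterlim_at_withinI)
  show "(\<lambda>n. 1 - 1 / real (n + 2)) \<longlonglongrightarrow> 1" by real_asymp
qed auto

text \<open>The dilates of f by \<open>\<rho> n\<close> are continuous up to the circle, so the
  Poisson formula holds for them; boundedness of f and of the kernel permits dominated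
  convergence.\<close>

lemma poisson_representation:
  assumes hol: "f holomorphic_on ball 0 1" and bd: "\<And>z. norm z < 1 \<Longrightarrow> norm (f z) \<le> B"
    and [measurable]: "g \<in> borel_measurable borel"
    and lim: "AE z in circ. ((\<lambda>t. f (complex_of_real t * z)) \<longlongrightarrow> g z) (at_left 1)"
    and a: "norm a < 1"
  shows "(LINT z|circ. of_real (poisson a z) * g z) = f a"
proof -
  define \<rho> where "\<rho> = (\<lambda>n::nat. 1 - 1 / real (n + 2))"
  have \<rho>: "0 < \<rho> n" "\<rho> n < 1" for n by (auto simp: \<rho>_def)
  \<comment> \<open>The truncation outside the closed disc secures Borel measurability on the whole
    plane.\<close>
  define F where "F = (\<lambda>n z. if norm z \<le> 1 then f (of_real (\<rho> n) * z) else 0)"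
  have contf: "continuous_on (ball 0 1) f" using hol by (rule holomorphic_on_imp_continuous_on)
  have in_ball: "norm (complex_of_real (\<rho> n) * z) < 1" if "norm z \<le> 1" for n z
  proof -
    have "\<rho> n * norm z \<le> \<rho> n * 1" using that \<rho>[of n] by (intro mult_left_mono) auto
    moreover have "norm (complex_of_real (\<rho> n) * z) = \<rho> n * norm z"
      using \<rho>[of n] by (simp add: norm_mult)
    ultimately show ?thesis using \<rho>[of n] by linarith
  qed
  have contF: "continuous_on (cball 0 1) (\<lambda>z. f (of_real (\<rho> n) * z))" for n
    by (intro continuous_on_compose2[OF contf] continuous_intros) (use in_ball in auto)
  have [measurable]: "F n \<in> borel_measurable borel" for n
  proof -
    have "F n = (\<lambda>z. indicator (cball 0 1) z *\<^sub>R f (of_real (\<rho> n) * z))"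
      by (auto simp: F_def fun_eq_iff indicator_def)
    thus ?thesis
      using borel_measurable_continuous_on_indicator[OF _ contF[of n]] by simp
  qed
  have PF: "(LINT z|circ. of_real (poisson a z) * F n z) = f (of_real (\<rho> n) * a)" for n
  proof -
    have "(LINT z|circ. of_real (poisson a z) * F n z) = F n a"
    proof (rule poisson_formula)
      show "continuous_on (cball 0 1) (F n)"
        using contF[of n] by (rule continuous_on_eq) (auto simp: F_def)
      have "(\<lambda>z. f (of_real (\<rho> n) * z)) holomorphic_on ball 0 1"
        by (intro holomorphic_on_compose_gen[OF _ hol, unfolded o_def] holomorphic_intros)
           (use in_ball in auto)
      thus "F n holomorphic_on ball 0 1"
        by (rule holomorphic_transform) (auto simp: F_def)
    qed (use a in auto)
    thus ?thesis using a by (simp add: F_def)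
  qed
  have 1: "(\<lambda>n. LINT z|circ. of_real (poisson a z) * F n z) \<longlonglongrightarrow> (LINT z|circ. of_real (poisson a z) * g z)"
  proof (rule integral_dominated_convergence[where w = "\<lambda>_. (1 + norm a) / (1 - norm a) * B"])
    show "AE z in circ. (\<lambda>n. of_real (poisson a z) * F n z) \<longlonglongrightarrow> of_real (poisson a z) * g z"
      using lim AE_circ_norm
    proof eventually_elim
      case (elim z)
      have "(\<lambda>n. f (of_real (\<rho> n) * z)) \<longlonglongrightarrow> g z"
        unfolding \<rho>_def
        by (rule filterlim_compose[OF elim(1) eventually_at_left_1_subseq])
      thus ?case using elim by (intro tendsto_intros) (auto simp: F_def)
    qed
    show "AE z in circ. norm (of_real (poisson a z) * F n z) \<le> (1 + norm a) / (1 - norm a) * B" for n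
      using AE_circ_norm
    proof eventually_elim
      case (elim z)
      have "norm (F n z) \<le> B" using elim in_ball[of z n] bd by (auto simp: F_def)
      hence "poisson a z * norm (F n z) \<le> (1 + norm a) / (1 - norm a) * B"
        using poisson_le[OF a elim] poisson_nonneg[OF a, of z] a by (intro mult_mono) auto
      thus ?case using poisson_nonneg[OF a, of z] by (simp add: norm_mult)
    qed
  qed auto
  have "(\<lambda>n. f (of_real (\<rho> n) * a)) \<longlonglongrightarrow> f a"
  proof (rule continuous_on_tendsto_compose[OF contf])
    have "\<rho> \<longlonglongrightarrow> 1" unfolding \<rho>_def by real_asymp
    hence "(\<lambda>n. complex_of_real (\<rho> n) * a) \<longlonglongrightarrow> of_real 1 * a" by (intro tendsto_intros)
    thus "(\<lambda>n. of_real (\<rho> n) * a) \<longlonglongrightarrow> a" by simp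
  qed (use a in_ball in \<open>auto intro!: always_eventually\<close>)
  with 1 show ?thesis unfolding PF by (rule LIMSEQ_unique)
qed


lemma integral_poisson: "norm a < 1 \<Longrightarrow> (LINT z|circ. poisson a z) = 1"
proof -
  assume a: "norm a < 1"
  have "(LINT z|circ. complex_of_real (poisson a z) * 1) = 1"
    using a by (intro poisson_formula) auto
  hence "complex_of_real (LINT z|circ. poisson a z) = 1" by simp
  thus ?thesis by (simp only: of_real_eq_1_iff)
qed

lemma integrable_poisson_mult:
  fixes h :: "complex \<Rightarrow> 'b::{banach, second_countable_topology}"
  assumes a: "norm a < 1" and [measurable]: "h \<in> borel_measurable borel"
    and bd: "AE z in circ. norm (h z) \<le> B"
  shows "integrable circ (\<lambda>z. poisson a z *\<^sub>R h z)"
proof (rule circ.integrable_const_bound)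
  show "AE z in circ. norm (poisson a z *\<^sub>R h z) \<le> (1 + norm a) / (1 - norm a) * B"
    using AE_circ_norm bd
  proof eventually_elim
    case (elim z)
    have "poisson a z * norm (h z) \<le> (1 + norm a) / (1 - norm a) * B"
      using poisson_le[OF a elim(1)] poisson_nonneg[OF a, of z] a elim(2) by (intro mult_mono) auto
    thus ?case using poisson_nonneg[OF a, of z] by simp
  qed
qed auto

lemma integrable_poisson: "norm a < 1 \<Longrightarrow> integrable circ (poisson a)"
  using integrable_poisson_mult[of a "\<lambda>_. 1::real" 1] by simp

lemma nn_integral_poisson: "norm a < 1 \<Longrightarrow> (\<integral>\<^sup>+z. ennreal (poisson a z) \<partial>circ) = 1"
  by (subst nn_integral_eq_integral) (auto simp: integrable_poisson integral_poisson poisson_nonneg)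

section \<open>Poisson kernels as an approximate identity\<close>

lemma norm_of_real_mult_less: "norm u = 1 \<Longrightarrow> 0 \<le> s \<Longrightarrow> s < 1 \<Longrightarrow> norm (complex_of_real s * u) < 1"
  by (simp add: norm_mult)

text \<open>Both bounds come from a lower bound for the distance of z to the pole: it is at least 1
  - s, and at least half of \<open>norm (z - u)\<close> because the pole is itself only 1 - s away
  from u.\<close>

lemma poisson_radial_le:
  assumes u: "norm u = 1" and z: "norm z = 1" and s: "0 \<le> s" "s < 1"
  shows "poisson (of_real s * u) z \<le> 2 / (1 - s)"
    and "z \<noteq> u \<Longrightarrow> poisson (of_real s * u) z \<le> 8 * (1 - s) / (norm (z - u))\<^sup>2"
proof -
  have "norm z - norm (of_real s * u) \<le> norm (z - of_real s * u)" by (rule norm_triangle_ineq2)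
  hence d1: "1 - s \<le> norm (z - of_real s * u)" using u z s by (simp add: norm_mult)
  have "norm (z - u) \<le> norm (z - of_real s * u) + norm (of_real s * u - u)"
    using norm_triangle_ineq[of "z - of_real s * u" "of_real s * u - u"] by simp
  also have "norm (of_real s * u - u) = 1 - s"
  proof -
    have "of_real s * u - u = of_real (s - 1) * u" by (simp add: algebra_simps)
    thus ?thesis using u s by (simp only: norm_mult norm_of_real) simp
  qed
  finally have d2: "norm (z - u) \<le> 2 * norm (z - of_real s * u)" using d1 by simp
  have P: "poisson (of_real s * u) z = (1 - s\<^sup>2) / (norm (z - of_real s * u))\<^sup>2"
    using u s by (simp add: poisson_def norm_mult)
  have s2: "1 - s\<^sup>2 \<le> 2 * (1 - s)"
    using zero_le_power2[of "1 - s"] by (simp add: power2_eq_square algebra_simps)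
  have s20: "0 \<le> 1 - s\<^sup>2" using s by (simp add: power_le_one)
  have "(1 - s)\<^sup>2 \<le> (norm (z - of_real s * u))\<^sup>2" using d1 s by (intro power_mono) auto
  hence "poisson (of_real s * u) z \<le> (2 * (1 - s)) / (1 - s)\<^sup>2"
    unfolding P using s s2 s20 by (intro frac_le) auto
  thus "poisson (of_real s * u) z \<le> 2 / (1 - s)" using s by (simp add: power2_eq_square del: right_diff_distrib_numeral)
  assume ne: "z \<noteq> u"
  have "(norm (z - u) / 2)\<^sup>2 \<le> (norm (z - of_real s * u))\<^sup>2" using d2 by (intro power_mono) auto
  hence "poisson (of_real s * u) z \<le> (2 * (1 - s)) / (norm (z - u) / 2)\<^sup>2"
    unfolding P using s s2 s20 ne by (intro frac_le) auto
  thus "poisson (of_real s * u) z \<le> 8 * (1 - s) / (norm (z - u))\<^sup>2"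
    by (simp add: power_divide mult_ac)
qed

text \<open>The kernel is majorised by step functions on chord balls of radii 2^k (1 - s). Outside
  the ball of index k - 1 the quadratic decay gives 8 * 4 / (4^k (1 - s)), hence the constant 32;
  the last term covers points at distance at least d / 2.\<close>

lemma poisson_dyadic_bound:
  assumes u: "norm u = 1" and z: "norm z = 1" and s: "0 \<le> s" "s < 1"
    and n: "d < 2 ^ Suc n * (1 - s)" and d: "d > 0"
  shows "poisson (of_real s * u) z \<le>
     (\<Sum>k\<le>n. 32 / (4 ^ k * (1 - s)) * indicator {w. norm (w - u) < 2 ^ k * (1 - s)} z) + 32 * (1 - s) / d\<^sup>2"
proof -
  define \<delta> where "\<delta> = 1 - s"
  have \<delta>: "\<delta> > 0" using s by (simp add: \<delta>_def)
  define f where "f = (\<lambda>k. 32 / (4 ^ k * \<delta>) * indicator {w. norm (w - u) < 2 ^ k * \<delta>} z)"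
  have f0: "0 \<le> f k" for k using \<delta> by (simp add: f_def)
  have goal: "poisson (of_real s * u) z \<le> (\<Sum>k\<le>n. f k) + 32 * \<delta> / d\<^sup>2"
  proof (cases "norm (z - u) < 2 ^ n * \<delta>")
    case True
    \<comment> \<open>The first dyadic scale that reaches z; by minimality the previous scale is a
      lower bound for the distance to u.\<close>
    define k where "k = (LEAST k. norm (z - u) < 2 ^ k * \<delta>)"
    have k: "norm (z - u) < 2 ^ k * \<delta>" unfolding k_def by (rule LeastI) (rule True)
    have kn: "k \<le> n" unfolding k_def by (rule Least_le) (rule True)
    have "poisson (of_real s * u) z \<le> f k"
    proof (cases k)
      case 0
      have "poisson (of_real s * u) z \<le> 2 / \<delta>" unfolding \<delta>_def by (rule poisson_radial_le(1)[OF u z s])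
      also have "\<dots> \<le> 32 / \<delta>" using \<delta> by (simp add: divide_simps)
      also have "\<dots> = f k" using k 0 by (simp add: f_def)
      finally show ?thesis .
    next
      case (Suc j)
      have j: "2 ^ j * \<delta> \<le> norm (z - u)"
        using not_less_Least[of j "\<lambda>k. norm (z - u) < 2 ^ k * \<delta>"] Suc by (simp add: k_def)
      have p: "0 < 2 ^ j * \<delta>" using \<delta> by simp
      have nzu: "0 < norm (z - u)" using j p by linarith
      hence "z \<noteq> u" by simp
      hence "poisson (of_real s * u) z \<le> 8 * \<delta> / (norm (z - u))\<^sup>2"
        unfolding \<delta>_def by (rule poisson_radial_le(2)[OF u z s])
      also have "\<dots> \<le> 8 * \<delta> / (2 ^ j * \<delta>)\<^sup>2"
        using j p \<delta> nzu by (intro divide_left_mono power_mono mult_pos_pos zero_less_power) (simp_all only: less_imp_le)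
      also have "\<dots> = 32 / (4 ^ k * \<delta>)"
      proof -
        have "(2 ^ j * \<delta>)\<^sup>2 = 4 ^ j * \<delta> * \<delta>"
          by (simp add: power_mult_distrib power2_eq_square flip: power_mult_distrib)
        thus ?thesis using \<delta> by (simp add: Suc divide_simps)
      qed
      also have "\<dots> = f k" using k by (simp add: f_def)
      finally show ?thesis .
    qed
    also have "f k \<le> (\<Sum>k\<le>n. f k)" using kn f0 by (intro member_le_sum) auto
    finally show ?thesis using \<delta> d by (smt (verit) divide_nonneg_nonneg zero_le_power2 mult_nonneg_nonneg)
  next
    case False
    have j: "d / 2 \<le> norm (z - u)" using False n by (simp add: \<delta>_def)
    have "z \<noteq> u" using j d by auto
    hence "poisson (of_real s * u) z \<le> 8 * \<delta> / (norm (z - u))\<^sup>2"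
      unfolding \<delta>_def by (rule poisson_radial_le(2)[OF u z s])
    also have "\<dots> \<le> 8 * \<delta> / (d / 2)\<^sup>2"
      using j d \<delta> by (intro divide_left_mono power_mono mult_pos_pos zero_less_power) auto
    also have "\<dots> = 32 * \<delta> / d\<^sup>2" by (simp add: power_divide)
    finally show ?thesis using sum_nonneg[of "{..n}" f] f0 by simp
  qed
  thus ?thesis by (simp add: f_def \<delta>_def)
qed

lemma integrable_indicator_mult:
  fixes \<phi> :: "complex \<Rightarrow> real"
  assumes [measurable]: "\<phi> \<in> borel_measurable borel" "A \<in> sets borel"
    and bd: "\<And>z. norm z = 1 \<Longrightarrow> 0 \<le> \<phi> z \<and> \<phi> z \<le> M"
  shows "integrable circ (\<lambda>z. indicator A z * \<phi> z)"
proof (rule circ.integrable_const_bound)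
  show "AE z in circ. norm (indicator A z * \<phi> z) \<le> M"
    using AE_circ_norm by eventually_elim (use bd in \<open>force simp: indicator_def\<close>)
qed auto

text \<open>Integrate the dyadic majorant: the ball of index k contributes at most 32 \<eta> / 2^k,
  since its weight decays like 4^-k while the assumed bound on the integral grows like 2^k.\<close>

lemma poisson_integral_small:
  fixes \<phi> :: "complex \<Rightarrow> real"
  assumes u: "norm u = 1" and [measurable]: "\<phi> \<in> borel_measurable borel"
    and bd: "\<And>z. norm z = 1 \<Longrightarrow> 0 \<le> \<phi> z \<and> \<phi> z \<le> M"
    and d: "0 < d" and \<eta>: "0 \<le> \<eta>"
    and small: "\<And>x. 0 < x \<Longrightarrow> x \<le> d \<Longrightarrow> (LINT z|circ. indicator {w. norm (w - u) < x} z * \<phi> z) \<le> \<eta> * x"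
    and s: "0 \<le> s" "s < 1" "1 - s \<le> d"
  shows "(LINT z|circ. poisson (of_real s * u) z * \<phi> z) \<le> 64 * \<eta> + 32 * M * (1 - s) / d\<^sup>2"
proof -
  define \<delta> where "\<delta> = 1 - s"
  have \<delta>: "\<delta> > 0" "\<delta> \<le> d" using s by (auto simp: \<delta>_def)
  obtain n0 where n0: "d / \<delta> < 2 ^ n0" using real_arch_pow[of 2 "d / \<delta>"] by auto
  \<comment> \<open>The predecessor n of m is the largest index with 2^n \<delta> \<le> d, so every
    ball in the majorant has a radius in the range of \<open>small\<close>.\<close>
  define m where "m = (LEAST m. d / \<delta> < 2 ^ m)"
  have m: "d / \<delta> < 2 ^ m" unfolding m_def by (rule LeastI) (rule n0)
  have "m \<noteq> 0"
  proof
    assume "m = 0" thus False using m \<delta> by (simp add: divide_simps)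
  qed
  then obtain n where n: "m = Suc n" by (cases m) auto
  have n1: "d < 2 ^ Suc n * \<delta>" using m n \<delta> by (simp add: divide_simps mult_ac)
  have "\<not> d / \<delta> < 2 ^ n" using not_less_Least[of n "\<lambda>m. d / \<delta> < 2 ^ m"] n by (simp add: m_def)
  hence n2: "2 ^ n * \<delta> \<le> d" using \<delta> by (simp add: divide_simps mult_ac)
  define A where "A = (\<lambda>k. {w. norm (w - u) < 2 ^ k * \<delta>})"
  have [measurable]: "A k \<in> sets borel" for k unfolding A_def by measurable
  have int: "integrable circ (\<lambda>z. indicator (A k) z * \<phi> z)" for k
    by (rule integrable_indicator_mult[OF _ _ bd]) auto
  have int1: "integrable circ \<phi>"
    using integrable_indicator_mult[of \<phi> UNIV M] bd by simp
  have M0: "0 \<le> M" using bd[of 1] by simp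
  have "(LINT z|circ. poisson (of_real s * u) z * \<phi> z) \<le>
      (LINT z|circ. (\<Sum>k\<le>n. 32 / (4 ^ k * \<delta>) * (indicator (A k) z * \<phi> z)) + 32 * \<delta> / d\<^sup>2 * \<phi> z)"
  proof (rule integral_mono_AE)
    have "integrable circ (\<lambda>z. poisson (of_real s * u) z *\<^sub>R \<phi> z)"
    proof (rule integrable_poisson_mult)
      show "AE z in circ. norm (\<phi> z) \<le> M"
        using AE_circ_norm by eventually_elim (use bd in force)
    qed (use u s in \<open>auto simp: norm_of_real_mult_less\<close>)
    thus "integrable circ (\<lambda>z. poisson (of_real s * u) z * \<phi> z)" by simp
    show "integrable circ (\<lambda>z. (\<Sum>k\<le>n. 32 / (4 ^ k * \<delta>) * (indicator (A k) z * \<phi> z)) + 32 * \<delta> / d\<^sup>2 * \<phi> z)"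
      by (intro Bochner_Integration.integrable_add Bochner_Integration.integrable_sum integrable_mult_right int int1)
    show "AE z in circ. poisson (of_real s * u) z * \<phi> z \<le>
       (\<Sum>k\<le>n. 32 / (4 ^ k * \<delta>) * (indicator (A k) z * \<phi> z)) + 32 * \<delta> / d\<^sup>2 * \<phi> z"
      using AE_circ_norm
    proof eventually_elim
      case (elim z)
      have "poisson (of_real s * u) z * \<phi> z \<le> ((\<Sum>k\<le>n. 32 / (4 ^ k * \<delta>) * indicator (A k) z) + 32 * \<delta> / d\<^sup>2) * \<phi> z"
        unfolding A_def \<delta>_def using bd[OF elim] n1 d s u elim
        by (intro mult_right_mono poisson_dyadic_bound) (auto simp: \<delta>_def)
      thus ?case by (simp add: sum_distrib_right distrib_right mult.assoc)
    qed
  qed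
  also have "\<dots> = (\<Sum>k\<le>n. 32 / (4 ^ k * \<delta>) * (LINT z|circ. indicator (A k) z * \<phi> z)) + 32 * \<delta> / d\<^sup>2 * (LINT z|circ. \<phi> z)"
    by (subst Bochner_Integration.integral_add)
       (auto intro!: Bochner_Integration.integrable_sum integrable_mult_right int int1 simp: Bochner_Integration.integral_sum int int1)
  also have "\<dots> \<le> (\<Sum>k\<le>n. 32 / (4 ^ k * \<delta>) * (\<eta> * (2 ^ k * \<delta>))) + 32 * \<delta> / d\<^sup>2 * M"
  proof (intro add_mono sum_mono mult_left_mono)
    fix k assume "k \<in> {..n}"
    hence "2 ^ k * \<delta> \<le> 2 ^ n * \<delta>" using \<delta> by (intro mult_right_mono power_increasing) auto
    thus "(LINT z|circ. indicator (A k) z * \<phi> z) \<le> \<eta> * (2 ^ k * \<delta>)"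
      unfolding A_def using n2 \<delta> by (intro small) (simp, linarith)
  next
    have "(LINT z|circ. \<phi> z) \<le> (LINT z|circ. M)"
    proof (rule integral_mono_AE[OF int1])
      show "AE z in circ. \<phi> z \<le> M" using AE_circ_norm by eventually_elim (use bd in blast)
    qed auto
    thus "(LINT z|circ. \<phi> z) \<le> M" using circ.prob_space by simp
  qed (use \<delta> in auto)
  also have "(\<Sum>k\<le>n. 32 / (4 ^ k * \<delta>) * (\<eta> * (2 ^ k * \<delta>))) = 32 * \<eta> * (\<Sum>k\<le>n. (1/2) ^ k)"
    unfolding sum_distrib_left
  proof (rule sum.cong)
    fix k
    have "(4::real) ^ k = 2 ^ k * 2 ^ k" by (simp flip: power_mult_distrib)
    thus "32 / (4 ^ k * \<delta>) * (\<eta> * (2 ^ k * \<delta>)) = 32 * \<eta> * (1 / 2) ^ k"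
      using \<delta> by (simp add: power_one_over divide_simps)
  qed auto
  also have "\<dots> \<le> 32 * \<eta> * 2"
  proof (intro mult_left_mono)
    have "(\<Sum>k\<le>n. (1/2::real) ^ k) \<le> (\<Sum>k. (1/2) ^ k)"
      by (intro sum_le_suminf) auto
    also have "\<dots> = 2" by (simp add: suminf_geometric)
    finally show "(\<Sum>k\<le>n. (1/2::real) ^ k) \<le> 2" .
  qed (use \<eta> in auto)
  finally show ?thesis by (simp add: \<delta>_def mult_ac)
qed

lemma integral_diff_poisson_le:
  fixes h :: "complex \<Rightarrow> complex"
  assumes u: "norm u = 1" and [measurable]: "h \<in> borel_measurable borel"
    and bd: "\<And>z. norm z = 1 \<Longrightarrow> norm (h z) \<le> M" and a: "norm a < 1"
  shows "norm ((LINT z|circ. of_real (poisson a z) * h z) - h u) \<le> (LINT z|circ. poisson a z * norm (h z - h u))"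
proof -
  have AE: "AE z in circ. norm (h z) \<le> M" using AE_circ_norm by eventually_elim (use bd in auto)
  have i1: "integrable circ (\<lambda>z. of_real (poisson a z) * h z)"
    using integrable_poisson_mult[OF a _ AE] by (simp add: scaleR_conv_of_real)
  have i2: "integrable circ (\<lambda>z. of_real (poisson a z) * h u)"
    using integrable_poisson[OF a] by (intro integrable_mult_left) auto
  have "(LINT z|circ. of_real (poisson a z) * h z) - h u =
        (LINT z|circ. of_real (poisson a z) * h z) - (LINT z|circ. of_real (poisson a z) * h u)"
    using integral_poisson[OF a] by simp
  also have "\<dots> = (LINT z|circ. of_real (poisson a z) * (h z - h u))"
    using i1 i2 by (simp add: right_diff_distrib)
  also have "norm \<dots> \<le> (LINT z|circ. norm (of_real (poisson a z) * (h z - h u)))"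
    by (rule integral_norm_bound)
  also have "\<dots> = (LINT z|circ. poisson a z * norm (h z - h u))"
    using poisson_nonneg[OF a] by (simp add: norm_mult)
  finally show ?thesis .
qed

text \<open>The hypothesis \<open>small\<close> says that u is a Lebesgue point of h, with chords in
  place of arc length.\<close>

lemma poisson_integral_tendsto:
  fixes h :: "complex \<Rightarrow> complex"
  assumes u: "norm u = 1" and meas [measurable]: "h \<in> borel_measurable borel"
    and bd: "\<And>z. norm z = 1 \<Longrightarrow> norm (h z) \<le> M"
    and small: "\<And>\<eta>. \<eta> > 0 \<Longrightarrow> \<exists>d>0. \<forall>x. 0 < x \<and> x \<le> d \<longrightarrow>
        (LINT z|circ. indicator {w. norm (w - u) < x} z * norm (h z - h u)) \<le> \<eta> * x"
  shows "((\<lambda>s. LINT z|circ. of_real (poisson (of_real s * u) z) * h z) \<longlongrightarrow> h u) (at_left 1)"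
proof (rule tendstoI)
  fix e :: real assume e: "e > 0"
  \<comment> \<open>With e / 128 the local term 64 * (e / 128) is e / 2, which leaves e / 2 for the
    far term.\<close>
  obtain d where d: "d > 0" "\<And>x. 0 < x \<Longrightarrow> x \<le> d \<Longrightarrow>
        (LINT z|circ. indicator {w. norm (w - u) < x} z * norm (h z - h u)) \<le> e / 128 * x"
    using small[of "e / 128"] e by auto
  have "((\<lambda>s. 64 * (e / 128) + 32 * (2 * M) * (1 - s) / d\<^sup>2) \<longlongrightarrow> 64 * (e / 128) + 32 * (2 * M) * (1 - 1) / d\<^sup>2) (at_left 1)"
    by (intro tendsto_intros) (use d in auto)
  hence "eventually (\<lambda>s. 64 * (e / 128) + 32 * (2 * M) * (1 - s) / d\<^sup>2 < e) (at_left 1)"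
    by (rule order_tendstoD) (use e in auto)
  moreover have "eventually (\<lambda>s. s \<in> {max 0 (1 - d)<..<1}) (at_left (1::real))"
    by (rule eventually_at_left_real) (use d in auto)
  ultimately show "eventually (\<lambda>s. dist (LINT z|circ. of_real (poisson (of_real s * u) z) * h z) (h u) < e) (at_left 1)"
  proof eventually_elim
    case (elim s)
    have s: "0 \<le> s" "s < 1" "1 - s \<le> d" using elim by auto
    have b2: "norm (h z - h u) \<le> 2 * M" if "norm z = 1" for z
      using norm_triangle_ineq4[of "h z" "h u"] bd[OF that] bd[OF u] by simp
    have "norm ((LINT z|circ. of_real (poisson (of_real s * u) z) * h z) - h u) \<le>
        (LINT z|circ. poisson (of_real s * u) z * norm (h z - h u))"
      by (rule integral_diff_poisson_le[OF u meas bd]) (use u s in \<open>auto simp: norm_mult\<close>)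
    also have "\<dots> \<le> 64 * (e / 128) + 32 * (2 * M) * (1 - s) / d\<^sup>2"
      using u s d e b2 by (intro poisson_integral_small) auto
    finally show ?case using elim by (simp add: dist_norm)
  qed
qed

text \<open>Proved directly rather than through Lebesgue points, which would require the measure of
  arcs: that measure is obtained below from rotation invariance, which itself rests on this
  lemma.\<close>

lemma poisson_integral_tendsto_continuous:
  fixes h :: "complex \<Rightarrow> complex"
  assumes u: "norm u = 1" and cont: "continuous_on UNIV h"
    and bd: "\<And>z. norm z = 1 \<Longrightarrow> norm (h z) \<le> M"
  shows "((\<lambda>s. LINT z|circ. of_real (poisson (of_real s * u) z) * h z) \<longlongrightarrow> h u) (at_left 1)"
proof (rule tendstoI)
  have meas [measurable]: "h \<in> borel_measurable borel"
    using cont by (rule borel_measurable_continuous_onI)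
  fix e :: real assume e: "e > 0"
  obtain d where d: "d > 0" "\<And>z. dist z u < d \<Longrightarrow> dist (h z) (h u) < e / 2"
    using cont e unfolding continuous_on_iff by (metis UNIV_I half_gt_zero)
  have "((\<lambda>s. e / 2 + 2 * M * (8 * (1 - s) / d\<^sup>2)) \<longlongrightarrow> e / 2 + 2 * M * (8 * (1 - 1) / d\<^sup>2)) (at_left 1)"
    by (intro tendsto_intros) (use d in auto)
  hence "eventually (\<lambda>s. e / 2 + 2 * M * (8 * (1 - s) / d\<^sup>2) < e) (at_left 1)"
    by (rule order_tendstoD) (use e in auto)
  moreover have "eventually (\<lambda>s. s \<in> {0<..<1}) (at_left (1::real))"
    by (rule eventually_at_left_real) (use d in auto)
  ultimately show "eventually (\<lambda>s. dist (LINT z|circ. of_real (poisson (of_real s * u) z) * h z) (h u) < e) (at_left 1)"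
  proof eventually_elim
    case (elim s)
    have s: "0 \<le> s" "s < 1" using elim by auto
    let ?a = "of_real s * u"
    have a: "norm ?a < 1" using u s by (rule norm_of_real_mult_less)
    have M: "0 \<le> M" using bd[OF u] norm_ge_zero order_trans by blast
    have b2: "norm (h z - h u) \<le> 2 * M" if "norm z = 1" for z
      using norm_triangle_ineq4[of "h z" "h u"] bd[OF that] bd[OF u] by simp
    have "norm ((LINT z|circ. of_real (poisson ?a z) * h z) - h u) \<le>
        (LINT z|circ. poisson ?a z * norm (h z - h u))"
      by (rule integral_diff_poisson_le[OF u meas bd a])
    also have "\<dots> \<le> (LINT z|circ. e / 2 * poisson ?a z + 2 * M * (8 * (1 - s) / d\<^sup>2))"
    proof (rule integral_mono_AE)
      have "integrable circ (\<lambda>z. poisson ?a z *\<^sub>R norm (h z - h u))"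
        using AE_circ_norm b2 by (intro integrable_poisson_mult[OF a, of _ "2 * M"]) (auto elim!: eventually_mono)
      thus "integrable circ (\<lambda>z. poisson ?a z * norm (h z - h u))" by simp
      show "integrable circ (\<lambda>z. e / 2 * poisson ?a z + 2 * M * (8 * (1 - s) / d\<^sup>2))"
        using integrable_poisson[OF a] by (intro Bochner_Integration.integrable_add integrable_mult_right) auto
      show "AE z in circ. poisson ?a z * norm (h z - h u) \<le> e / 2 * poisson ?a z + 2 * M * (8 * (1 - s) / d\<^sup>2)"
        using AE_circ_norm
      proof eventually_elim
        case (elim z)
        have P: "0 \<le> poisson ?a z" using a by (rule poisson_nonneg)
        show ?case
        proof (cases "dist z u < d")
          case True
          hence "poisson ?a z * norm (h z - h u) \<le> poisson ?a z * (e / 2)"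
            using d(2)[of z] P by (intro mult_left_mono) (auto simp: dist_norm)
          moreover have "0 \<le> 2 * M * (8 * (1 - s) / d\<^sup>2)" using M s by simp
          ultimately show ?thesis by (simp add: mult_ac)
        next
          case False
          hence f: "d \<le> norm (z - u)" by (simp add: dist_norm)
          have "poisson ?a z \<le> 8 * (1 - s) / (norm (z - u))\<^sup>2"
            by (rule poisson_radial_le(2)[OF u elim s]) (use f d in auto)
          also have "\<dots> \<le> 8 * (1 - s) / d\<^sup>2"
            using f d s by (intro divide_left_mono power_mono mult_pos_pos zero_less_power) auto
          finally have "poisson ?a z * norm (h z - h u) \<le> 8 * (1 - s) / d\<^sup>2 * (2 * M)"
            using b2[OF elim] P s by (intro mult_mono) auto
          moreover have "0 \<le> e / 2 * poisson ?a z" using P e by simp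
          ultimately show ?thesis by (simp only: mult_ac)
        qed
      qed
    qed
    also have "\<dots> = e / 2 + 2 * M * (8 * (1 - s) / d\<^sup>2)"
      using integrable_poisson[OF a] integral_poisson[OF a] circ.prob_space by simp
    finally show ?case using elim by (simp add: dist_norm)
  qed
qed


section \<open>Transport of harmonic measure by boundary maps\<close>

text \<open>The Poisson integrals of \<phi> are bounded by 1 and converge to \<phi> on the circle;
  Fubini and \<open>poisson_swap\<close> then move the kernel from \<phi> to \<nu>. So integrals
  against \<nu> are recovered from its Poisson integrals.\<close>

lemma nn_integral_continuous_eq_lim_poisson:
  fixes \<phi> :: "complex \<Rightarrow> real"
  assumes "finite_measure \<nu>" and sets [measurable_cong]: "sets \<nu> = sets borel"
    and \<nu>1: "AE z in \<nu>. norm z = 1"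
    and cont: "continuous_on UNIV \<phi>" and bd: "\<And>z. 0 \<le> \<phi> z \<and> \<phi> z \<le> 1"
  shows "(\<lambda>n. \<integral>\<^sup>+w. ennreal (\<phi> w) * (\<integral>\<^sup>+z. ennreal (poisson (of_real (1 - 1 / real (n + 2)) * w) z) \<partial>\<nu>) \<partial>circ)
     \<longlonglongrightarrow> (\<integral>\<^sup>+z. ennreal (\<phi> z) \<partial>\<nu>)"
proof -
  interpret \<nu>: finite_measure \<nu> by fact
  interpret P: pair_sigma_finite \<nu> circ ..
  define \<rho> where "\<rho> = (\<lambda>n::nat. 1 - 1 / real (n + 2))"
  have \<rho>: "0 < \<rho> n" "\<rho> n < 1" for n by (auto simp: \<rho>_def)
  have [measurable]: "\<phi> \<in> borel_measurable borel"
    using cont by (rule borel_measurable_continuous_onI)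
  define u where "u = (\<lambda>n z. \<integral>\<^sup>+w. ennreal (poisson (of_real (\<rho> n) * z) w) * ennreal (\<phi> w) \<partial>circ)"
  have [measurable]: "u n \<in> borel_measurable borel" for n
    unfolding u_def by measurable
  have u_eq: "u n z = ennreal (LINT w|circ. poisson (of_real (\<rho> n) * z) w * \<phi> w)" if z: "norm z = 1" for n z
  proof -
    have a: "norm (of_real (\<rho> n) * z) < 1" using z \<rho>[of n] by (intro norm_of_real_mult_less) auto
    have "integrable circ (\<lambda>w. poisson (of_real (\<rho> n) * z) w *\<^sub>R \<phi> w)"
      using bd by (intro integrable_poisson_mult[OF a, of _ 1]) auto
    hence "(\<integral>\<^sup>+w. ennreal (poisson (of_real (\<rho> n) * z) w * \<phi> w) \<partial>circ) = 
        ennreal (LINT w|circ. poisson (of_real (\<rho> n) * z) w * \<phi> w)"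
      using bd poisson_nonneg[OF a] by (intro nn_integral_eq_integral) auto
    thus ?thesis using bd poisson_nonneg[OF a] by (simp add: u_def ennreal_mult')
  qed
  have "(\<lambda>n. \<integral>\<^sup>+z. u n z \<partial>\<nu>) \<longlonglongrightarrow> (\<integral>\<^sup>+z. ennreal (\<phi> z) \<partial>\<nu>)"
  proof (rule nn_integral_dominated_convergence[where w = "\<lambda>_. 1"])
    show "AE z in \<nu>. u n z \<le> 1" for n
      using \<nu>1
    proof eventually_elim
      case (elim z)
      have a: "norm (of_real (\<rho> n) * z) < 1" using elim \<rho>[of n] by (intro norm_of_real_mult_less) auto
      have "u n z \<le> (\<integral>\<^sup>+w. ennreal (poisson (of_real (\<rho> n) * z) w) \<partial>circ)"
        unfolding u_def using bd by (intro nn_integral_mono) (auto intro!: mult_left_le)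
      thus ?case using nn_integral_poisson[OF a] by simp
    qed
    show "AE z in \<nu>. (\<lambda>n. u n z) \<longlonglongrightarrow> ennreal (\<phi> z)"
      using \<nu>1
    proof eventually_elim
      case (elim z)
      have "((\<lambda>s. LINT w|circ. complex_of_real (poisson (of_real s * z) w) * of_real (\<phi> w)) \<longlongrightarrow> of_real (\<phi> z)) (at_left 1)"
        using bd by (intro poisson_integral_tendsto_continuous[OF elim, of _ 1] continuous_intros cont) auto
      hence "((\<lambda>s. complex_of_real (LINT w|circ. poisson (of_real s * z) w * \<phi> w)) \<longlongrightarrow> of_real (\<phi> z)) (at_left 1)"
        by (simp flip: of_real_mult)
      hence "((\<lambda>s. LINT w|circ. poisson (of_real s * z) w * \<phi> w) \<longlongrightarrow> \<phi> z) (at_left 1)"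
        by (simp only: tendsto_of_real_iff)
      from filterlim_compose[OF this eventually_at_left_1_subseq]
      have "(\<lambda>n. LINT w|circ. poisson (of_real (\<rho> n) * z) w * \<phi> w) \<longlonglongrightarrow> \<phi> z"
        by (simp add: \<rho>_def)
      thus ?case unfolding u_eq[OF elim] by (rule tendsto_ennrealI)
    qed
    show "(\<integral>\<^sup>+z. 1 \<partial>\<nu>) < \<infinity>" by (simp add: less_top[symmetric])
  qed auto
  moreover have "(\<integral>\<^sup>+z. u n z \<partial>\<nu>) =
      (\<integral>\<^sup>+w. ennreal (\<phi> w) * (\<integral>\<^sup>+z. ennreal (poisson (of_real (\<rho> n) * w) z) \<partial>\<nu>) \<partial>circ)" for n
  proof -
    have "(\<integral>\<^sup>+z. u n z \<partial>\<nu>) = (\<integral>\<^sup>+w. (\<integral>\<^sup>+z. ennreal (poisson (of_real (\<rho> n) * z) w) * ennreal (\<phi> w) \<partial>\<nu>) \<partial>circ)"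
      unfolding u_def by (rule P.Fubini'[symmetric]) measurable
    also have "\<dots> = (\<integral>\<^sup>+w. ennreal (\<phi> w) * (\<integral>\<^sup>+z. ennreal (poisson (of_real (\<rho> n) * w) z) \<partial>\<nu>) \<partial>circ)"
    proof (rule nn_integral_cong_AE)
      show "AE w in circ. (\<integral>\<^sup>+z. ennreal (poisson (of_real (\<rho> n) * z) w) * ennreal (\<phi> w) \<partial>\<nu>) =
          ennreal (\<phi> w) * (\<integral>\<^sup>+z. ennreal (poisson (of_real (\<rho> n) * w) z) \<partial>\<nu>)"
        using AE_circ_norm
      proof eventually_elim
        case (elim w)
        have "(\<integral>\<^sup>+z. ennreal (poisson (of_real (\<rho> n) * z) w) * ennreal (\<phi> w) \<partial>\<nu>) =
          (\<integral>\<^sup>+z. ennreal (\<phi> w) * ennreal (poisson (of_real (\<rho> n) * w) z) \<partial>\<nu>)"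
        proof (rule nn_integral_cong_AE)
          show "AE z in \<nu>. ennreal (poisson (of_real (\<rho> n) * z) w) * ennreal (\<phi> w) =
              ennreal (\<phi> w) * ennreal (poisson (of_real (\<rho> n) * w) z)"
            using \<nu>1 by eventually_elim (simp add: poisson_swap[OF elim] mult.commute[of "ennreal (\<phi> w)"])
        qed
        also have "\<dots> = ennreal (\<phi> w) * (\<integral>\<^sup>+z. ennreal (poisson (of_real (\<rho> n) * w) z) \<partial>\<nu>)"
          by (rule nn_integral_cmult) measurable
        finally show ?case .
      qed
    qed
    finally show ?thesis .
  qed
  ultimately show ?thesis by (simp add: \<rho>_def)
qed

text \<open>Poisson integrals determine the integrals of continuous functions by the preceding
  limit, and these determine the measure of open sets.\<close>

lemma measure_eqI_poisson:
  assumes "finite_measure \<mu>" "finite_measure \<nu>"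
    and sets: "sets \<mu> = sets borel" "sets \<nu> = sets borel"
    and supp: "AE z in \<mu>. norm z = 1" "AE z in \<nu>. norm z = 1"
    and eq: "\<And>b. norm b < 1 \<Longrightarrow>
      (\<integral>\<^sup>+z. ennreal (poisson b z) \<partial>\<mu>) = (\<integral>\<^sup>+z. ennreal (poisson b z) \<partial>\<nu>)"
  shows "\<mu> = \<nu>"
proof -
  interpret \<nu>: finite_measure \<nu> by fact
  note [measurable_cong] = sets
  have cont_eq: "(\<integral>\<^sup>+z. ennreal (\<phi> z) \<partial>\<mu>) = (\<integral>\<^sup>+z. ennreal (\<phi> z) \<partial>\<nu>)"
    if "continuous_on UNIV \<phi>" "\<And>z. 0 \<le> \<phi> z \<and> \<phi> z \<le> 1" for \<phi> :: "complex \<Rightarrow> real"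
  proof -
    define c where "c = (\<lambda>\<nu> n. \<integral>\<^sup>+w. ennreal (\<phi> w) *
        (\<integral>\<^sup>+z. ennreal (poisson (of_real (1 - 1 / real (n + 2)) * w) z) \<partial>\<nu>) \<partial>circ)"
    have "c \<mu> n = c \<nu> n" for n
      unfolding c_def
    proof (rule nn_integral_cong_AE)
      show "AE w in circ. ennreal (\<phi> w) * (\<integral>\<^sup>+z. ennreal (poisson (of_real (1 - 1 / real (n + 2)) * w) z) \<partial>\<mu>) =
        ennreal (\<phi> w) * (\<integral>\<^sup>+z. ennreal (poisson (of_real (1 - 1 / real (n + 2)) * w) z) \<partial>\<nu>)"
        using AE_circ_norm
        by eventually_elim (subst eq, auto intro!: norm_of_real_mult_less simp del: of_real_diff of_real_divide of_nat_add)
    qed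
    moreover have "c \<mu> \<longlonglongrightarrow> (\<integral>\<^sup>+z. ennreal (\<phi> z) \<partial>\<mu>)" "c \<nu> \<longlonglongrightarrow> (\<integral>\<^sup>+z. ennreal (\<phi> z) \<partial>\<nu>)"
      unfolding c_def by (intro nn_integral_continuous_eq_lim_poisson assms that)+
    ultimately show ?thesis by (metis LIMSEQ_unique ext)
  qed
  have open_eq: "emeasure \<mu> U = emeasure \<nu> U" if U: "open U" for U
  proof (cases "U = UNIV")
    case True
    thus ?thesis using cont_eq[of "\<lambda>_. 1"] sets_eq_imp_space_eq[OF sets(1)] sets_eq_imp_space_eq[OF sets(2)] by simp
  next
    case False
    hence ne: "- U \<noteq> {}" by auto
    \<comment> \<open>Continuous functions increasing to the indicator of U. The case of the whole
      plane is separate because \<open>infdist\<close> from the empty set is 0 by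
      convention.\<close>
    define \<phi> where "\<phi> = (\<lambda>n z. min 1 (real n * infdist z (- U)))"
    have cont: "continuous_on UNIV (\<phi> n)" for n
      unfolding \<phi>_def by (intro continuous_intros)
    have [measurable]: "\<phi> n \<in> borel_measurable borel" for n
      using cont by (rule borel_measurable_continuous_onI)
    have lim: "(SUP n. ennreal (\<phi> n z)) = indicator U z" for z
    proof (rule SUP_eqI)
      show "ennreal (\<phi> n z) \<le> indicator U z" for n
        by (cases "z \<in> U") (auto simp: \<phi>_def infdist_zero)
    next
      fix y assume y: "\<And>n. n \<in> UNIV \<Longrightarrow> ennreal (\<phi> n z) \<le> y"
      show "indicator U z \<le> y"
      proof (cases "z \<in> U")
        case True
        have "infdist z (- U) \<noteq> 0"
          using in_closed_iff_infdist_zero[of "- U" z] U ne True by auto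
        hence "infdist z (- U) > 0" by (simp add: order_less_le infdist_nonneg)
        then obtain n where "real n * infdist z (- U) > 1"
          using ex_less_of_nat_mult by blast
        hence "\<phi> n z = 1" by (simp add: \<phi>_def)
        thus ?thesis using y[of n] True by simp
      qed simp
    qed
    have inc: "incseq (\<lambda>n z. ennreal (\<phi> n z))"
      by (auto simp: incseq_def le_fun_def \<phi>_def intro!: ennreal_leI min.mono mult_right_mono infdist_nonneg)
    have "emeasure \<kappa> U = (SUP n. \<integral>\<^sup>+z. ennreal (\<phi> n z) \<partial>\<kappa>)"
      if [measurable_cong]: "sets \<kappa> = sets borel" for \<kappa> :: "complex measure"
    proof -
      have "emeasure \<kappa> U = (\<integral>\<^sup>+z. (SUP n. ennreal (\<phi> n z)) \<partial>\<kappa>)"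
        unfolding lim using U that by simp
      also have "\<dots> = (SUP n. \<integral>\<^sup>+z. ennreal (\<phi> n z) \<partial>\<kappa>)"
        by (rule nn_integral_monotone_convergence_SUP[OF inc]) measurable
      finally show ?thesis .
    qed
    moreover have "(\<integral>\<^sup>+z. ennreal (\<phi> n z) \<partial>\<mu>) = (\<integral>\<^sup>+z. ennreal (\<phi> n z) \<partial>\<nu>)" for n
      by (intro cont_eq cont) (auto simp: \<phi>_def infdist_nonneg)
    ultimately show ?thesis using sets by simp
  qed
  show ?thesis
  proof (rule measure_eqI_generator_eq[where E = "{U. open U}" and \<Omega> = UNIV and A = "\<lambda>_. UNIV"])
    show "sets \<mu> = sigma_sets UNIV {U. open U}" "sets \<nu> = sigma_sets UNIV {U. open U}"
      using sets by (auto simp: borel_def)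
  qed (auto simp: Int_stable_def open_eq)
qed

text \<open>The Herglotz kernel, written so as to be holomorphic in w for fixed b. It is on the
  circle that its real part is the Poisson kernel, which is where boundary values are
  tested.\<close>

definition herglotz :: "complex \<Rightarrow> complex \<Rightarrow> complex" where
  "herglotz b w = (1 + cnj b * w) / (1 - cnj b * w)"

lemma Re_herglotz:
  assumes "norm b < 1" "norm w = 1" shows "Re (herglotz b w) = poisson b w"
proof -
  have "complex_of_real (Re (herglotz b w)) = (herglotz b w + cnj (herglotz b w)) / 2"
    by (simp add: complex_add_cnj)
  also have "\<dots> = of_real (poisson b w)"
  proof -
    have w: "w * cnj w = 1" using assms by (simp add: complex_norm_square[symmetric])
    have 1: "1 - cnj b * w \<noteq> 0" using assms by (intro one_minus_cnj_mult_nonzero) auto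
    have 2: "1 - b * cnj w \<noteq> 0" using assms one_minus_cnj_mult_nonzero[of "cnj b" "cnj w"] by simp
    have 3: "w \<noteq> 0" "w \<noteq> b" using assms by auto
    have 4: "complex_of_real ((norm b)\<^sup>2) = b * cnj b" by (simp only: complex_norm_square)
    have 5: "w - b = w * (1 - b * cnj w)" using w by (simp add: algebra_simps)
    have 6: "(herglotz b w + cnj (herglotz b w)) / 2 = (1 - (b * cnj b) * (w * cnj w)) / ((1 - b * cnj w) * (1 - cnj b * w))"
      unfolding herglotz_def using 1 2 by (simp add: divide_simps) (simp add: algebra_simps)
    show ?thesis
      unfolding poisson_circle_eq[OF assms(2,1)] 6 w 4[symmetric] using 1 2 3(1) 
      by (subst 5) simp
  qed
  finally show ?thesis by (simp only: of_real_eq_iff)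
qed

lemma herglotz_holomorphic:
  assumes b: "norm b < 1" shows "herglotz b holomorphic_on ball 0 1"
  unfolding herglotz_def using one_minus_cnj_mult_nonzero[OF b]
  by (intro holomorphic_intros) auto

lemma norm_herglotz_le:
  assumes b: "norm b < 1" "norm w \<le> 1" shows "norm (herglotz b w) \<le> 2 / (1 - norm b)"
proof -
  have bw: "norm (cnj b * w) \<le> norm b" using assms by (simp add: norm_mult mult_left_le)
  have "norm (1 + cnj b * w) \<le> 2" using norm_triangle_ineq[of 1 "cnj b * w"] bw b by simp
  moreover have "1 - norm b \<le> norm (1 - cnj b * w)"
    using norm_triangle_ineq2[of 1 "cnj b * w"] bw by simp
  ultimately show ?thesis
    unfolding herglotz_def norm_divide using b by (intro frac_le) auto
qed

lemma continuous_herglotz: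
  assumes "norm b < 1" "norm w \<le> 1" shows "isCont (herglotz b) w"
  unfolding herglotz_def using one_minus_cnj_mult_nonzero[OF assms]
  by (intro continuous_intros) auto

text \<open>An inner function together with a Borel representative of its boundary map that is
  unimodular everywhere. Preimages under boundary maps and compositions of them are then measurable
  without tracking null sets.\<close>

definition radial_boundary :: "(complex \<Rightarrow> complex) \<Rightarrow> (complex \<Rightarrow> complex) \<Rightarrow> bool" where
  "radial_boundary f g \<longleftrightarrow> g \<in> borel_measurable borel \<and> (\<forall>z. norm (g z) = 1) \<and>
     f holomorphic_on ball 0 1 \<and> f ` ball 0 1 \<subseteq> ball 0 1 \<and>
     (AE z in circ. ((\<lambda>t. f (complex_of_real t * z)) \<longlongrightarrow> g z) (at_left 1))"

lemma herglotz_measurable [measurable]: "herglotz b \<in> borel_measurable borel"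
  unfolding herglotz_def by measurable

text \<open>\<open>herglotz b\<close> composed with f is bounded and holomorphic, with radial limits
  \<open>herglotz b\<close> of g, so its boundary values represent it; real parts give the claim.
  The result depends on f and a only through \<open>f a\<close>, which is what identifies the image
  measure.\<close>

lemma nn_integral_poisson_boundary:
  assumes fg: "radial_boundary f g" and a: "norm a < 1" and b: "norm b < 1"
  shows "(\<integral>\<^sup>+z. ennreal (poisson a z) * ennreal (poisson b (g z)) \<partial>circ) = ennreal (Re (herglotz b (f a)))"
proof -
  have [measurable]: "g \<in> borel_measurable borel" and g: "\<And>z. norm (g z) = 1"
    and hol: "f holomorphic_on ball 0 1" and ball: "f ` ball 0 1 \<subseteq> ball 0 1"
    and lim: "AE z in circ. ((\<lambda>t. f (complex_of_real t * z)) \<longlongrightarrow> g z) (at_left 1)"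
    using fg by (auto simp: radial_boundary_def)
  have "(LINT z|circ. of_real (poisson a z) * herglotz b (g z)) = herglotz b (f a)"
  proof (rule poisson_representation[where B = "2 / (1 - norm b)"])
    show "(\<lambda>z. herglotz b (f z)) holomorphic_on ball 0 1"
      using holomorphic_on_compose_gen[OF hol herglotz_holomorphic[OF b] ball] by (simp add: o_def)
    show "norm (herglotz b (f z)) \<le> 2 / (1 - norm b)" if "norm z < 1" for z
      using ball that by (intro norm_herglotz_le b) (auto simp: image_subset_iff less_imp_le)
    show "AE z in circ. ((\<lambda>t. herglotz b (f (complex_of_real t * z))) \<longlongrightarrow> herglotz b (g z)) (at_left 1)"
      using lim by eventually_elim (rule isCont_tendsto_compose, use b g in \<open>auto intro: continuous_herglotz\<close>)
  qed (use a in auto)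
  moreover have int: "integrable circ (\<lambda>z. poisson a z *\<^sub>R herglotz b (g z))"
    using norm_herglotz_le[OF b] g by (intro integrable_poisson_mult[OF a, of _ "2 / (1 - norm b)"]) auto
  ultimately have "(LINT z|circ. Re (poisson a z *\<^sub>R herglotz b (g z))) = Re (herglotz b (f a))"
    by (subst integral_Re) (auto simp: scaleR_conv_of_real)
  hence "(LINT z|circ. poisson a z * poisson b (g z)) = Re (herglotz b (f a))"
    using g b by (simp add: Re_herglotz)
  moreover have "integrable circ (\<lambda>z. Re (poisson a z *\<^sub>R herglotz b (g z)))"
    using int by (rule integrable_Re)
  hence "integrable circ (\<lambda>z. poisson a z * poisson b (g z))"
    using g b by (simp add: Re_herglotz)
  ultimately show ?thesis
    using poisson_nonneg[OF a] poisson_nonneg[OF b]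
    by (simp add: nn_integral_eq_integral flip: ennreal_mult)
qed

text \<open>The identity taken at the pole \<open>f a\<close> produces the same value as f taken at
  a; this evaluates the target measure in \<open>distr_poisson_measure\<close>. The value 1 off the
  circle keeps the map unimodular everywhere.\<close>

lemma radial_boundary_id: "radial_boundary id (\<lambda>z. if norm z = 1 then z else 1)"
proof -
  have "AE z in circ. ((\<lambda>t. id (complex_of_real t * z)) \<longlongrightarrow> (if norm z = 1 then z else 1)) (at_left 1)"
    using AE_circ_norm
  proof eventually_elim
    case (elim z)
    have "((\<lambda>t. complex_of_real t * z) \<longlongrightarrow> of_real 1 * z) (at_left 1)" by (intro tendsto_intros)
    thus ?case using elim by simp
  qed
  thus ?thesis by (auto simp: radial_boundary_def)
qed

definition poisson_measure :: "complex \<Rightarrow> complex measure" where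
  "poisson_measure a = density circ (\<lambda>z. ennreal (poisson a z))"

lemma sets_poisson_measure [simp, measurable_cong]: "sets (poisson_measure a) = sets borel"
  and space_poisson_measure [simp]: "space (poisson_measure a) = UNIV"
  by (simp_all add: poisson_measure_def)

lemma nn_integral_poisson_measure:
  "h \<in> borel_measurable borel \<Longrightarrow>
    (\<integral>\<^sup>+z. h z \<partial>poisson_measure a) = (\<integral>\<^sup>+z. ennreal (poisson a z) * h z \<partial>circ)"
  unfolding poisson_measure_def by (rule nn_integral_density) measurable

lemma prob_space_poisson_measure: "norm a < 1 \<Longrightarrow> prob_space (poisson_measure a)"
  by (rule prob_spaceI) (simp add: nn_integral_poisson emeasure_density poisson_measure_def)

lemma AE_poisson_measure: "AE z in circ. P z \<Longrightarrow> AE z in poisson_measure a. P z"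
  unfolding poisson_measure_def by (subst AE_density) (auto elim: eventually_mono)

lemma poisson_measure_0: "poisson_measure 0 = circ"
proof -
  have "poisson_measure 0 = density circ (\<lambda>_. 1)"
    unfolding poisson_measure_def using AE_circ_norm
    by (intro density_cong) (auto elim!: eventually_mono simp: poisson_def)
  thus ?thesis by (simp add: density_1)
qed

text \<open>Loewner's lemma; for \<open>a = f a = 0\<close> it says that \<open>g\<close> preserves normalised Lebesgue measure.\<close>

lemma distr_poisson_measure:
  assumes fg: "radial_boundary f g" and a: "norm a < 1"
  shows "distr (poisson_measure a) borel g = poisson_measure (f a)"
proof (rule measure_eqI_poisson)
  have [measurable]: "g \<in> borel_measurable borel" and g: "\<And>z. norm (g z) = 1"
    and fa: "norm (f a) < 1"
    using fg a by (auto simp: radial_boundary_def image_subset_iff)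
  interpret A: prob_space "poisson_measure a" using a by (rule prob_space_poisson_measure)
  interpret FA: prob_space "poisson_measure (f a)" using fa by (rule prob_space_poisson_measure)
  interpret D: prob_space "distr (poisson_measure a) borel g"
    by (rule A.prob_space_distr) measurable
  show "finite_measure (distr (poisson_measure a) borel g)" "finite_measure (poisson_measure (f a))"
    by unfold_locales
  show "AE z in distr (poisson_measure a) borel g. cmod z = 1"
    using g by (subst AE_distr_iff) auto
  show "AE z in poisson_measure (f a). cmod z = 1"
    using AE_circ_norm by (rule AE_poisson_measure)
  fix b :: complex assume b: "norm b < 1"
  have "(\<integral>\<^sup>+z. ennreal (poisson b z) \<partial>distr (poisson_measure a) borel g) = ennreal (Re (herglotz b (f a)))"
    using nn_integral_poisson_boundary[OF fg a b]
    by (simp add: nn_integral_distr nn_integral_poisson_measure)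
  also have "\<dots> = (\<integral>\<^sup>+z. ennreal (poisson (f a) z) * ennreal (poisson b (if norm z = 1 then z else 1)) \<partial>circ)"
    using nn_integral_poisson_boundary[OF radial_boundary_id fa b] by simp
  also have "\<dots> = (\<integral>\<^sup>+z. ennreal (poisson b z) \<partial>poisson_measure (f a))"
    using AE_circ_norm
    by (subst nn_integral_poisson_measure) (auto intro!: nn_integral_cong_AE elim!: eventually_mono)
  finally show "(\<integral>\<^sup>+z. ennreal (poisson b z) \<partial>distr (poisson_measure a) borel g) =
    (\<integral>\<^sup>+z. ennreal (poisson b z) \<partial>poisson_measure (f a))" .
qed auto


section \<open>Arcs\<close>

text \<open>Jordan's inequality: the concave sine lies above its chord on [0, pi / 2].\<close>

lemma sin_ge_linear:
  assumes "0 \<le> x" "x \<le> pi / 2" shows "2 * x / pi \<le> sin x"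
proof -
  have "concave_on {0..pi / 2} sin"
  proof (rule f''_le0_imp_concave[where f' = cos and f'' = "\<lambda>x. - sin x"])
    fix x :: real assume "x \<in> {0..pi / 2}"
    thus "- sin x \<le> 0" using sin_ge_zero[of x] by simp
  qed (auto intro!: derivative_eq_intros)
  from concave_onD[OF this, of "2 * x / pi" 0 "pi / 2"] show ?thesis
    using assms by (simp add: divide_simps)
qed

lemma norm_cis_diff: "norm (cis a - cis b) = 2 * \<bar>sin ((a - b) / 2)\<bar>"
proof -
  have "cis a - cis b = cis b * (cis (a - b) - 1)"
    by (simp add: algebra_simps cis_mult)
  hence "norm (cis a - cis b) = norm (cis (a - b) - 1)" by (simp add: norm_mult)
  also have "\<dots> = 2 * \<bar>sin ((a - b) / 2)\<bar>"
    using dist_exp_i_1[of "a - b"] by (simp add: cis_conv_exp)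
  finally show ?thesis .
qed

text \<open>The angle has to stay away both from 0 and from a full turn. In the metric of diameter
  1, points at distance e then span a chord of length at least 2 e.\<close>

lemma norm_cis_diff_ge:
  assumes "pi * e \<le> \<bar>a - b\<bar>" "\<bar>a - b\<bar> \<le> 2 * pi - pi * e" "0 \<le> e"
  shows "2 * e \<le> norm (cis a - cis b)"
proof -
  define x where "x = \<bar>a - b\<bar> / 2"
  have x: "pi * e / 2 \<le> x" "x \<le> pi - pi * e / 2" using assms by (auto simp: x_def)
  have e1: "pi * e / 2 \<le> pi / 2" using x by linarith
  have "e = 2 * (pi * e / 2) / pi" by simp
  also have "\<dots> \<le> sin (pi * e / 2)"
    using assms e1 by (intro sin_ge_linear) auto
  also have "\<dots> \<le> sin x"
  proof (cases "x \<le> pi / 2")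
    case True
    thus ?thesis using x e1 assms by (intro sin_monotone_2pi_le) (auto, smt (verit) pi_gt_zero mult_nonneg_nonneg)
  next
    case False
    have "sin (pi * e / 2) \<le> sin (pi - x)"
      using False x assms by (intro sin_monotone_2pi_le) (auto, smt (verit) pi_gt_zero mult_nonneg_nonneg)
    thus ?thesis by simp
  qed
  finally have "e \<le> \<bar>sin x\<bar>" by simp
  also have "\<bar>sin x\<bar> = \<bar>sin ((a - b) / 2)\<bar>" 
  proof -
    have "x = (a - b) / 2 \<or> x = - ((a - b) / 2)" unfolding x_def by linarith
    thus ?thesis by (metis sin_minus abs_minus_cancel)
  qed
  finally show ?thesis by (simp add: norm_cis_diff)
qed

lemma abs_Arg_eq_arccos: "norm z = 1 \<Longrightarrow> \<bar>Arg z\<bar> = arccos (Re z)"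
proof -
  assume z: "norm z = 1"
  have "arccos (cos \<bar>Arg z\<bar>) = \<bar>Arg z\<bar>"
    using mpi_less_Arg[of z] Arg_le_pi[of z] by (intro arccos_cos) auto
  moreover have "cos \<bar>Arg z\<bar> = Re z" using z by (subst cos_abs_real) (subst cos_Arg, auto)
  ultimately show ?thesis by simp
qed

lemma Re_divide_circle: "norm w = 1 \<Longrightarrow> Re (c / w) = c \<bullet> w"
  by (simp add: Re_divide cmod_def inner_complex_def)

lemma circle_dist_eq: "norm c = 1 \<Longrightarrow> norm w = 1 \<Longrightarrow> circle_dist c w = arccos (c \<bullet> w) / pi"
  unfolding circle_dist_def by (subst abs_Arg_eq_arccos) (auto simp: norm_divide Re_divide_circle)

lemma circle_dist_commute: "norm c = 1 \<Longrightarrow> norm w = 1 \<Longrightarrow> circle_dist c w = circle_dist w c"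
  by (simp add: circle_dist_eq inner_commute)

lemma inner_circle_bounds:
  fixes c w :: complex
  assumes "norm c = 1" "norm w = 1" shows "- 1 \<le> c \<bullet> w" "c \<bullet> w \<le> 1"
  using Cauchy_Schwarz_ineq2[of c w] assms by auto

lemma circle_dist_le_1: "norm c = 1 \<Longrightarrow> norm w = 1 \<Longrightarrow> circle_dist c w \<le> 1"
  using inner_circle_bounds[of c w] arccos_ubound[of "c \<bullet> w"] by (simp add: circle_dist_eq)

lemma circle_dist_nonneg: "0 \<le> circle_dist c w"
  by (simp add: circle_dist_def)

text \<open>An arc is cut out of the circle by an open half plane; Borel measurability of arcs
  follows from this form.\<close>

lemma circle_ball_eq:
  assumes c: "norm c = 1" and \<rho>: "0 < \<rho>" "\<rho> \<le> 1"
  shows "circle_ball c \<rho> = {w \<in> sphere 0 1. cos (pi * \<rho>) < c \<bullet> w}"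
proof -
  have "circle_dist c w < \<rho> \<longleftrightarrow> cos (pi * \<rho>) < c \<bullet> w" if w: "norm w = 1" for w
  proof -
    have "circle_dist c w < \<rho> \<longleftrightarrow> arccos (c \<bullet> w) < pi * \<rho>"
      using c w by (simp add: circle_dist_eq divide_simps mult.commute)
    also have "\<dots> \<longleftrightarrow> arccos (c \<bullet> w) < arccos (cos (pi * \<rho>))"
      using \<rho> by (subst arccos_cos) auto
    also have "\<dots> \<longleftrightarrow> cos (pi * \<rho>) < c \<bullet> w"
      using inner_circle_bounds[OF c w] by (intro arccos_less_mono) (auto simp: abs_le_iff)
    finally show ?thesis .
  qed
  thus ?thesis by (auto simp: circle_ball_def)
qed

lemma circle_ball_gt_1: "norm c = 1 \<Longrightarrow> 1 < \<rho> \<Longrightarrow> circle_ball c \<rho> = sphere 0 1"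
  unfolding circle_ball_def by (force intro: le_less_trans[OF circle_dist_le_1])

lemma circle_ball_nonpos: "\<rho> \<le> 0 \<Longrightarrow> circle_ball c \<rho> = {}"
  using circle_dist_nonneg by (force simp: circle_ball_def not_less intro: order_trans)

lemma circle_ball_measurable [measurable]:
  assumes "norm c = 1" shows "circle_ball c \<rho> \<in> sets borel"
proof -
  consider "\<rho> \<le> 0" | "0 < \<rho>" "\<rho> \<le> 1" | "1 < \<rho>" by linarith
  thus ?thesis
  proof cases
    case 2
    have "{w :: complex. cos (pi * \<rho>) < c \<bullet> w} \<in> sets borel" by measurable
    hence "sphere 0 1 \<inter> {w. cos (pi * \<rho>) < c \<bullet> w} \<in> sets borel" by (intro sets.Int) auto
    thus ?thesis using assms 2 by (simp add: circle_ball_eq Int_def)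
  qed (use assms in \<open>auto simp: circle_ball_gt_1 circle_ball_nonpos\<close>)
qed

text \<open>Rotations are inner functions fixing 0, so rotation invariance of \<open>circ\<close>
  becomes an instance of Loewner's lemma.\<close>

lemma radial_boundary_rotation:
  assumes c: "norm c = 1"
  shows "radial_boundary (\<lambda>z. c * z) (\<lambda>z. if norm z = 1 then c * z else 1)"
proof -
  have "AE z in circ. ((\<lambda>t. c * (complex_of_real t * z)) \<longlongrightarrow> (if norm z = 1 then c * z else 1)) (at_left 1)"
    using AE_circ_norm
  proof eventually_elim
    case (elim z)
    have "((\<lambda>t. c * (complex_of_real t * z)) \<longlongrightarrow> c * (of_real 1 * z)) (at_left 1)" by (intro tendsto_intros)
    thus ?case using elim by simp
  qed
  thus ?thesis using c by (auto simp: radial_boundary_def norm_mult intro!: holomorphic_intros)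
qed

lemma distr_circ:
  assumes "radial_boundary f g" "f 0 = 0" shows "distr circ borel g = circ"
  using distr_poisson_measure[OF assms(1), of 0] assms(2) by (simp add: poisson_measure_0)

lemma emeasure_circle_ball_1:
  assumes \<rho>: "0 < \<rho>" "\<rho> \<le> 1" shows "emeasure circ (circle_ball 1 \<rho>) = ennreal \<rho>"
proof -
  \<comment> \<open>The parametrisation starts and ends at the centre 1, so the arc appears as one
    interval at each end of the parameter range.\<close>
  have "{t \<in> {0..1}. cis (2 * pi * t) \<in> circle_ball 1 \<rho>} = {0..<\<rho> / 2} \<union> {1 - \<rho> / 2<..1}" (is "?A = ?B")
  proof -
    have "cos (pi * \<rho>) < cos (2 * pi * t) \<longleftrightarrow> t < \<rho> / 2 \<or> 1 - \<rho> / 2 < t" if t: "0 \<le> t" "t \<le> 1" for t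
    proof (cases "t \<le> 1 / 2")
      case True
      have "cos (pi * \<rho>) < cos (2 * pi * t) \<longleftrightarrow> 2 * pi * t < pi * \<rho>"
        using \<rho> t True by (intro cos_mono_less_eq) auto
      also have "\<dots> \<longleftrightarrow> t < \<rho> / 2" by (simp add: divide_simps mult_ac)
      finally show ?thesis using True \<rho> by auto
    next
      case False
      have eq: "cos (2 * pi * t) = cos (2 * pi * (1 - t))"
        using cos_periodic[of "- (2 * pi * t)"] by (simp add: algebra_simps)
      have "cos (pi * \<rho>) < cos (2 * pi * (1 - t)) \<longleftrightarrow> 2 * pi * (1 - t) < pi * \<rho>"
        using \<rho> t False by (intro cos_mono_less_eq) auto
      also have "\<dots> \<longleftrightarrow> 2 * (1 - t) < \<rho>" 
        by (metis mult.assoc mult.left_commute mult_less_cancel_left_pos pi_gt_zero)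
      also have "\<dots> \<longleftrightarrow> 1 - \<rho> / 2 < t" by auto
      finally show ?thesis using False \<rho> eq by auto
    qed
    thus ?thesis using \<rho> by (auto simp: circle_ball_eq inner_complex_def)
  qed
  moreover have "emeasure lborel ?B = ennreal \<rho>"
  proof -
    have "emeasure lborel ?B = emeasure lborel {0..<\<rho> / 2} + emeasure lborel {1 - \<rho> / 2<..1}"
      using \<rho> by (intro plus_emeasure[symmetric]) auto
    also have "\<dots> = ennreal \<rho>" using \<rho> by (simp flip: ennreal_plus)
    finally show ?thesis .
  qed
  ultimately show ?thesis by (subst emeasure_circ) (auto intro: circle_ball_measurable)
qed

lemma emeasure_circle_ball:
  assumes c: "norm c = 1" and \<rho>: "0 \<le> \<rho>" "\<rho> \<le> 1" shows "emeasure circ (circle_ball c \<rho>) = ennreal \<rho>"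
proof (cases "\<rho> = 0")
  case False
  hence \<rho>0: "0 < \<rho>" using \<rho> by simp
  let ?g = "\<lambda>z. if norm z = 1 then c * z else 1"
  note [measurable] = circle_ball_measurable[OF c] circle_ball_measurable[of 1]
  have "emeasure circ (circle_ball c \<rho>) = emeasure (distr circ borel ?g) (circle_ball c \<rho>)"
    using distr_circ[OF radial_boundary_rotation[OF c]] by simp
  also have "\<dots> = emeasure circ (?g -` circle_ball c \<rho>)"
    by (subst emeasure_distr) auto
  also have "\<dots> = emeasure circ (circle_ball 1 \<rho>)"
  proof (rule emeasure_eq_AE)
    show "AE z in circ. z \<in> ?g -` circle_ball c \<rho> \<longleftrightarrow> z \<in> circle_ball 1 \<rho>"
      using AE_circ_norm by eventually_elim
        (use c in \<open>auto simp: circle_ball_def norm_mult circle_dist_def\<close>)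
    have "?g -` circle_ball c \<rho> \<inter> space borel \<in> sets borel" by measurable
    thus "?g -` circle_ball c \<rho> \<in> sets circ" by simp
  qed auto
  finally show ?thesis using emeasure_circle_ball_1[OF \<rho>0 \<rho>(2)] by simp
qed (simp add: circle_ball_nonpos)

lemma measure_circle_ball:
  "norm c = 1 \<Longrightarrow> 0 \<le> \<rho> \<Longrightarrow> \<rho> \<le> 1 \<Longrightarrow> measure circ (circle_ball c \<rho>) = \<rho>"
  by (simp add: measure_def emeasure_circle_ball)

lemma circle_eq_cis:
  assumes "norm c = 1" "norm w = 1"
  obtains b where "w = c * cis b" "\<bar>b\<bar> \<le> pi" "circle_dist c w = \<bar>b\<bar> / pi"
proof
  have c0: "c \<noteq> 0" "w \<noteq> 0" using assms by auto
  show "w = c * cis (Arg (w / c))"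
    using c0 assms by (subst cis_Arg) (auto simp: sgn_div_norm norm_divide)
  show "\<bar>Arg (w / c)\<bar> \<le> pi" using mpi_less_Arg[of "w / c"] Arg_le_pi[of "w / c"] by auto
  show "circle_dist c w = \<bar>Arg (w / c)\<bar> / pi"
    using assms by (subst circle_dist_commute) (auto simp: circle_dist_def)
qed

text \<open>Angles of w and z are measured from the centre c. Their difference is at least pi
  \<eta>, and at most 2 pi - pi \<eta> because \<rho>1 + \<eta> \<le> 1.\<close>

lemma circle_ball_separation:
  assumes c: "norm c = 1" and w: "w \<in> circle_ball c \<rho>1" and z: "norm z = 1" "z \<notin> circle_ball c \<rho>2"
    and \<rho>: "\<rho>1 + \<eta> \<le> \<rho>2" "\<rho>2 \<le> 1" "0 \<le> \<eta>"
  shows "2 * \<eta> \<le> norm (z - w)"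
proof -
  have w1: "norm w = 1" "circle_dist c w < \<rho>1" using w by (auto simp: circle_ball_def)
  have z1: "\<rho>2 \<le> circle_dist c z" using z by (auto simp: circle_ball_def)
  obtain a where a: "z = c * cis a" "\<bar>a\<bar> \<le> pi" "circle_dist c z = \<bar>a\<bar> / pi"
    using circle_eq_cis[OF c z(1)] .
  obtain b where b: "w = c * cis b" "\<bar>b\<bar> \<le> pi" "circle_dist c w = \<bar>b\<bar> / pi"
    using circle_eq_cis[OF c w1(1)] .
  have 1: "pi * \<rho>2 \<le> \<bar>a\<bar>" using z1 unfolding a(3) by (simp add: pos_le_divide_eq mult.commute)
  have 2: "\<bar>b\<bar> \<le> pi * \<rho>1" using w1(2) unfolding b(3) by (simp add: pos_divide_less_eq mult.commute)
  have 3: "pi * \<rho>1 + pi * \<eta> \<le> pi * \<rho>2" using \<rho> by (simp flip: distrib_left)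
  have 4: "pi * \<rho>2 \<le> pi" using \<rho> by simp
  have "z - w = c * (cis a - cis b)" using a b by (simp add: algebra_simps)
  hence "norm (z - w) = norm (cis a - cis b)" using c by (simp add: norm_mult)
  also have "\<dots> \<ge> 2 * \<eta>"
    using 1 2 3 4 a b \<rho> by (intro norm_cis_diff_ge) linarith+
  finally show ?thesis .
qed

lemma circle_dist_le_norm:
  assumes "norm u = 1" "norm w = 1" shows "2 * circle_dist u w \<le> norm (w - u)"
proof -
  obtain b where b: "w = u * cis b" "\<bar>b\<bar> \<le> pi" "circle_dist u w = \<bar>b\<bar> / pi"
    using circle_eq_cis[OF assms] .
  have "w - u = u * (cis b - cis 0)" using b by (simp add: algebra_simps)
  hence "norm (w - u) = norm (cis b - cis 0)" using assms by (simp add: norm_mult)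
  also have "\<dots> \<ge> 2 * (\<bar>b\<bar> / pi)" using b by (intro norm_cis_diff_ge) auto
  finally show ?thesis using b by simp
qed

lemma measure_chord_ball_le:
  assumes u: "norm u = 1" and d: "0 \<le> d" shows "measure circ {w. norm (w - u) < d} \<le> d"
proof (cases "d \<le> 1")
  case True
  have "measure circ {w. norm (w - u) < d} \<le> measure circ (circle_ball u d)"
  proof (rule circ.finite_measure_mono_AE)
    show "AE w in circ. w \<in> {w. norm (w - u) < d} \<longrightarrow> w \<in> circle_ball u d"
      using AE_circ_norm
    proof eventually_elim
      case (elim w)
      show ?case using circle_dist_le_norm[OF u elim] elim circle_dist_nonneg[of u w]
        by (auto simp: circle_ball_def)
    qed
  qed (use circle_ball_measurable[OF u] in auto)
  thus ?thesis using measure_circle_ball[OF u d True] by simp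
qed (use circ.prob_le_1[of "{w. norm (w - u) < d}"] in linarith)


section \<open>Radial limits of Poisson integrals\<close>

text \<open>The predicate need not be Borel, so \<open>AE_circ_iff\<close> does not apply. A null
  set of parameters is turned into a Borel null set of the circle by means of \<open>Arg2pi\<close>,
  a continuous inverse of the parametrisation off the nonnegative reals.\<close>

lemma AE_circI:
  assumes "AE t in lborel. t \<in> {0<..<1} \<longrightarrow> P (cis (2 * pi * t))"
  shows "AE z in circ. P z"
proof -
  obtain N where N: "{t \<in> space lborel. \<not> (t \<in> {0<..<1} \<longrightarrow> P (cis (2 * pi * t)))} \<subseteq> N"
    "N \<in> sets lborel" "emeasure lborel N = 0"
    by (rule AE_E[OF assms])
  define S where "S = - (\<real>\<^sub>\<ge>\<^sub>0 :: complex set)"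
  define \<tau> where "\<tau> = (\<lambda>z. Arg2pi z / (2 * pi))"
  have S: "S \<in> sets borel" unfolding S_def by (intro borel_open) (auto simp: closed_nonneg_Reals_complex)
  have "continuous_on S \<tau>"
    unfolding \<tau>_def S_def
    by (intro continuous_at_imp_continuous_on ballI continuous_intros continuous_at_Arg2pi) auto
  from borel_measurable_continuous_on_indicator[OF S this]
  have \<tau>m: "(\<lambda>z. indicator S z *\<^sub>R \<tau> z) \<in> borel_measurable borel" .
  \<comment> \<open>The point 1, where the parametrisation closes up and \<open>Arg2pi\<close>
    jumps, is added by hand.\<close>
  define B where "B = insert 1 (S \<inter> (\<lambda>z. indicator S z *\<^sub>R \<tau> z) -` N)"
  have "(\<lambda>z. indicator S z *\<^sub>R \<tau> z) -` N \<in> sets borel"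
    using N(2) by (intro measurable_sets_borel[OF \<tau>m]) simp
  hence B: "B \<in> sets borel" unfolding B_def using S by auto
  have \<tau>: "\<tau> (cis (2 * pi * t)) = t" if "0 < t" "t < 1" for t
  proof -
    have "Arg2pi (cis (2 * pi * t)) = 2 * pi * t"
      using that by (intro Arg2pi_unique[of 1]) (auto simp: cis_conv_exp)
    thus ?thesis by (simp add: \<tau>_def)
  qed
  have "{t \<in> {0..1}. cis (2 * pi * t) \<in> B} \<subseteq> N \<union> {0, 1}"
  proof
    fix t assume t: "t \<in> {t \<in> {0..1}. cis (2 * pi * t) \<in> B}"
    show "t \<in> N \<union> {0, 1}"
    proof (cases "t = 0 \<or> t = 1")
      case False
      hence t': "0 < t" "t < 1" using t by auto
      have "cis (2 * pi * t) \<noteq> 1"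
      proof
        assume "cis (2 * pi * t) = 1"
        hence "\<tau> (cis (2 * pi * t)) = 0" using Arg2pi_unique[of 1 0 1] by (simp add: \<tau>_def)
        thus False using \<tau>[OF t'] t' by simp
      qed
      thus ?thesis using t \<tau>[OF t'] by (auto simp: B_def)
    qed auto
  qed
  hence "emeasure lborel {t \<in> {0..1}. cis (2 * pi * t) \<in> B} \<le> emeasure lborel (N \<union> {0, 1})"
    using N by (intro emeasure_mono) auto
  also have "\<dots> \<le> emeasure lborel N + emeasure lborel {0, 1::real}"
    using N by (intro emeasure_subadditive) auto
  also have "\<dots> = 0" using N by (simp add: emeasure_lborel_countable)
  finally have "emeasure circ B = 0" using B by (subst emeasure_circ) auto
  hence "AE z in circ. z \<notin> B" using B by (intro AE_not_in null_setsI) auto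
  thus ?thesis using AE_circ_norm
  proof eventually_elim
    case (elim z)
    have z1: "z \<noteq> 1" "z \<noteq> 0" using elim by (auto simp: B_def)
    have zS: "z \<in> S"
    proof (rule ccontr)
      assume "z \<notin> S"
      then obtain x where x: "z = of_real x" "0 \<le> x" by (auto simp: S_def elim: nonneg_Reals_cases)
      hence "x = 1" using elim(2) by simp
      thus False using x z1 by simp
    qed
    define t where "t = \<tau> z"
    have zc: "cis (2 * pi * t) = z"
      using Arg2pi_eq[of z, symmetric] elim(2) by (simp add: t_def \<tau>_def cis_conv_exp)
    have t0: "t \<noteq> 0"
    proof
      assume "t = 0" thus False using zc z1 by simp
    qed
    have "0 \<le> t" unfolding t_def \<tau>_def by (intro divide_nonneg_nonneg Arg2pi_ge_0) auto
    hence "0 < t" using t0 by simp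
    moreover have "t < 1"
      using Arg2pi_lt_2pi[of z] by (simp add: t_def \<tau>_def)
    moreover have "t \<notin> N" using elim(1) zS by (auto simp: B_def t_def)
    ultimately have "P (cis (2 * pi * t))" using N(1) by auto
    thus "P z" by (simp only: zc)
  qed
qed

text \<open>
  Vitali cover the exceptional set by disjoint intervals inside an open set that exceeds \<open>E\<close> by
  little; each interval carries a fixed proportion of that excess. The exceptional set need not be
  measurable, hence the formulation through outer measure.
\<close>

lemma negligible_low_density:
  fixes E :: "real set"
  assumes E: "E \<in> sets lebesgue" and \<eta>: "\<eta> > 0"
  shows "negligible {t \<in> E. \<forall>d>0. \<exists>\<rho>. 0 < \<rho> \<and> \<rho> < d \<and> \<eta> * \<rho> < measure lebesgue (ball t \<rho> - E)}" (is "negligible ?S")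
  unfolding negligible_outer_le
proof (intro allI impI)
  fix e :: real assume e: "e > 0"
  \<comment> \<open>The excess e * \<eta> / 2 is chosen because the selected intervals have total
    length at most 2 / \<eta> times the measure of the part of T - E that they contain.\<close>
  obtain T where T: "open T" "E \<subseteq> T" "T - E \<in> lmeasurable" "emeasure lebesgue (T - E) < ennreal (e * \<eta> / 2)"
    using sets_lebesgue_outer_open[OF E, of "e * \<eta> / 2"] e \<eta> by auto
  define K where "K = {(t, \<rho>). t \<in> ?S \<and> 0 < \<rho> \<and> ball t \<rho> \<subseteq> T \<and> \<eta> * \<rho> < measure lebesgue (ball t \<rho> - E)}"
  have "\<exists>i. i \<in> K \<and> x \<in> ball (fst i) (snd i) \<and> snd i < d" if x: "x \<in> ?S" "0 < d" for x d
  proof -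
    obtain d' where d': "d' > 0" "ball x d' \<subseteq> T"
      using x T(1,2) by (metis (no_types, lifting) open_contains_ball mem_Collect_eq subsetD)
    obtain \<rho> where \<rho>: "0 < \<rho>" "\<rho> < min d d'" "\<eta> * \<rho> < measure lebesgue (ball x \<rho> - E)"
      using x d'(1) by (auto dest!: spec[of _ "min d d'"])
    have "ball x \<rho> \<subseteq> T" using d'(2) \<rho>(2) by (auto simp: subset_iff)
    thus ?thesis using \<rho> x by (intro exI[of _ "(x, \<rho>)"]) (auto simp: K_def)
  qed
  then obtain C where C: "countable C" "C \<subseteq> K"
     "pairwise (\<lambda>i j. disjnt (ball (fst i) (snd i)) (ball (fst j) (snd j))) C"
     "negligible (?S - (\<Union>i\<in>C. ball (fst i) (snd i)))"
    using Vitali_covering_theorem_balls[of ?S K fst snd] by blast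
  define U where "U = (\<Union>i\<in>C. ball (fst i) (snd i))"
  have dis: "disjoint_family_on (\<lambda>i. ball (fst i) (snd i)) C"
    using C(3) by (auto simp: disjoint_family_on_def pairwise_def disjnt_def)
  have ballE: "ball t \<rho> - E \<in> lmeasurable" for t \<rho> :: real
    using E by (intro fmeasurable_Diff) auto
  have "emeasure lebesgue U = (\<integral>\<^sup>+i. emeasure lebesgue (ball (fst i) (snd i)) \<partial>count_space C)"
    unfolding U_def using C(1) dis by (intro emeasure_UN_countable) auto
  also have "\<dots> \<le> (\<integral>\<^sup>+i. ennreal (2 / \<eta>) * emeasure lebesgue (ball (fst i) (snd i) - E) \<partial>count_space C)"
  proof (rule nn_integral_mono)
    fix i assume "i \<in> space (count_space C)"
    hence i: "0 < snd i" "\<eta> * snd i < measure lebesgue (ball (fst i) (snd i) - E)"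
      using C(2) by (auto simp: K_def)
    have "emeasure lebesgue (ball (fst i) (snd i)) = ennreal (2 * snd i)"
      using i by (simp add: ball_eq_greaterThanLessThan)
    also have "\<dots> \<le> ennreal (2 / \<eta> * measure lebesgue (ball (fst i) (snd i) - E))"
      using i \<eta> by (intro ennreal_leI) (simp add: divide_simps mult.commute)
    also have "\<dots> = ennreal (2 / \<eta>) * emeasure lebesgue (ball (fst i) (snd i) - E)"
      using \<eta> by (subst emeasure_eq_measure2[OF ballE]) (simp flip: ennreal_mult')
    finally show "emeasure lebesgue (ball (fst i) (snd i)) \<le> ennreal (2 / \<eta>) * emeasure lebesgue (ball (fst i) (snd i) - E)" .
  qed
  also have "\<dots> = ennreal (2 / \<eta>) * (\<integral>\<^sup>+i. emeasure lebesgue (ball (fst i) (snd i) - E) \<partial>count_space C)"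
    by (intro nn_integral_cmult) auto
  also have "(\<integral>\<^sup>+i. emeasure lebesgue (ball (fst i) (snd i) - E) \<partial>count_space C) =
      emeasure lebesgue (\<Union>i\<in>C. ball (fst i) (snd i) - E)"
  proof (rule emeasure_UN_countable[symmetric])
    show "disjoint_family_on (\<lambda>i. ball (fst i) (snd i) - E) C"
      using dis unfolding disjoint_family_on_def by blast
  qed (use C(1) ballE in auto)
  also have "\<dots> \<le> emeasure lebesgue (T - E)"
  proof (rule emeasure_mono)
    have "ball (fst i) (snd i) \<subseteq> T" if "i \<in> C" for i
      using subsetD[OF C(2) that] by (simp add: K_def case_prod_unfold)
    thus "(\<Union>i\<in>C. ball (fst i) (snd i) - E) \<subseteq> T - E" by blast
  qed (use T(3) in auto)
  also have "\<dots> \<le> ennreal (e * \<eta> / 2)" using T by simp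
  also have "ennreal (2 / \<eta>) * ennreal (e * \<eta> / 2) = ennreal e"
    using \<eta> e by (simp flip: ennreal_mult)
  finally have Ue: "emeasure lebesgue U \<le> ennreal e" by (simp add: mult_left_mono)
  have Us: "U \<in> sets lebesgue" unfolding U_def using C(1) by (intro sets.countable_UN'') auto
  have Ul: "U \<in> lmeasurable"
    using Ue Us by (intro fmeasurableI) (auto simp: le_less_trans)
  have Um: "measure lebesgue U \<le> e" using Ue Ul e by (simp add: emeasure_eq_measure2)
  let ?N = "?S - U"
  have N: "?N \<in> lmeasurable" "measure lebesgue ?N = 0"
    using C(4) unfolding U_def by (auto simp: negligible_iff_measure)
  show "\<exists>T. ?S \<subseteq> T \<and> T \<in> lmeasurable \<and> measure lebesgue T \<le> e"
  proof (intro exI conjI)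
    show "?S \<subseteq> U \<union> ?N" by auto
    show "U \<union> ?N \<in> lmeasurable" using Ul N by (intro fmeasurable.Un)
    show "measure lebesgue (U \<union> ?N) \<le> e"
      using measure_Un_le[of U lebesgue ?N] N Us Um by auto
  qed
qed

text \<open>Carried over from density on the line. A parameter difference of x / 4 already forces a
  chord of length x, so a chord ball of radius x comes from an interval of radius x / 4; this is why
  the density on the line is used with 4 * \<eta>.\<close>

lemma circle_density:
  assumes E [measurable]: "E \<in> sets borel" and \<eta>: "\<eta> > 0"
  shows "AE u in circ. u \<in> E \<longrightarrow>
    (\<exists>d>0. \<forall>x. 0 < x \<and> x \<le> d \<longrightarrow> measure circ ({w. norm (w - u) < x} - E) \<le> \<eta> * x)"
proof (rule AE_circI)
  define E' where "E' = {t. 0 < t \<and> t < 1 \<and> cis (2 * pi * t) \<in> E}"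
  have "E' = {0<..<1} \<inter> (\<lambda>t. cis (2 * pi * t)) -` E" by (auto simp: E'_def)
  moreover have "(\<lambda>t. cis (2 * pi * t)) -` E \<in> sets borel"
    by (intro measurable_sets_borel[where M = borel]) auto
  ultimately have E'b: "E' \<in> sets borel" by auto
  hence E': "E' \<in> sets lebesgue" by (intro sets_completionI_sets) (simp only: sets_lborel)
  define S where "S = {t \<in> E'. \<forall>d>0. \<exists>\<rho>. 0 < \<rho> \<and> \<rho> < d \<and> 4 * \<eta> * \<rho> < measure lebesgue (ball t \<rho> - E')}"
  have "negligible S" unfolding S_def using negligible_low_density[OF E', of "4 * \<eta>"] \<eta> by simp
  hence "AE t in lebesgue. t \<notin> S" by (intro AE_not_in) (simp add: negligible_iff_null_sets)
  hence "AE t in lborel. t \<notin> S" by (simp add: AE_completion_iff)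
  thus "AE t in lborel. t \<in> {0<..<1} \<longrightarrow> cis (2 * pi * t) \<in> E \<longrightarrow>
    (\<exists>d>0. \<forall>x. 0 < x \<and> x \<le> d \<longrightarrow> measure circ ({w. norm (w - cis (2 * pi * t)) < x} - E) \<le> \<eta> * x)"
  proof eventually_elim
    case (elim t)
    show ?case
    proof (intro impI)
      assume t: "t \<in> {0<..<1}" and tE: "cis (2 * pi * t) \<in> E"
      hence "t \<in> E'" by (simp add: E'_def)
      with elim obtain d where d0: "d > 0" "\<not> (\<exists>\<rho>. 0 < \<rho> \<and> \<rho> < d \<and> 4 * \<eta> * \<rho> < measure lebesgue (ball t \<rho> - E'))"
        unfolding S_def by blast
      have d: "d > 0"
        "\<And>\<rho>. 0 < \<rho> \<Longrightarrow> \<rho> < d \<Longrightarrow> measure lebesgue (ball t \<rho> - E') \<le> 4 * \<eta> * \<rho>"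
        using d0 by (auto simp only: not_less[symmetric])
      \<comment> \<open>The bounds 4 * t and 4 * (1 - t) keep parameters on the two sides of the
        seam apart, and 2 * d makes x / 4 smaller than d.\<close>
      define d' where "d' = min (2 * d) (min (4 * t) (4 * (1 - t)))"
      have "d' > 0" using d t by (auto simp: d'_def)
      moreover have "measure circ ({w. norm (w - cis (2 * pi * t)) < x} - E) \<le> \<eta> * x"
        if x: "0 < x" "x \<le> d'" for x
      proof -
        have sub: "{s \<in> {0..1}. cis (2 * pi * s) \<in> {w. norm (w - cis (2 * pi * t)) < x} - E} \<subseteq> ball t (x / 4) - E'"
        proof
          fix s assume s: "s \<in> {s \<in> {0..1}. cis (2 * pi * s) \<in> {w. norm (w - cis (2 * pi * t)) < x} - E}"
          have "\<bar>s - t\<bar> < x / 4"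
          proof (rule ccontr)
            assume "\<not> \<bar>s - t\<bar> < x / 4"
            hence 1: "x / 4 \<le> \<bar>s - t\<bar>" by simp
            have 2: "\<bar>s - t\<bar> \<le> 1 - x / 4"
              using s t x by (auto simp: d'_def)
            have eq: "\<bar>2 * pi * s - 2 * pi * t\<bar> = 2 * pi * \<bar>s - t\<bar>"
              by (simp add: abs_mult flip: right_diff_distrib)
            have "2 * (x / 2) \<le> norm (cis (2 * pi * s) - cis (2 * pi * t))"
            proof (rule norm_cis_diff_ge)
              show "pi * (x / 2) \<le> \<bar>2 * pi * s - 2 * pi * t\<bar>"
                unfolding eq using mult_left_mono[OF 1, of "2 * pi"] by simp
              show "\<bar>2 * pi * s - 2 * pi * t\<bar> \<le> 2 * pi - pi * (x / 2)"
                unfolding eq using mult_left_mono[OF 2, of "2 * pi"] by (simp add: algebra_simps)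
            qed (use x in auto)
            thus False using s by simp
          qed
          thus "s \<in> ball t (x / 4) - E'"
            using s by (auto simp: E'_def dist_real_def abs_minus_commute)
        qed
        have lm: "ball t (x / 4) - E' \<in> lmeasurable"
          using E' by (intro fmeasurable_Diff) auto
        have "emeasure circ ({w. norm (w - cis (2 * pi * t)) < x} - E) \<le> emeasure lborel (ball t (x / 4) - E')"
          using sub E'b by (subst emeasure_circ) (auto intro!: emeasure_mono)
        also have "\<dots> = ennreal (measure lebesgue (ball t (x / 4) - E'))"
          unfolding emeasure_eq_measure2[OF lm, symmetric] using E'b
          by (subst emeasure_completion) (auto simp: main_part_sets)
        also have "\<dots> \<le> ennreal (4 * \<eta> * (x / 4))"
          using x d by (intro ennreal_leI d) (auto simp: d'_def)
        finally show ?thesis using \<eta> x by (simp add: circ.emeasure_eq_measure)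
      qed
      ultimately show "\<exists>d>0. \<forall>x. 0 < x \<and> x \<le> d \<longrightarrow> measure circ ({w. norm (w - cis (2 * pi * t)) < x} - E) \<le> \<eta> * x"
        by blast
    qed
  qed
qed

text \<open>Fatou's theorem. Almost every u is a density point of every set \<open>E n q\<close>
  that contains it, q running through a countable dense set; since h varies by less than 2 *
  \<epsilon> n on \<open>E n q\<close>, such a u is a Lebesgue point of h.\<close>

theorem poisson_integral_radial_limit:
  fixes h :: "complex \<Rightarrow> complex"
  assumes h [measurable]: "h \<in> borel_measurable borel"
    and bd: "\<And>z. norm z = 1 \<Longrightarrow> norm (h z) \<le> M"
  shows "AE u in circ. ((\<lambda>s. LINT z|circ. of_real (poisson (of_real s * u) z) * h z) \<longlongrightarrow> h u) (at_left 1)"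
proof -
  from countable_dense_exists[where ?'a = complex] obtain D :: "complex set"
    where D': "countable D \<and> (\<forall>X. open X \<longrightarrow> X \<noteq> {} \<longrightarrow> (\<exists>d\<in>D. d \<in> X))" ..
  note D = conjunct1[OF D'] conjunct2[OF D']
  define \<epsilon> where "\<epsilon> = (\<lambda>n. 1 / real (Suc n))"
  define E where "E = (\<lambda>n q. {z. norm (h z - q) < \<epsilon> n})"
  have E [measurable]: "E n q \<in> sets borel" for n q unfolding E_def by measurable
  have M: "0 \<le> M" using order_trans[OF norm_ge_zero bd[of 1]] by simp
  have "AE u in circ. \<forall>q\<in>D. u \<in> E n q \<longrightarrow>
    (\<exists>d>0. \<forall>x. 0 < x \<and> x \<le> d \<longrightarrow> measure circ ({w. norm (w - u) < x} - E n q) \<le> \<epsilon> k * x)" for n k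
    unfolding AE_ball_countable[OF D(1)]
  proof
    fix q
    show "AE u in circ. u \<in> E n q \<longrightarrow>
      (\<exists>d>0. \<forall>x. 0 < x \<and> x \<le> d \<longrightarrow> measure circ ({w. norm (w - u) < x} - E n q) \<le> \<epsilon> k * x)"
      by (rule circle_density) (auto simp: \<epsilon>_def)
  qed
  hence "AE u in circ. \<forall>n k. \<forall>q\<in>D. u \<in> E n q \<longrightarrow>
    (\<exists>d>0. \<forall>x. 0 < x \<and> x \<le> d \<longrightarrow> measure circ ({w. norm (w - u) < x} - E n q) \<le> \<epsilon> k * x)"
    unfolding AE_all_countable by blast
  thus ?thesis using AE_circ_norm
  proof eventually_elim
    case (elim u)
    note u = elim(2)
    show ?case
    proof (rule poisson_integral_tendsto[OF u h bd])
      fix \<eta> :: real assume \<eta>: "\<eta> > 0"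
      have \<epsilon>_small: "\<exists>n. \<epsilon> n < x" if "x > 0" for x
        using reals_Archimedean[OF that] by (simp add: \<epsilon>_def inverse_eq_divide)
      obtain n where n: "\<epsilon> n < \<eta> / 4" using \<epsilon>_small[of "\<eta> / 4"] \<eta> by auto
      \<comment> \<open>The second summand of the denominator guards against M = 0.\<close>
      obtain k where k: "\<epsilon> k < \<eta> / (4 * M + 4)" using \<epsilon>_small[of "\<eta> / (4 * M + 4)"] \<eta> M by auto
      have \<epsilon>0: "0 < \<epsilon> n" for n by (simp add: \<epsilon>_def)
      obtain q where q: "q \<in> D" "q \<in> ball (h u) (\<epsilon> n)"
      proof -
        have "ball (h u) (\<epsilon> n) \<noteq> {}" using \<epsilon>0[of n] by simp
        from D(2)[rule_format, OF open_ball this] show thesis using that by blast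
      qed
      hence uE: "u \<in> E n q" by (simp add: E_def dist_norm)
      obtain d where d: "d > 0"
        "\<And>x. 0 < x \<Longrightarrow> x \<le> d \<Longrightarrow> measure circ ({w. norm (w - u) < x} - E n q) \<le> \<epsilon> k * x"
        using elim(1)[rule_format, OF q(1) uE, of k] by blast
      have "(LINT z|circ. indicator {w. norm (w - u) < x} z * norm (h z - h u)) \<le> \<eta> * x"
        if x: "0 < x" "x \<le> d" for x
      proof -
        define A where "A = {w. norm (w - u) < x}"
        have [measurable]: "A \<in> sets borel" unfolding A_def by measurable
        have ind: "integrable circ (indicator X :: complex \<Rightarrow> real)" if "X \<in> sets borel" for X
          using that by (intro circ.integrable_const_bound[where B = 1]) auto
        have b2: "norm (h z - h u) \<le> 2 * M" if "norm z = 1" for z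
          using norm_triangle_ineq4[of "h z" "h u"] bd[OF that] bd[OF u] by simp
        have "(LINT z|circ. indicator A z * norm (h z - h u)) \<le>
            (LINT z|circ. 2 * \<epsilon> n * indicator A z + 2 * M * indicator (A - E n q) z)"
        proof (rule integral_mono_AE)
          show "integrable circ (\<lambda>z. indicator A z * norm (h z - h u))"
            by (rule integrable_indicator_mult[where M = "2 * M"]) (auto simp: b2)
          show "integrable circ (\<lambda>z. 2 * \<epsilon> n * indicator A z + 2 * M * indicator (A - E n q) z)"
            by (intro Bochner_Integration.integrable_add integrable_mult_right ind) auto
          show "AE z in circ. indicator A z * norm (h z - h u) \<le> 2 * \<epsilon> n * indicator A z + 2 * M * indicator (A - E n q) z"
            using AE_circ_norm
          proof eventually_elim
            case (elim z)
            have "norm (h z - h u) \<le> 2 * \<epsilon> n" if "z \<in> E n q"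
              using norm_triangle_ineq4[of "h z - q" "h u - q"] that uE by (simp add: E_def)
            thus ?case using b2[OF elim] \<epsilon>0[of n] by (auto simp: indicator_def)
          qed
        qed
        also have "\<dots> = 2 * \<epsilon> n * measure circ A + 2 * M * measure circ (A - E n q)"
          using ind[of A] ind[of "A - E n q"] by simp
        also have "\<dots> \<le> 2 * (\<eta> / 4) * x + 2 * M * (\<eta> / (4 * M + 4) * x)"
        proof (intro add_mono mult_mono mult_left_mono)
          show "measure circ A \<le> x" unfolding A_def using x by (intro measure_chord_ball_le u) auto
          have "measure circ (A - E n q) \<le> \<epsilon> k * x" unfolding A_def using x by (intro d)
          also have "\<dots> \<le> \<eta> / (4 * M + 4) * x" using k x by (intro mult_right_mono) auto
          finally show "measure circ (A - E n q) \<le> \<eta> / (4 * M + 4) * x" .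
        qed (use n \<epsilon>0[of n] \<eta> x M in auto)
        also have "2 * M * (\<eta> / (4 * M + 4) * x) \<le> \<eta> / 2 * x"
        proof -
          have "2 * M / (4 * M + 4) \<le> 1 / 2" using M by (simp add: divide_simps)
          hence "2 * M / (4 * M + 4) * (\<eta> * x) \<le> 1 / 2 * (\<eta> * x)"
            using \<eta> x by (intro mult_right_mono) auto
          thus ?thesis by simp
        qed
        finally show ?thesis unfolding A_def by simp
      qed
      thus "\<exists>d>0. \<forall>x. 0 < x \<and> x \<le> d \<longrightarrow>
        (LINT z|circ. indicator {w. norm (w - u) < x} z * norm (h z - h u)) \<le> \<eta> * x"
        using d(1) by blast
    qed
  qed
qed


section \<open>Composition and contraction of inner functions\<close>

text \<open>The limit along a fixed sequence of radii is a Borel function, and it agrees with the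
  full radial limit wherever the latter exists.\<close>

lemma inner_function_radial_boundary:
  assumes "inner_function f" obtains g where "radial_boundary f g"
proof -
  have hol: "f holomorphic_on ball 0 1" and ball: "f ` ball 0 1 \<subseteq> ball 0 1"
    and lim: "AE z in circ. \<exists>w\<in>sphere 0 1. ((\<lambda>t. f (complex_of_real t * z)) \<longlongrightarrow> w) (at_left 1)"
    using assms by (auto simp: inner_function_def AE_circle_measure_iff)
  define \<rho> where "\<rho> = (\<lambda>n::nat. 1 - 1 / real (n + 2))"
  define h where "h = (\<lambda>z. indicator (ball 0 1) z *\<^sub>R f z)"
  have [measurable]: "h \<in> borel_measurable borel"
    unfolding h_def using hol
    by (intro borel_measurable_continuous_on_indicator holomorphic_on_imp_continuous_on) auto
  define l where "l = (\<lambda>z. lim (\<lambda>n. h (of_real (\<rho> n) * z)))"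
  have [measurable]: "l \<in> borel_measurable borel"
    unfolding l_def by (rule borel_measurable_lim_metric) measurable
  \<comment> \<open>Correction on the exceptional null set, so that g is unimodular
    everywhere.\<close>
  define g where "g = (\<lambda>z. if norm (l z) = 1 then l z else 1)"
  have "AE z in circ. ((\<lambda>t. f (complex_of_real t * z)) \<longlongrightarrow> g z) (at_left 1)"
    using lim AE_circ_norm
  proof eventually_elim
    case (elim z)
    then obtain w where w: "norm w = 1" "((\<lambda>t. f (complex_of_real t * z)) \<longlongrightarrow> w) (at_left 1)"
      by auto
    have "(\<lambda>n. f (of_real (\<rho> n) * z)) \<longlonglongrightarrow> w"
      unfolding \<rho>_def by (rule filterlim_compose[OF w(2) eventually_at_left_1_subseq])
    also have "(\<lambda>n. f (of_real (\<rho> n) * z)) = (\<lambda>n. h (of_real (\<rho> n) * z))"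
    proof
      fix n
      have "0 \<le> \<rho> n" "\<rho> n < 1" by (auto simp: \<rho>_def)
      from norm_of_real_mult_less[OF elim(2) this]
      show "f (of_real (\<rho> n) * z) = h (of_real (\<rho> n) * z)" by (simp add: h_def)
    qed
    finally have "l z = w" unfolding l_def by (rule limI)
    thus ?case using w by (simp add: g_def)
  qed
  moreover have "g \<in> borel_measurable borel" unfolding g_def by measurable
  ultimately have "radial_boundary f g"
    using hol ball by (auto simp: radial_boundary_def g_def)
  thus ?thesis by (rule that)
qed

lemma radial_boundary_measurable: "radial_boundary f g \<Longrightarrow> g \<in> borel_measurable borel"
  and radial_boundary_norm: "radial_boundary f g \<Longrightarrow> norm (g z) = 1"
  and radial_boundary_ball: "radial_boundary f g \<Longrightarrow> norm a < 1 \<Longrightarrow> norm (f a) < 1"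
  by (auto simp: radial_boundary_def image_subset_iff)

lemma integral_poisson_measure:
  fixes h :: "complex \<Rightarrow> complex"
  assumes [measurable]: "h \<in> borel_measurable borel" and a: "norm a < 1"
  shows "(LINT z|poisson_measure a. h z) = (LINT z|circ. of_real (poisson a z) * h z)"
  unfolding poisson_measure_def using poisson_nonneg[OF a]
  by (subst integral_density) (auto simp: scaleR_conv_of_real)

text \<open>Radial limits of f say nothing directly about f along the curve
  \<open>F (s * u)\<close>. Instead Loewner's lemma for G turns the Poisson representation of f at
  \<open>F a\<close> into one of the composition at a, with boundary function g after G; to that
  representation Fatou's theorem applies.\<close>

lemma radial_boundary_comp:
  assumes fg: "radial_boundary f g" and FG: "radial_boundary F G" and F0: "F 0 = 0"
  shows "radial_boundary (f \<circ> F) (g \<circ> G)"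
proof -
  note [measurable] = radial_boundary_measurable[OF fg] radial_boundary_measurable[OF FG]
  have holf: "f holomorphic_on ball 0 1" and holF: "F holomorphic_on ball 0 1"
    and ballF: "F ` ball 0 1 \<subseteq> ball 0 1" and ballf: "f ` ball 0 1 \<subseteq> ball 0 1"
    using fg FG by (auto simp: radial_boundary_def)
  have lim: "AE z in circ. ((\<lambda>t. f (complex_of_real t * z)) \<longlongrightarrow> g z) (at_left 1)"
    using fg by (simp add: radial_boundary_def)
  have repr: "(LINT z|circ. of_real (poisson a z) * g (G z)) = f (F a)" if a: "norm a < 1" for a
  proof -
    have Fa: "norm (F a) < 1" using FG a by (rule radial_boundary_ball)
    have "(LINT z|circ. of_real (poisson a z) * g (G z)) = (LINT z|poisson_measure a. g (G z))"
      using a by (subst integral_poisson_measure) auto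
    also have "\<dots> = (LINT z|distr (poisson_measure a) borel G. g z)"
      by (subst integral_distr) auto
    also have "\<dots> = (LINT z|circ. of_real (poisson (F a) z) * g z)"
      using Fa by (simp add: distr_poisson_measure[OF FG a] integral_poisson_measure)
    also have "\<dots> = f (F a)"
    proof (rule poisson_representation[OF holf _ _ lim Fa])
      show "norm (f z) \<le> 1" if "norm z < 1" for z
        using radial_boundary_ball[OF fg that] by simp
    qed auto
    finally show ?thesis .
  qed
  have "AE u in circ. ((\<lambda>s. LINT z|circ. of_real (poisson (of_real s * u) z) * g (G z)) \<longlongrightarrow> g (G u)) (at_left 1)"
    by (rule poisson_integral_radial_limit[where M = 1]) (auto simp: radial_boundary_norm[OF fg])
  hence "AE u in circ. ((\<lambda>s. f (F (of_real s * u))) \<longlongrightarrow> g (G u)) (at_left 1)"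
    using AE_circ_norm
  proof eventually_elim
    case (elim u)
    have "eventually (\<lambda>s. s \<in> {0<..<1}) (at_left (1::real))"
      by (rule eventually_at_left_real) auto
    hence "eventually (\<lambda>s. (LINT z|circ. of_real (poisson (of_real s * u) z) * g (G z)) = f (F (of_real s * u))) (at_left 1)"
      by eventually_elim (rule repr, rule norm_of_real_mult_less[OF elim(2)], auto)
    thus ?case using elim(1) by (simp cong: tendsto_cong)
  qed
  thus ?thesis
    using holomorphic_on_compose_gen[OF holF holf ballF] ballF ballf radial_boundary_norm[OF fg]
    by (auto simp: radial_boundary_def image_subset_iff o_def)
qed

lemma forward_comp_add: "forward_comp f (m + k) = forward_comp (\<lambda>i. f (m + i)) k \<circ> forward_comp f m"
  by (induction k) (auto simp: o_assoc)

lemma forward_comp_fixes_0: "(\<And>n. 1 \<le> n \<Longrightarrow> f n 0 = 0) \<Longrightarrow> forward_comp f n 0 = 0"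
  by (induction n) auto

lemma radial_boundary_forward_comp:
  assumes "\<And>n. 1 \<le> n \<Longrightarrow> radial_boundary (f n) (g n)" "\<And>n. 1 \<le> n \<Longrightarrow> f n 0 = 0" "1 \<le> n"
  shows "radial_boundary (forward_comp f n) (forward_comp g n)"
  using assms(3)
proof (induction n rule: nat_induct_at_least)
  case base
  thus ?case using assms(1)[of 1] by simp
next
  case (Suc n)
  thus ?case using assms(1)[of "Suc n"] forward_comp_fixes_0[of f n] assms(2)
    unfolding forward_comp.simps by (intro radial_boundary_comp) auto
qed

text \<open>Schwarz-Pick is applied to the quotient h of f by the identity, whose value at 0 is the
  derivative of f there: the pseudohyperbolic distance from \<open>h z\<close> to \<open>h 0\<close>
  is at most \<open>norm z\<close>, which keeps \<open>norm (h z)\<close> below 1 by a definite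
  amount.\<close>

lemma schwarz_pick_quotient:
  assumes hol: "f holomorphic_on ball 0 1" and ball: "f ` ball 0 1 \<subseteq> ball 0 1" and f0: "f 0 = 0"
    and d: "norm (deriv f 0) \<le> \<alpha>" and \<alpha>: "\<alpha> < 1" and z: "norm z < 1"
  shows "norm (f z) \<le> norm z * (1 - (1 - \<alpha>) / (1 + \<alpha>) * (1 - norm z))"
proof (cases "z = 0")
  case False
  have \<alpha>0: "0 \<le> \<alpha>" using order_trans[OF norm_ge_zero d] .
  have no: "norm (f z) < 1" if "norm z < 1" for z using ball that by (auto simp: image_subset_iff)
  obtain h where h: "h holomorphic_on ball 0 1" "\<And>z. norm z < 1 \<Longrightarrow> f z = z * h z" "deriv f 0 = h 0"
    using Schwarz3[OF hol f0] by blast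
  have h1: "norm (h w) < 1" if w: "norm w < 1" for w
  proof (cases "w = 0")
    case True
    thus ?thesis using h(3) d \<alpha> by simp
  next
    case w0: False
    have "norm (f w) \<le> norm w" using Schwarz_Lemma(1)[OF hol f0] no w by blast
    \<comment> \<open>Equality would make f a rotation, with a derivative of modulus 1 at 0.\<close>
    moreover have "norm (f w) \<noteq> norm w"
    proof
      assume "norm (f w) = norm w"
      hence "(\<exists>z. norm z < 1 \<and> z \<noteq> 0 \<and> norm (f z) = norm z) \<or> norm (deriv f 0) = 1"
        using w w0 by blast
      from Schwarz_Lemma(3)[OF hol f0 no _ this, of 0]
      obtain \<beta> where \<beta>: "\<And>z. norm z < 1 \<Longrightarrow> f z = \<beta> * z" "norm \<beta> = 1"
        by auto
      have "deriv f 0 = deriv (\<lambda>z. \<beta> * z) 0"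
      proof (rule deriv_cong_ev)
        have "eventually (\<lambda>z. z \<in> ball 0 1) (nhds (0::complex))"
          by (intro eventually_nhds_in_open) auto
        thus "eventually (\<lambda>z. f z = \<beta> * z) (nhds 0)" by eventually_elim (simp add: \<beta>(1))
      qed simp
      also have "\<dots> = \<beta>" by simp
      finally show False using \<beta>(2) d \<alpha> by simp
    qed
    ultimately have "norm w * norm (h w) < norm w * 1" using h(2)[OF w] by (simp add: norm_mult)
    thus ?thesis using w0 by (subst (asm) mult_less_cancel_left_pos) auto
  qed
  define \<beta> where "\<beta> = h 0"
  have \<beta>: "norm \<beta> \<le> \<alpha>" "norm \<beta> < 1" using h(3) d \<alpha> by (auto simp: \<beta>_def)
  \<comment> \<open>The disc automorphism that sends \<open>h 0\<close> to 0, composed with h, so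
    that Schwarz's lemma applies.\<close>
  define k where "k = (\<lambda>z. (h z - \<beta>) / (1 - cnj \<beta> * h z))"
  have nz: "1 - cnj \<beta> * h w \<noteq> 0" if "norm w < 1" for w
    using \<beta>(2) h1[OF that] by (intro one_minus_cnj_mult_nonzero) auto
  have "norm (k z) \<le> norm z"
  proof (rule Schwarz_Lemma(1))
    show "k holomorphic_on ball 0 1" unfolding k_def using nz by (intro holomorphic_intros h) auto
    show "k 0 = 0" by (simp add: k_def \<beta>_def)
    show "norm (k w) < 1" if "norm w < 1" for w
      using Moebius_function_norm_lt_1[OF \<beta>(2) h1[OF that], of 0] by (simp add: k_def Moebius_function_simple)
  qed fact
  hence le: "norm (h z - \<beta>) \<le> norm z * norm (1 - cnj \<beta> * h z)"
    using nz[OF z] by (simp add: k_def norm_divide divide_simps)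
  define x b s c where "x = norm (h z)" and "b = norm \<beta>" and "s = norm z" and "c = Re (cnj \<beta> * h z)"
  have x: "0 \<le> x" "x < 1" and b: "0 \<le> b" "b \<le> \<alpha>" "b < 1" and s: "0 \<le> s" "s < 1"
    using h1[OF z] \<beta> z by (auto simp: x_def b_def s_def)
  have c: "c \<le> b * x" unfolding c_def b_def x_def
    using complex_Re_le_cmod[of "cnj \<beta> * h z"] by (simp add: norm_mult)
  have A: "(norm (h z - \<beta>))\<^sup>2 = x\<^sup>2 + b\<^sup>2 - 2 * c"
    unfolding x_def b_def c_def cmod_power2 by (simp add: power2_eq_square algebra_simps)
  have B: "(norm (1 - cnj \<beta> * h z))\<^sup>2 = 1 + (b * x)\<^sup>2 - 2 * c"
    unfolding x_def b_def c_def power_mult_distrib cmod_power2 by (simp add: power2_eq_square algebra_simps)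
  have C: "(norm (h z - \<beta>))\<^sup>2 \<le> (s * norm (1 - cnj \<beta> * h z))\<^sup>2"
    using le unfolding s_def by (intro power_mono) auto
  have 1: "x\<^sup>2 + b\<^sup>2 - 2 * c \<le> s\<^sup>2 * (1 + (b * x)\<^sup>2 - 2 * c)"
    using C by (simp only: power_mult_distrib[of s] A B)
  \<comment> \<open>Replacing c by its upper bound b * x goes in the right direction because 1 - s^2
    is nonnegative; both sides then become squares, and the complex inequality reduces to one
    between moduli.\<close>
  have "2 * c * (1 - s\<^sup>2) \<le> 2 * (b * x) * (1 - s\<^sup>2)"
    using c s by (intro mult_right_mono) (auto simp: power_le_one)
  moreover have "(s * (1 - b * x))\<^sup>2 - (x - b)\<^sup>2 = (s\<^sup>2 * (1 + (b * x)\<^sup>2 - 2 * c) - (x\<^sup>2 + b\<^sup>2 - 2 * c))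
      + (2 * (b * x) * (1 - s\<^sup>2) - 2 * c * (1 - s\<^sup>2))"
    by (simp add: power2_eq_square algebra_simps)
  ultimately have "(x - b)\<^sup>2 \<le> (s * (1 - b * x))\<^sup>2" using 1 by linarith
  moreover have "0 \<le> s * (1 - b * x)"
  proof -
    have "b * x \<le> 1 * 1" using b x by (intro mult_mono) auto
    thus ?thesis using s by simp
  qed
  ultimately have "x - b \<le> s * (1 - b * x)" by (rule power2_le_imp_le)
  hence "(1 + s * b) * (1 - x) \<ge> (1 - s) * (1 - b)" by (simp add: algebra_simps)
  hence "(1 - s) * (1 - b) / (1 + s * b) \<le> 1 - x"
    using s b by (simp add: divide_simps mult.commute add_pos_nonneg)
  moreover have "(1 - s) * ((1 - \<alpha>) / (1 + \<alpha>)) \<le> (1 - s) * ((1 - b) / (1 + s * b))"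
  proof (intro mult_left_mono frac_le)
    have "s * b \<le> 1 * \<alpha>" using s b by (intro mult_mono) auto
    thus "1 + s * b \<le> 1 + \<alpha>" by simp
  qed (use s b \<alpha> in \<open>auto intro!: add_pos_nonneg\<close>)
  ultimately have "x \<le> 1 - (1 - \<alpha>) / (1 + \<alpha>) * (1 - s)" by (simp add: mult.commute)
  hence "s * x \<le> s * (1 - (1 - \<alpha>) / (1 + \<alpha>) * (1 - s))" using s by (intro mult_left_mono) auto
  thus ?thesis using h(2)[OF z] by (simp add: s_def x_def norm_mult)
qed (simp add: f0)

text \<open>Comparable to s near 0 and to 1 / (1 - s) near 1, so that the escape from the circle and
  the approach to 0 obey a single geometric rate.\<close>

definition odds :: "real \<Rightarrow> real" where "odds s = s / (1 - s)"

lemma odds_mono: "x \<le> y \<Longrightarrow> y < 1 \<Longrightarrow> odds x \<le> odds y"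
  by (simp add: odds_def divide_simps algebra_simps)

lemma odds_contraction:
  assumes "f holomorphic_on ball 0 1" "f ` ball 0 1 \<subseteq> ball 0 1" "f 0 = 0"
    and d: "norm (deriv f 0) \<le> \<alpha>" and \<alpha>: "\<alpha> < 1" and z: "norm z < 1"
  shows "odds (norm (f z)) \<le> (1 + \<alpha>) / 2 * odds (norm z)"
proof -
  define s \<kappa> where "s = norm z" and "\<kappa> = (1 - \<alpha>) / (1 + \<alpha>)"
  have \<alpha>0: "0 \<le> \<alpha>" using order_trans[OF norm_ge_zero d] .
  have s: "0 \<le> s" "s < 1" using z by (auto simp: s_def)
  have \<kappa>: "0 < \<kappa>" "\<kappa> \<le> 1" using \<alpha> \<alpha>0 by (auto simp: \<kappa>_def)
  define y where "y = 1 - \<kappa> * (1 - s)"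
  have y: "y \<le> 1" "0 \<le> y" using \<kappa> s by (auto simp: y_def mult_le_one)
  have sy: "s * y < 1" using s y by (metis mult_left_le order_le_less_trans)
  have "odds (norm (f z)) \<le> odds (s * y)"
    using schwarz_pick_quotient[OF assms] sy unfolding s_def \<kappa>_def y_def by (intro odds_mono) auto
  also have "\<dots> \<le> 1 / (1 + \<kappa>) * odds s"
  proof -
    \<comment> \<open>The right side exceeds the left by exactly \<kappa>^2 (1 - s).\<close>
    have "(1 + \<kappa>) * (1 - \<kappa> * (1 - s)) \<le> 1 + \<kappa> * s"
      using \<kappa> s mult_left_le[of s "\<kappa> * \<kappa>"] by (simp add: algebra_simps)
    hence "s * (1 - s) * ((1 + \<kappa>) * y) \<le> s * (1 - s) * (1 + \<kappa> * s)"
      unfolding y_def using s by (intro mult_left_mono) auto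
    also have "(1 - s) * (1 + \<kappa> * s) = 1 - s * y" by (simp add: y_def algebra_simps)
    hence "s * (1 - s) * (1 + \<kappa> * s) = s * (1 - s * y)" by (metis mult.assoc)
    finally show ?thesis
      using s sy \<kappa> unfolding odds_def by (simp add: divide_simps mult_ac)
  qed
  also have "1 / (1 + \<kappa>) = (1 + \<alpha>) / 2" using \<alpha>0 by (simp add: \<kappa>_def divide_simps)
  finally show ?thesis by (simp add: s_def)
qed

text \<open>Since t \<le> \<open>odds t\<close> \<le> 1 / (1 - t) on [0, 1), iterating the
  contraction of \<open>odds\<close> gives a bound that depends on the starting point only through
  its distance to the circle.\<close>

lemma norm_forward_comp_le:
  assumes "\<And>n. 1 \<le> n \<Longrightarrow> radial_boundary (f n) (g n)" and "\<And>n. 1 \<le> n \<Longrightarrow> f n 0 = 0"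
    and d: "\<And>n. 1 \<le> n \<Longrightarrow> norm (deriv (f n) 0) \<le> \<alpha>" and \<alpha>: "\<alpha> < 1" and a: "norm a < 1"
  shows "norm (forward_comp f n a) < 1 \<and> norm (forward_comp f n a) \<le> ((1 + \<alpha>) / 2) ^ n / (1 - norm a)"
proof -
  have \<alpha>0: "0 \<le> \<alpha>" using order_trans[OF norm_ge_zero d[of 1]] by simp
  have "norm (forward_comp f n a) < 1 \<and> odds (norm (forward_comp f n a)) \<le> ((1 + \<alpha>) / 2) ^ n * odds (norm a)"
  proof (induction n)
    case (Suc n)
    let ?w = "forward_comp f n a"
    have rb: "radial_boundary (f (Suc n)) (g (Suc n))" by (rule assms(1)) simp
    have "odds (norm (f (Suc n) ?w)) \<le> (1 + \<alpha>) / 2 * odds (norm ?w)"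
      using rb assms(2)[of "Suc n"] d[of "Suc n"] \<alpha> Suc
      by (intro odds_contraction) (auto simp: radial_boundary_def)
    also have "\<dots> \<le> (1 + \<alpha>) / 2 * (((1 + \<alpha>) / 2) ^ n * odds (norm a))"
      using Suc \<alpha>0 by (intro mult_left_mono) auto
    finally show ?case using radial_boundary_ball[OF rb] Suc by (simp add: mult_ac)
  qed (use a in auto)
  hence *: "norm (forward_comp f n a) < 1"
    "odds (norm (forward_comp f n a)) \<le> ((1 + \<alpha>) / 2) ^ n * odds (norm a)" by auto
  let ?t = "norm (forward_comp f n a)"
  have "?t \<le> odds ?t" using *(1) by (simp add: odds_def pos_le_divide_eq mult_left_le)
  also have "\<dots> \<le> ((1 + \<alpha>) / 2) ^ n * (1 / (1 - norm a))"
    using *(2) a \<alpha>0 by (elim order_trans, intro mult_left_mono) (auto simp: odds_def divide_right_mono)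
  finally show ?thesis using *(1) by simp
qed


section \<open>Exponential decorrelation\<close>

lemma emeasure_poisson_measure_le:
  assumes b: "norm b \<le> y" "y < 1" and [measurable]: "B \<in> sets borel"
  shows "emeasure (poisson_measure b) B \<le> ennreal ((1 + y) / (1 - y)) * emeasure circ B"
proof -
  have b1: "norm b < 1" using b by simp
  have "emeasure (poisson_measure b) B = (\<integral>\<^sup>+z. ennreal (poisson b z) * indicator B z \<partial>circ)"
    unfolding poisson_measure_def by (subst emeasure_density) auto
  also have "\<dots> \<le> (\<integral>\<^sup>+z. ennreal ((1 + y) / (1 - y)) * indicator B z \<partial>circ)"
  proof (rule nn_integral_mono_AE)
    show "AE z in circ. ennreal (poisson b z) * indicator B z \<le> ennreal ((1 + y) / (1 - y)) * indicator B z"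
      using AE_circ_norm
    proof eventually_elim
      case (elim z)
      have "poisson b z \<le> (1 + norm b) / (1 - norm b)" by (rule poisson_le[OF b1 elim])
      also have "\<dots> \<le> (1 + y) / (1 - y)" using b order_trans[OF norm_ge_zero b(1)] by (intro frac_le) auto
      finally show ?case by (intro mult_right_mono ennreal_leI) auto
    qed
  qed
  also have "\<dots> = ennreal ((1 + y) / (1 - y)) * emeasure circ B"
    by (subst nn_integral_cmult) auto
  finally show ?thesis .
qed

text \<open>Points outside A' lie at distance at least 2 y from z, and the pole at distance y^3 from
  the circle, so the kernel there is at most 8 y^3 / (2 y)^2 = 2 y. By \<open>poisson_swap\<close>
  the integral may run over the poles, as the Fubini argument in \<open>mixing_upper\<close>
  requires.\<close>

lemma poisson_mass_near:
  assumes y: "0 < y" "y \<le> 1 / 4" and z: "norm z = 1" and [measurable]: "A' \<in> sets borel"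
    and sep: "\<And>w. norm w = 1 \<Longrightarrow> w \<notin> A' \<Longrightarrow> 2 * y \<le> norm (z - w)"
  shows "ennreal (1 - 2 * y) \<le> (\<integral>\<^sup>+w. indicator A' w * ennreal (poisson (of_real (1 - y ^ 3) * w) z) \<partial>circ)"
proof -
  define s where "s = 1 - y ^ 3"
  have "y ^ 3 \<le> 1 ^ 3" using y by (intro power_mono) auto
  hence s: "0 \<le> s" "s < 1" using y by (auto simp: s_def)
  have a: "norm (of_real s * z) < 1" using z s by (intro norm_of_real_mult_less)
  define P where "P = (\<lambda>w. poisson (of_real s * z) w)"
  have [measurable]: "P \<in> borel_measurable borel" unfolding P_def by measurable
  have "1 = (\<integral>\<^sup>+w. ennreal (P w) \<partial>circ)" unfolding P_def using nn_integral_poisson[OF a] by simp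
  also have "\<dots> \<le> (\<integral>\<^sup>+w. indicator A' w * ennreal (P w) + ennreal (2 * y) \<partial>circ)"
  proof (rule nn_integral_mono_AE)
    show "AE w in circ. ennreal (P w) \<le> indicator A' w * ennreal (P w) + ennreal (2 * y)"
      using AE_circ_norm
    proof eventually_elim
      case (elim w)
      show ?case
      proof (cases "w \<in> A'")
        case False
        have zw: "2 * y \<le> norm (w - z)" using sep[OF elim False] by (simp add: norm_minus_commute)
        hence "w \<noteq> z" using y by auto
        hence "P w \<le> 8 * (1 - s) / (norm (w - z))\<^sup>2"
          unfolding P_def by (rule poisson_radial_le(2)[OF z elim s])
        also have "\<dots> \<le> 8 * (1 - s) / (2 * y)\<^sup>2"
          using zw y s by (intro divide_left_mono power_mono mult_pos_pos zero_less_power) auto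
        also have "\<dots> = 2 * y" using y by (simp add: s_def power2_eq_square power3_eq_cube)
        finally show ?thesis using False by (simp add: ennreal_leI)
      qed simp
    qed
  qed
  also have "\<dots> = (\<integral>\<^sup>+w. indicator A' w * ennreal (P w) \<partial>circ) + ennreal (2 * y)"
    using circ.emeasure_space_1 by (subst nn_integral_add) auto
  also have "(\<integral>\<^sup>+w. indicator A' w * ennreal (P w) \<partial>circ) =
     (\<integral>\<^sup>+w. indicator A' w * ennreal (poisson (of_real s * w) z) \<partial>circ)"
  proof (rule nn_integral_cong_AE)
    show "AE w in circ. indicator A' w * ennreal (P w) = indicator A' w * ennreal (poisson (of_real s * w) z)"
      using AE_circ_norm by eventually_elim (simp add: P_def poisson_swap[OF z])
  qed
  finally have "ennreal 1 \<le> (\<integral>\<^sup>+w. indicator A' w * ennreal (poisson (of_real s * w) z) \<partial>circ) + ennreal (2 * y)"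
    by simp
  hence "ennreal 1 - ennreal (2 * y) \<le> (\<integral>\<^sup>+w. indicator A' w * ennreal (poisson (of_real s * w) z) \<partial>circ)"
    by (simp only: ennreal_minus_le_iff) (auto simp: add.commute)
  moreover have "ennreal (1 - 2 * y) = ennreal 1 - ennreal (2 * y)"
    using y by (intro ennreal_minus[symmetric]) auto
  ultimately show ?thesis by (simp only: s_def)
qed

text \<open>
  \<open>A\<close> is dominated by a superposition of Poisson kernels with poles near the enlargement \<open>A'\<close>,
  and \<open>G\<close> maps harmonic measure at \<open>a\<close> to harmonic measure at \<open>\<gamma> a\<close>, which is
  almost uniform.
\<close>

lemma mixing_upper:
  assumes [measurable]: "G \<in> borel_measurable borel"
    and tr: "\<And>a. norm a < 1 \<Longrightarrow> distr (poisson_measure a) borel G = poisson_measure (\<gamma> a)"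
    and y: "0 < y" "y \<le> 1 / 4"
    and small: "\<And>w. norm w = 1 \<Longrightarrow> norm (\<gamma> (of_real (1 - y ^ 3) * w)) \<le> y"
    and [measurable]: "A \<in> sets borel" "A' \<in> sets borel" "B \<in> sets borel"
    and sep: "\<And>z w. norm z = 1 \<Longrightarrow> z \<in> A \<Longrightarrow> norm w = 1 \<Longrightarrow> w \<notin> A' \<Longrightarrow> 2 * y \<le> norm (z - w)"
    and A': "measure circ A' \<le> q + y" and q: "0 \<le> q" "q \<le> 1"
  shows "measure circ (A \<inter> G -` B) \<le> (q + 24 * y) * measure circ B"
proof -
  have [measurable]: "G -` B \<in> sets borel" by (intro measurable_sets_borel[of G borel]) auto
  have sep': "\<And>w. norm w = 1 \<Longrightarrow> w \<notin> A' \<Longrightarrow> 2 * y \<le> norm (z - w)" if "norm z = 1" "z \<in> A" for z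
    using sep[OF that] .
  define s where "s = 1 - y ^ 3"
  have "y ^ 3 \<le> 1 ^ 3" using y by (intro power_mono) auto
  hence s: "0 \<le> s" "s < 1" using y by (auto simp: s_def)
  interpret P: pair_sigma_finite circ circ ..
  have "ennreal (1 - 2 * y) * emeasure circ (A \<inter> G -` B) =
      (\<integral>\<^sup>+z. ennreal (1 - 2 * y) * indicator (A \<inter> G -` B) z \<partial>circ)"
    by (subst nn_integral_cmult) auto
  also have "\<dots> \<le> (\<integral>\<^sup>+z. (\<integral>\<^sup>+w. indicator (G -` B) z * indicator A' w * ennreal (poisson (of_real s * w) z) \<partial>circ) \<partial>circ)"
  proof (rule nn_integral_mono_AE)
    show "AE z in circ. ennreal (1 - 2 * y) * indicator (A \<inter> G -` B) z \<le>
       (\<integral>\<^sup>+w. indicator (G -` B) z * indicator A' w * ennreal (poisson (of_real s * w) z) \<partial>circ)"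
      using AE_circ_norm
    proof eventually_elim
      case (elim z)
      show ?case
      proof (cases "z \<in> A \<inter> G -` B")
        case True
        thus ?thesis using poisson_mass_near[OF y elim _ sep'[OF elim], of A'] by (simp add: s_def)
      qed simp
    qed
  qed
  also have "\<dots> = (\<integral>\<^sup>+w. (\<integral>\<^sup>+z. indicator (G -` B) z * indicator A' w * ennreal (poisson (of_real s * w) z) \<partial>circ) \<partial>circ)"
    by (rule P.Fubini'[symmetric]) measurable
  also have "\<dots> \<le> (\<integral>\<^sup>+w. indicator A' w * (ennreal ((1 + y) / (1 - y)) * emeasure circ B) \<partial>circ)"
  proof (rule nn_integral_mono_AE)
    show "AE w in circ. (\<integral>\<^sup>+z. indicator (G -` B) z * indicator A' w * ennreal (poisson (of_real s * w) z) \<partial>circ)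
        \<le> indicator A' w * (ennreal ((1 + y) / (1 - y)) * emeasure circ B)"
      using AE_circ_norm
    proof eventually_elim
      case (elim w)
      have a: "norm (of_real s * w) < 1" using elim s by (intro norm_of_real_mult_less)
      have "(\<integral>\<^sup>+z. indicator (G -` B) z * indicator A' w * ennreal (poisson (of_real s * w) z) \<partial>circ) =
         (\<integral>\<^sup>+z. indicator A' w * (ennreal (poisson (of_real s * w) z) * indicator (G -` B) z) \<partial>circ)"
        by (simp only: mult_ac)
      also have "\<dots> = indicator A' w * (\<integral>\<^sup>+z. ennreal (poisson (of_real s * w) z) * indicator (G -` B) z \<partial>circ)"
        by (rule nn_integral_cmult) measurable
      also have "(\<integral>\<^sup>+z. ennreal (poisson (of_real s * w) z) * indicator (G -` B) z \<partial>circ) =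
          emeasure (poisson_measure (of_real s * w)) (G -` B)"
        unfolding poisson_measure_def by (subst emeasure_density) auto
      also have "\<dots> = emeasure (distr (poisson_measure (of_real s * w)) borel G) B"
        by (subst emeasure_distr) auto
      also have "\<dots> = emeasure (poisson_measure (\<gamma> (of_real s * w))) B"
        using tr[OF a] by simp
      also have "\<dots> \<le> ennreal ((1 + y) / (1 - y)) * emeasure circ B"
        using small[OF elim] y by (intro emeasure_poisson_measure_le) (auto simp: s_def)
      finally show ?case by (simp add: mult_left_mono)
    qed
  qed
  also have "\<dots> = ennreal ((1 + y) / (1 - y)) * emeasure circ B * emeasure circ A'"
    by (subst nn_integral_multc) (auto simp: mult_ac)
  finally have "ennreal ((1 - 2 * y) * measure circ (A \<inter> G -` B)) \<le>
     ennreal ((1 + y) / (1 - y) * measure circ B * measure circ A')"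
    using y by (simp add: circ.emeasure_eq_measure flip: ennreal_mult')
  hence "(1 - 2 * y) * measure circ (A \<inter> G -` B) \<le> (1 + y) / (1 - y) * measure circ B * measure circ A'"
    using y by (subst (asm) ennreal_le_iff) auto
  also have "\<dots> \<le> (1 + y) / (1 - y) * measure circ B * (q + y)"
    using y A' by (intro mult_left_mono) auto
  also have "\<dots> \<le> ((1 - 2 * y) * (q + 24 * y)) * measure circ B"
  proof -
    \<comment> \<open>This inequality fixes the constant 24: the slack is y times a factor that is
      nonnegative for y \<le> 1 / 4, because 4 - 2 y \<le> 23 - 73 y there.\<close>
    have "(1 + y) * (q + y) \<le> (1 - 2 * y) * (q + 24 * y) * (1 - y)"
    proof -
      have eq: "(1 - 2 * y) * (q + 24 * y) * (1 - y) - (1 + y) * (q + y) =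
         y * ((23 - 73 * y + 48 * y\<^sup>2) - q * (4 - 2 * y))"
        by (simp add: power2_eq_square algebra_simps)
      have "q * (4 - 2 * y) \<le> 1 * (4 - 2 * y)" using q y by (intro mult_right_mono) auto
      also have "\<dots> \<le> 23 - 73 * y" using y by simp
      also have "\<dots> \<le> 23 - 73 * y + 48 * y\<^sup>2" by simp
      finally have "0 \<le> (23 - 73 * y + 48 * y\<^sup>2) - q * (4 - 2 * y)" by (simp only: diff_ge_0_iff_ge)
      hence "0 \<le> y * ((23 - 73 * y + 48 * y\<^sup>2) - q * (4 - 2 * y))" using y by simp
      with eq show ?thesis by linarith
    qed
    hence "(1 + y) / (1 - y) * (q + y) \<le> (1 - 2 * y) * (q + 24 * y)"
      using y by (simp add: divide_simps)
    hence "(1 + y) / (1 - y) * (q + y) * measure circ B \<le> (1 - 2 * y) * (q + 24 * y) * measure circ B"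
      by (intro mult_right_mono) auto
    thus ?thesis by (simp only: mult_ac)
  qed
  finally have "(1 - 2 * y) * measure circ (A \<inter> G -` B) \<le> (1 - 2 * y) * ((q + 24 * y) * measure circ B)"
    by (simp only: mult_ac)
  thus ?thesis using y by (subst (asm) mult_le_cancel_left_pos) auto
qed

text \<open>The lower bound is the upper bound for the complementary arc, since G preserves the
  measure of B. For y > 1 / 4 the claim is trivial because 24 y exceeds 1. The factor
  \<open>measure circ B\<close> in the error later makes the variance linear in the sum of the
  radii.\<close>

lemma mixing_circle_ball:
  assumes G [measurable]: "G \<in> borel_measurable borel"
    and tr: "\<And>a. norm a < 1 \<Longrightarrow> distr (poisson_measure a) borel G = poisson_measure (\<gamma> a)"
    and \<gamma>0: "\<gamma> 0 = 0" and y: "0 < y"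
    and small: "\<And>w. norm w = 1 \<Longrightarrow> y \<le> 1 / 4 \<Longrightarrow> norm (\<gamma> (of_real (1 - y ^ 3) * w)) \<le> y"
    and c: "norm c = 1" and \<rho>: "0 < \<rho>" "\<rho> \<le> 1" and B [measurable]: "B \<in> sets borel"
  shows "\<bar>measure circ (circle_ball c \<rho> \<inter> G -` B) - \<rho> * measure circ B\<bar> \<le> 24 * y * measure circ B"
proof -
  note [measurable] = circle_ball_measurable[OF c]
  have [measurable]: "G -` B \<in> sets borel" by (intro measurable_sets_borel[of G borel]) auto
  have inv: "measure circ (G -` B) = measure circ B"
  proof -
    have "measure (distr circ borel G) B = measure circ (G -` B)" by (subst measure_distr) auto
    thus ?thesis using tr[of 0] by (simp add: \<gamma>0 poisson_measure_0)
  qed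
  let ?A = "circle_ball c \<rho>"
  have split: "measure circ (G -` B) = measure circ (?A \<inter> G -` B) + measure circ (- ?A \<inter> G -` B)"
    by (subst circ.finite_measure_Union[symmetric]) (auto intro!: arg_cong[where f = "measure circ"])
  have bB: "0 \<le> measure circ B" "0 \<le> measure circ (?A \<inter> G -` B)" "0 \<le> measure circ (- ?A \<inter> G -` B)" by auto
  show ?thesis
  proof (cases "y \<le> 1 / 4")
    case False
    have "\<rho> * measure circ B \<le> 1 * measure circ B" using \<rho> by (intro mult_right_mono) auto
    moreover have "1 * measure circ B \<le> 24 * y * measure circ B" using False by (intro mult_right_mono) auto
    moreover have "0 \<le> \<rho> * measure circ B" using \<rho> by simp
    ultimately show ?thesis using split inv bB by linarith
  next
    case True
    have s: "norm (\<gamma> (of_real (1 - y ^ 3) * w)) \<le> y" if "norm w = 1" for w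
      using small[OF that True] .
    have up: "measure circ (?A \<inter> G -` B) \<le> (\<rho> + 24 * y) * measure circ B"
    proof (rule mixing_upper[OF G tr y True s])
      \<comment> \<open>An enlarged arc of radius above 1 is replaced by the whole plane, whose mass
        1 is still at most \<rho> + y.\<close>
      define A' where "A' = (if \<rho> + y \<le> 1 then circle_ball c (\<rho> + y) else UNIV)"
      show "A' \<in> sets borel" by (simp add: A'_def)
      show "2 * y \<le> norm (z - w)" if "norm z = 1" "z \<in> ?A" "norm w = 1" "w \<notin> A'" for z w
        using that y \<rho> circle_ball_separation[OF c that(2,3), of "\<rho> + y" y]
        by (auto simp: A'_def norm_minus_commute split: if_splits)
      show "measure circ A' \<le> \<rho> + y"
        using \<rho> y circ.prob_space by (auto simp: A'_def measure_circle_ball[OF c])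
    qed (use \<rho> in auto)
    have lo: "measure circ (- ?A \<inter> G -` B) \<le> ((1 - \<rho>) + 24 * y) * measure circ B"
    proof (rule mixing_upper[OF G tr y True s])
      \<comment> \<open>Enlarging the complement means shrinking the arc; if the arc would vanish,
        everything is taken.\<close>
      define A' where "A' = (if \<rho> - y \<ge> 0 then - circle_ball c (\<rho> - y) else UNIV)"
      show "A' \<in> sets borel" by (auto simp: A'_def)
      show "2 * y \<le> norm (z - w)" if "norm z = 1" "z \<in> - ?A" "norm w = 1" "w \<notin> A'" for z w
        using that y \<rho> circle_ball_separation[OF c _ that(1), of w "\<rho> - y" \<rho> y]
        by (auto simp: A'_def split: if_splits)
      have "measure circ (- circle_ball c (\<rho> - y)) = 1 - (\<rho> - y)" if "\<rho> - y \<ge> 0"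
        using circ.prob_compl[of "circle_ball c (\<rho> - y)"] that \<rho> y
        by (simp add: Compl_eq_Diff_UNIV measure_circle_ball[OF c])
      thus "measure circ A' \<le> (1 - \<rho>) + y"
        using \<rho> y circ.prob_space by (auto simp: A'_def)
    qed (use \<rho> in auto)
    have "measure circ (?A \<inter> G -` B) - \<rho> * measure circ B \<le> 24 * y * measure circ B"
      using up by (simp add: algebra_simps)
    moreover have "- (measure circ (?A \<inter> G -` B) - \<rho> * measure circ B) \<le> 24 * y * measure circ B"
      using lo split inv by (simp add: algebra_simps)
    ultimately show ?thesis by (rule abs_leI)
  qed
qed

lemma mixing_forward_comp:
  assumes rb: "\<And>n. 1 \<le> n \<Longrightarrow> radial_boundary (f n) (g n)" and f0: "\<And>n. 1 \<le> n \<Longrightarrow> f n 0 = 0"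
    and d: "\<And>n. 1 \<le> n \<Longrightarrow> norm (deriv (f n) 0) \<le> \<alpha>" and \<alpha>: "\<alpha> < 1"
    and c: "norm c = 1" and \<rho>: "0 < \<rho>" "\<rho> \<le> 1" and B: "B \<in> sets borel" and n: "1 \<le> n"
  shows "\<bar>measure circ (circle_ball c \<rho> \<inter> forward_comp g n -` B) - \<rho> * measure circ B\<bar>
     \<le> 24 * root 6 ((1 + \<alpha>) / 2) ^ n * measure circ B"
proof (rule mixing_circle_ball)
  have FG: "radial_boundary (forward_comp f n) (forward_comp g n)"
    by (rule radial_boundary_forward_comp[OF rb f0 n])
  show "forward_comp g n \<in> borel_measurable borel" using FG by (rule radial_boundary_measurable)
  show "distr (poisson_measure a) borel (forward_comp g n) = poisson_measure (forward_comp f n a)"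
    if "norm a < 1" for a using FG that by (rule distr_poisson_measure)
  show "forward_comp f n 0 = 0" by (rule forward_comp_fixes_0) (rule f0)
  define \<beta> where "\<beta> = (1 + \<alpha>) / 2"
  define y where "y = root 6 \<beta> ^ n"
  have \<alpha>0: "0 \<le> \<alpha>" using order_trans[OF norm_ge_zero d[of 1]] by simp
  have \<beta>: "0 < \<beta>" "\<beta> < 1" using \<alpha> \<alpha>0 by (auto simp: \<beta>_def)
  have y0: "0 < y" using \<beta> by (simp add: y_def)
  \<comment> \<open>This choice of y turns the pole estimate \<beta>^n / y^3 into y^3, which is at
    most y.\<close>
  have y6: "y ^ 6 = \<beta> ^ n"
  proof -
    have "y ^ 6 = (root 6 \<beta> ^ 6) ^ n" unfolding y_def by (simp only: power_mult[symmetric] mult.commute)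
    also have "root 6 \<beta> ^ 6 = \<beta>" using \<beta> by (intro real_root_pow_pos2) auto
    finally show ?thesis .
  qed
  show "0 < root 6 ((1 + \<alpha>) / 2) ^ n" using y0 unfolding y_def \<beta>_def .
  show "norm (forward_comp f n (of_real (1 - (root 6 ((1 + \<alpha>) / 2) ^ n) ^ 3) * w)) \<le> root 6 ((1 + \<alpha>) / 2) ^ n"
    if w: "norm w = 1" and y14: "root 6 ((1 + \<alpha>) / 2) ^ n \<le> 1 / 4" for w
  proof -
    have y1: "y \<le> 1" using y14 unfolding y_def \<beta>_def by linarith
    have y3: "0 < y ^ 3" "y ^ 3 \<le> 1" using y0 y1 by (auto simp: power_le_one)
    let ?a = "complex_of_real (1 - y ^ 3) * w"
    have na: "norm ?a = 1 - y ^ 3" using w y3 by (simp only: norm_mult norm_of_real) simp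
    have a: "norm ?a < 1" using na y3 by simp
    have "norm (forward_comp f n ?a) \<le> \<beta> ^ n / (1 - norm ?a)"
      using norm_forward_comp_le[of f g \<alpha>, OF rb f0 d \<alpha> a] unfolding \<beta>_def by blast
    also have "\<dots> = y ^ 6 / y ^ 3" unfolding na y6 by simp
    also have "\<dots> = y ^ 3" using y0 by (simp add: divide_simps flip: power_add)
    also have "\<dots> \<le> y ^ 1" using y0 y1 by (intro power_decreasing) auto
    finally show ?thesis unfolding y_def \<beta>_def by simp
  qed
qed (use assms in auto)


section \<open>Counting from a variance bound\<close>

text \<open>Truncate the binary expansion of j at each digit: consecutive truncations differ by
  nothing or by one dyadic block, so Y j telescopes over t + 1 levels. Cauchy-Schwarz costs the
  factor t + 1, and summing over all blocks of a level makes the bound uniform in j.\<close>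

lemma dyadic_chaining:
  fixes Y :: "nat \<Rightarrow> real"
  assumes Y0: "Y 0 = 0" and j: "j \<le> 2 ^ t"
  shows "(Y j)\<^sup>2 \<le> real (t + 1) * (\<Sum>s\<le>t. \<Sum>i<2 ^ (t - s). (Y ((i + 1) * 2 ^ s) - Y (i * 2 ^ s))\<^sup>2)"
proof -
  define a where "a = (\<lambda>s. Y (j div 2 ^ s * 2 ^ s))"
  have "j < 2 ^ Suc t" using le_less_trans[OF j, of "2 ^ Suc t"] by simp
  hence at: "a (Suc t) = 0" using Y0 unfolding a_def by (simp add: div_less del: power_Suc)
  have "(\<Sum>s<Suc t. a s - a (Suc s)) = a 0 - a (Suc t)" by (rule sum_lessThan_telescope')
  hence "Y j = (\<Sum>s\<le>t. a s - a (Suc s))" using at by (simp add: a_def lessThan_Suc_atMost)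
  hence "(Y j)\<^sup>2 \<le> (\<Sum>s\<le>t. (a s - a (Suc s))\<^sup>2) * real (card {..t})"
    by (simp only:) (rule sum_squared_le_sum_of_squares)
  also have "\<dots> = real (t + 1) * (\<Sum>s\<le>t. (a s - a (Suc s))\<^sup>2)" by simp
  also have "\<dots> \<le> real (t + 1) * (\<Sum>s\<le>t. \<Sum>i<2 ^ (t - s). (Y ((i + 1) * 2 ^ s) - Y (i * 2 ^ s))\<^sup>2)"
  proof (intro mult_left_mono sum_mono)
    fix s assume "s \<in> {..t}"
    hence s: "s \<le> t" by simp
    define q where "q = j div 2 ^ s"
    have q: "j div 2 ^ Suc s = q div 2" unfolding q_def power_Suc2 by (rule div_mult2_eq)
    let ?f = "\<lambda>i. (Y ((i + 1) * 2 ^ s) - Y (i * 2 ^ s))\<^sup>2"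
    show "(a s - a (Suc s))\<^sup>2 \<le> sum ?f {..<2 ^ (t - s)}"
    \<comment> \<open>The parity of q is the binary digit of j at level s; the digit 0 contributes
      nothing.\<close>
    proof (cases "even q")
      case True
      hence "a (Suc s) = a s" unfolding a_def q by (simp add: q_def[symmetric] mult.assoc[symmetric])
      thus ?thesis by (simp add: sum_nonneg)
    next
      case False
      then obtain p where p: "q = 2 * p + 1" by (elim oddE)
      have "a s - a (Suc s) = Y ((2 * p + 1) * 2 ^ s) - Y (2 * p * 2 ^ s)"
        unfolding a_def q by (simp add: q_def[symmetric] p mult_ac)
      moreover have "2 * p < 2 ^ (t - s)"
      proof -
        have "q \<le> 2 ^ t div 2 ^ s" unfolding q_def using j by (rule div_le_mono)
        also have "\<dots> = 2 ^ (t - s)" using s by (simp add: power_diff)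
        finally show ?thesis using p by simp
      qed
      hence "?f (2 * p) \<le> sum ?f {..<2 ^ (t - s)}" by (intro member_le_sum) auto
      ultimately show ?thesis by simp
    qed
  qed auto
  finally show ?thesis .
qed

text \<open>The series of the quotients \<open>D t x / w t\<close> has finite expectation, hence
  converges almost surely, and each of its terms is at most the sum.\<close>

lemma AE_bounded_of_expectation_le:
  fixes D :: "nat \<Rightarrow> 'a \<Rightarrow> real"
  assumes [measurable]: "\<And>t. D t \<in> borel_measurable M" and pos: "\<And>t x. 0 \<le> D t x"
    and int: "\<And>t. integrable M (D t)" and w: "\<And>t. w t > 0"
    and sm: "summable (\<lambda>t. (LINT x|M. D t x) / w t)"
  shows "AE x in M. \<exists>K\<ge>0. \<forall>t. D t x \<le> K * w t"
proof -
  have "(\<integral>\<^sup>+x. (\<Sum>t. ennreal (D t x / w t)) \<partial>M) = (\<Sum>t. \<integral>\<^sup>+x. ennreal (D t x / w t) \<partial>M)"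
    by (rule nn_integral_suminf) measurable
  also have "\<dots> = (\<Sum>t. ennreal ((LINT x|M. D t x) / w t))"
  proof (rule suminf_cong)
    fix t
    have "(\<integral>\<^sup>+x. ennreal (D t x / w t) \<partial>M) = ennreal (LINT x|M. D t x / w t)"
      using int pos w by (intro nn_integral_eq_integral) (auto simp: less_imp_le)
    thus "(\<integral>\<^sup>+x. ennreal (D t x / w t) \<partial>M) = ennreal ((LINT x|M. D t x) / w t)" by simp
  qed
  also have "\<dots> < \<infinity>"
  proof -
    have "(\<Sum>t. ennreal ((LINT x|M. D t x) / w t)) = ennreal (\<Sum>t. (LINT x|M. D t x) / w t)"
      using sm pos w by (intro suminf_ennreal2) (auto simp: less_imp_le)
    thus ?thesis by simp
  qed
  finally have "AE x in M. (\<Sum>t. ennreal (D t x / w t)) \<noteq> \<infinity>"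
    by (intro nn_integral_noteq_infinite) auto
  thus ?thesis
  proof eventually_elim
    case (elim x)
    define K where "K = enn2real (\<Sum>t. ennreal (D t x / w t))"
    have K: "ennreal K = (\<Sum>t. ennreal (D t x / w t))"
      using elim unfolding K_def by (intro ennreal_enn2real) (simp add: less_top[symmetric])
    have "D t x \<le> K * w t" for t
    proof -
      have "ennreal (D t x / w t) \<le> ennreal K"
        unfolding K using sum_le_suminf[of "\<lambda>t. ennreal (D t x / w t)" "{t}"] by simp
      hence "D t x / w t \<le> K" by (subst (asm) ennreal_le_iff) (auto simp: K_def)
      thus ?thesis using w[of t] by (simp add: divide_simps)
    qed
    moreover have "0 \<le> K" by (simp add: K_def)
    ultimately show ?case by blast
  qed
qed

text \<open>
  The times \<open>n j\<close> at which \<open>\<Phi>\<close> reaches the level \<open>j\<close> reduce the claim to a random walk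
  whose increments over dyadic blocks of levels have variance proportional to their length.
\<close>

theorem counting_from_variance:
  fixes X :: "nat \<Rightarrow> 'a \<Rightarrow> real" and \<phi> :: "nat \<Rightarrow> real" and C \<epsilon> :: real
  assumes "prob_space M" and X [measurable]: "\<And>k. X k \<in> borel_measurable M"
    and X01: "\<And>k x. 0 \<le> X k x \<and> X k x \<le> 1" and \<phi>01: "\<And>k. 0 \<le> \<phi> k \<and> \<phi> k \<le> 1"
    and var: "\<And>m n. m \<le> n \<Longrightarrow>
      (LINT x|M. (\<Sum>k\<in>{m<..n}. X k x - \<phi> k)\<^sup>2) \<le> C * (\<Sum>k\<in>{m<..n}. \<phi> k)"
    and C: "0 \<le> C" and div: "\<not> summable (\<lambda>k. \<phi> (Suc k))" and \<epsilon>: "\<epsilon> > 0"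
  shows "AE x in M. \<exists>K. \<forall>N. 1 \<le> (\<Sum>k=1..N. \<phi> k) \<longrightarrow>
    \<bar>(\<Sum>k=1..N. X k x) - (\<Sum>k=1..N. \<phi> k)\<bar> \<le>
      K * ((\<Sum>k=1..N. \<phi> k) powr (1/2) * log_err (\<Sum>k=1..N. \<phi> k) powr (3/2 + \<epsilon>))"
proof -
  interpret prob_space M by fact
  define \<Phi> where "\<Phi> = (\<lambda>N. \<Sum>k=1..N. \<phi> k)"
  have \<Phi>_Suc: "\<Phi> (Suc N) = \<Phi> N + \<phi> (Suc N)" for N by (simp add: \<Phi>_def)
  have \<Phi>0: "\<Phi> 0 = 0" by (simp add: \<Phi>_def)
  have \<Phi>_mono: "\<Phi> m \<le> \<Phi> n" if "m \<le> n" for m n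
    using that \<phi>01 unfolding \<Phi>_def by (intro sum_mono2) auto
  have block: "{1..n} = {1..m} \<union> {m<..n}" if "m \<le> n" for m n :: nat using that by auto
  have sum_block: "(\<Sum>k\<in>{m<..n}. h k) = (\<Sum>k=1..n. h k) - (\<Sum>k=1..m. h k)" if "m \<le> n" for m n and h :: "nat \<Rightarrow> real"
    unfolding block[OF that] by (subst sum.union_disjoint) auto
  have unbounded: "\<exists>N. b \<le> \<Phi> N" for b
  proof (rule ccontr)
    assume "\<nexists>N. b \<le> \<Phi> N"
    hence b: "\<Phi> N \<le> b" for N by (simp add: not_le less_imp_le)
    have "(\<Sum>k<N. \<phi> (Suc k)) = \<Phi> N" for N by (induction N) (simp_all add: \<Phi>0 \<Phi>_Suc)
    hence "summable (\<lambda>k. \<phi> (Suc k))" using \<phi>01 b by (intro bounded_imp_summable[of _ b]) (auto simp flip: lessThan_Suc_atMost)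
    thus False using div by simp
  qed
  define n where "n = (\<lambda>j::nat. LEAST N. real j \<le> \<Phi> N)"
  have n_ge: "real j \<le> \<Phi> (n j)" for j unfolding n_def using unbounded by (rule LeastI_ex)
  have n_le: "n j \<le> N" if "real j \<le> \<Phi> N" for j N unfolding n_def using that by (rule Least_le)
  have n0: "n 0 = 0" using n_le[of 0 0] \<Phi>0 by simp
  \<comment> \<open>The overshoot over the level is at most 1 because every increment of \<Phi>
    is.\<close>
  have n_less: "\<Phi> (n j) \<le> real j + 1" for j
  proof (cases "n j")
    case (Suc m)
    have "\<Phi> m < real j" using n_le[of j m] Suc by (cases "real j \<le> \<Phi> m") auto
    thus ?thesis using Suc \<Phi>_Suc[of m] \<phi>01[of "Suc m"] by simp
  qed (simp add: \<Phi>0)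
  have n_mono: "n i \<le> n j" if "i \<le> j" for i j
    using n_ge[of j] that by (intro n_le) simp
  define S where "S = (\<lambda>N x. \<Sum>k=1..N. X k x)"
  have S_mono: "S m x \<le> S n x" if "m \<le> n" for m n x
    using that X01 unfolding S_def by (intro sum_mono2) auto
  define Y where "Y = (\<lambda>j x. S (n j) x - \<Phi> (n j))"
  have [measurable]: "Y j \<in> borel_measurable M" for j unfolding Y_def S_def by measurable
  \<comment> \<open>The quantity produced by \<open>dyadic_chaining\<close>. At each level the
    variance bounds telescope to the total, so the number of levels contributes a factor t + 1 to
    the expectation.\<close>
  define D where "D = (\<lambda>t x. \<Sum>s\<le>t. \<Sum>i<2 ^ (t - s). (Y ((i + 1) * 2 ^ s) x - Y (i * 2 ^ s) x)\<^sup>2)"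
  have [measurable]: "D t \<in> borel_measurable M" for t unfolding D_def by measurable
  have Ydiff: "Y j x - Y i x = (\<Sum>k\<in>{n i<..n j}. X k x - \<phi> k)" if "i \<le> j" for i j x
    using n_mono[OF that] by (simp add: Y_def S_def \<Phi>_def sum_subtractf sum_block)
  have intY: "integrable M (\<lambda>x. (Y j x - Y i x)\<^sup>2)" if "i \<le> j" for i j
  proof (rule integrable_const_bound[where B = "(real (card {n i<..n j}))\<^sup>2"])
    show "AE x in M. norm ((Y j x - Y i x)\<^sup>2) \<le> (real (card {n i<..n j}))\<^sup>2"
    proof (rule AE_I2)
      fix x
      have "\<bar>Y j x - Y i x\<bar> \<le> (\<Sum>k\<in>{n i<..n j}. 1)"
        unfolding Ydiff[OF that] by (rule order_trans[OF sum_abs sum_mono]) (use X01 \<phi>01 in \<open>smt (verit)\<close>)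
      hence "\<bar>Y j x - Y i x\<bar>\<^sup>2 \<le> (real (card {n i<..n j}))\<^sup>2" by (intro power_mono) auto
      thus "norm ((Y j x - Y i x)\<^sup>2) \<le> (real (card {n i<..n j}))\<^sup>2" by simp
    qed
  qed auto
  have step: "i * 2 ^ s \<le> (i + 1) * 2 ^ s" for i s :: nat by simp
  have intD: "integrable M (D t)" for t
    unfolding D_def by (intro Bochner_Integration.integrable_sum intY step)
  have ED: "(LINT x|M. D t x) \<le> 2 * C * real (t + 1) * 2 ^ t" for t
  proof -
    have "(LINT x|M. D t x) = (\<Sum>s\<le>t. \<Sum>i<2 ^ (t - s). LINT x|M. (Y ((i + 1) * 2 ^ s) x - Y (i * 2 ^ s) x)\<^sup>2)"
      unfolding D_def by (simp only: Bochner_Integration.integral_sum Bochner_Integration.integrable_sum intY step)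
    also have "\<dots> \<le> (\<Sum>s\<le>t. 2 * C * 2 ^ t)"
    proof (rule sum_mono)
      fix s assume "s \<in> {..t}"
      hence s: "s \<le> t" by simp
      have "(\<Sum>i<2 ^ (t - s). LINT x|M. (Y ((i + 1) * 2 ^ s) x - Y (i * 2 ^ s) x)\<^sup>2) \<le>
        (\<Sum>i<2 ^ (t - s). C * (\<Phi> (n (Suc i * 2 ^ s)) - \<Phi> (n (i * 2 ^ s))))"
      proof (rule sum_mono)
        fix i
        show "(LINT x|M. (Y ((i + 1) * 2 ^ s) x - Y (i * 2 ^ s) x)\<^sup>2) \<le> C * (\<Phi> (n (Suc i * 2 ^ s)) - \<Phi> (n (i * 2 ^ s)))"
          using var[OF n_mono[OF step[of i s]]] sum_block[OF n_mono[OF step[of i s]], of \<phi>]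
          by (simp only: Ydiff[OF step] \<Phi>_def Suc_eq_plus1)
      qed
      also have "\<dots> = C * (\<Sum>i<2 ^ (t - s). \<Phi> (n (Suc i * 2 ^ s)) - \<Phi> (n (i * 2 ^ s)))"
        by (simp only: sum_distrib_left)
      also have "(\<Sum>i<2 ^ (t - s). \<Phi> (n (Suc i * 2 ^ s)) - \<Phi> (n (i * 2 ^ s))) = \<Phi> (n (2 ^ (t - s) * 2 ^ s)) - \<Phi> (n (0 * 2 ^ s))"
        by (rule sum_lessThan_telescope)
      also have "\<dots> = \<Phi> (n (2 ^ t))" using s n0 \<Phi>0 by (simp flip: power_add)
      also have "C * \<Phi> (n (2 ^ t)) \<le> C * (2 * 2 ^ t)"
      proof (rule mult_left_mono[OF _ C])
        have "\<Phi> (n (2 ^ t)) \<le> 2 ^ t + 1" using n_less[of "2 ^ t"] by simp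
        also have "\<dots> \<le> 2 * 2 ^ t" by simp
        finally show "\<Phi> (n (2 ^ t)) \<le> 2 * 2 ^ t" .
      qed
      finally show "(\<Sum>i<2 ^ (t - s). LINT x|M. (Y ((i + 1) * 2 ^ s) x - Y (i * 2 ^ s) x)\<^sup>2) \<le> 2 * C * 2 ^ t"
        by (simp only: mult_ac)
    qed
    also have "\<dots> = 2 * C * real (t + 1) * 2 ^ t" by simp
    finally show ?thesis .
  qed
  \<comment> \<open>Up to a constant the weight exceeds the expectation of \<open>D t\<close> by (t
    + 1)^(1 + 2 \<epsilon>), whose reciprocals are summable. Together with the factor t + 1 from
    chaining, the square root has exponent 3/2 + \<epsilon>.\<close>
  define w where "w = (\<lambda>t. 2 ^ t * real (t + 1) powr (2 + 2 * \<epsilon>))"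
  have w: "w t > 0" for t by (simp add: w_def)
  have Dpos: "0 \<le> D t x" for t x unfolding D_def by (intro sum_nonneg) auto
  have "summable (\<lambda>t. (LINT x|M. D t x) / w t)"
  proof (rule summable_comparison_test)
    have "(LINT x|M. D t x) / w t \<le> 2 * C * real (t + 1) powr - (1 + 2 * \<epsilon>)" for t
    proof -
      have "(LINT x|M. D t x) / w t \<le> (2 * C * real (t + 1) * 2 ^ t) / w t"
        using ED w[of t] by (intro divide_right_mono) (auto simp: less_imp_le)
      also have "\<dots> = 2 * C * (real (t + 1) powr 1 / real (t + 1) powr (2 + 2 * \<epsilon>))"
        by (simp add: w_def)
      also have "real (t + 1) powr 1 / real (t + 1) powr (2 + 2 * \<epsilon>) = real (t + 1) powr - (1 + 2 * \<epsilon>)"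
        by (subst powr_diff[symmetric]) simp
      finally show ?thesis .
    qed
    moreover have "0 \<le> (LINT x|M. D t x) / w t" for t
      using w[of t] Dpos by (intro divide_nonneg_nonneg integral_nonneg_AE) (auto simp: less_imp_le)
    ultimately show "\<exists>N. \<forall>t\<ge>N. norm ((LINT x|M. D t x) / w t) \<le> 2 * C * real (t + 1) powr - (1 + 2 * \<epsilon>)"
      by (simp only: real_norm_def abs_of_nonneg simp_thms)
    have "summable (\<lambda>t. real t powr - (1 + 2 * \<epsilon>))" using \<epsilon> by (subst summable_real_powr_iff) simp
    hence "summable (\<lambda>t. real (t + 1) powr - (1 + 2 * \<epsilon>))" by (subst summable_iff_shift)
    thus "summable (\<lambda>t. 2 * C * real (t + 1) powr - (1 + 2 * \<epsilon>))" by (rule summable_mult)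
  qed
  hence "AE x in M. \<exists>K\<ge>0. \<forall>t. D t x \<le> K * w t"
    by (intro AE_bounded_of_expectation_le intD w Dpos) auto
  thus ?thesis
  proof eventually_elim
    case (elim x)
    then obtain K where K: "K \<ge> 0" "\<And>t. D t x \<le> K * w t" by blast
    have Y_le: "\<bar>Y j x\<bar> \<le> sqrt K * (sqrt (2 ^ t) * real (t + 1) powr (3/2 + \<epsilon>))" if j: "j \<le> 2 ^ t" for j t
    proof -
      have "(Y j x)\<^sup>2 \<le> real (t + 1) * D t x"
        unfolding D_def by (rule dyadic_chaining[OF _ j]) (simp add: Y_def S_def n0 \<Phi>0)
      also have "\<dots> \<le> real (t + 1) * (K * w t)" using K by (intro mult_left_mono) auto
      also have "\<dots> = K * (2 ^ t * (real (t + 1) powr 1 * real (t + 1) powr (2 + 2 * \<epsilon>)))"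
        by (simp add: w_def mult_ac)
      also have "real (t + 1) powr 1 * real (t + 1) powr (2 + 2 * \<epsilon>) = (real (t + 1) powr (3/2 + \<epsilon>))\<^sup>2"
      proof -
        have "1 + (2 + 2 * \<epsilon>) = (3 / 2 + \<epsilon>) + (3 / 2 + \<epsilon>)" by simp
        hence "real (t + 1) powr (1 + (2 + 2 * \<epsilon>)) = real (t + 1) powr ((3 / 2 + \<epsilon>) + (3 / 2 + \<epsilon>))"
          by (rule arg_cong)
        thus ?thesis unfolding powr_add power2_eq_square .
      qed
      finally have "sqrt ((Y j x)\<^sup>2) \<le> sqrt (K * (2 ^ t * (real (t + 1) powr (3/2 + \<epsilon>))\<^sup>2))"
        by (rule real_sqrt_le_mono)
      thus ?thesis by (simp add: real_sqrt_mult)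
    qed
    show ?case
    proof (intro exI allI impI)
      fix N assume "1 \<le> (\<Sum>k=1..N. \<phi> k)"
      hence \<Phi>1: "1 \<le> \<Phi> N" by (simp add: \<Phi>_def)
      have \<Phi>p: "0 < \<Phi> N" using \<Phi>1 by linarith
      define L where "L = log_err (\<Phi> N)"
      have L1: "1 \<le> L" by (simp add: L_def log_err_def)
      define j where "j = nat \<lfloor>\<Phi> N\<rfloor>"
      have j: "real j \<le> \<Phi> N" "\<Phi> N < real j + 1" "1 \<le> j"
        using \<Phi>1 unfolding j_def by linarith+
      have nj: "n j \<le> N" by (rule n_le[OF j(1)])
      have nj1: "N \<le> n (Suc j)"
      proof (rule ccontr)
        assume "\<not> N \<le> n (Suc j)"
        hence "\<Phi> (n (Suc j)) \<le> \<Phi> N" by (intro \<Phi>_mono) simp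
        thus False using n_ge[of "Suc j"] j by simp
      qed
      define t where "t = (LEAST t. Suc j \<le> 2 ^ t)"
      have t: "Suc j \<le> 2 ^ t"
        unfolding t_def by (rule LeastI[of _ "Suc j"]) (rule less_imp_le[OF less_exp])
      obtain t' where t': "t = Suc t'" using t j by (cases t) auto
      have "\<not> Suc j \<le> 2 ^ t'" using not_less_Least[of t' "\<lambda>t. Suc j \<le> 2 ^ t"] t' by (simp add: t_def)
      hence "2 ^ t' \<le> j" by simp
      hence "real (2 ^ t') \<le> real j" by (rule of_nat_mono)
      hence "real (2 ^ t') \<le> \<Phi> N" using j(1) by (rule order_trans)
      hence t'\<Phi>: "2 ^ t' \<le> \<Phi> N" by simp
      have t\<Phi>: "2 ^ t \<le> 2 * \<Phi> N" using t'\<Phi> t' by simp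
      \<comment> \<open>From 2^t' \<le> \<Phi> N and ln 2 \<ge> 1 / 2 follows t' \<le> 2 L; the
        remaining 2 in t + 1 = t' + 2 is absorbed by L \<ge> 1.\<close>
      have tL: "real (t + 1) \<le> 4 * L"
      proof -
        have "ln (2 ^ t') \<le> ln (\<Phi> N)" using t'\<Phi> \<Phi>p by simp
        hence "real t' * ln 2 \<le> ln (\<Phi> N)" by (simp add: ln_realpow)
        also have "\<dots> \<le> L" by (simp add: L_def log_err_def)
        finally have "real t' * ln 2 \<le> L" .
        moreover have "real t' * (1 / 2) \<le> real t' * ln 2"
          using ln2_ge_two_thirds by (intro mult_left_mono) auto
        ultimately show ?thesis using L1 t' by simp
      qed
      define Q where "Q = \<Phi> N powr (1/2) * L powr (3/2 + \<epsilon>)"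
      have "1 powr (1/2) * 1 powr (3/2 + \<epsilon>) \<le> Q"
        unfolding Q_def using \<Phi>1 L1 \<epsilon> by (intro mult_mono powr_mono2) auto
      hence Q1: "1 \<le> Q" by simp
      define B where "B = sqrt K * (sqrt 2 * 4 powr (3/2 + \<epsilon>))"
      have B0: "0 \<le> B" using K by (simp add: B_def)
      have Yb: "\<bar>Y i x\<bar> \<le> B * Q" if "i \<le> Suc j" for i
      proof -
        have "\<bar>Y i x\<bar> \<le> sqrt K * (sqrt (2 ^ t) * real (t + 1) powr (3/2 + \<epsilon>))"
          using that t by (intro Y_le) simp
        also have "\<dots> \<le> sqrt K * (sqrt (2 * \<Phi> N) * (4 * L) powr (3/2 + \<epsilon>))"
        proof (intro mult_left_mono mult_mono powr_mono2 real_sqrt_le_mono)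
          show "2 ^ t \<le> 2 * \<Phi> N" by (rule t\<Phi>)
          show "real (t + 1) \<le> 4 * L" by (rule tL)
        qed (use K \<epsilon> \<Phi>p in simp_all)
        also have "\<dots> = B * Q"
          using \<Phi>1 L1 by (simp add: B_def Q_def real_sqrt_mult powr_mult powr_half_sqrt)
        finally show ?thesis .
      qed
      \<comment> \<open>Counts are monotone, so the count at N is squeezed between those at the
        level times of j and j + 1. This loses at most 2, which 1 \<le> Q absorbs.\<close>
      have "S N x \<le> S (n (Suc j)) x" by (rule S_mono[OF nj1])
      also have "\<dots> = Y (Suc j) x + \<Phi> (n (Suc j))" by (simp add: Y_def)
      also have "\<dots> \<le> B * Q + (real (Suc j) + 1)" using Yb[of "Suc j"] n_less[of "Suc j"] by linarith
      finally have up: "S N x - \<Phi> N \<le> B * Q + 2" using j by simp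
      have "- (B * Q) + real j \<le> Y j x + \<Phi> (n j)" using Yb[of j] n_ge[of j] by simp
      also have "\<dots> = S (n j) x" by (simp add: Y_def)
      also have "\<dots> \<le> S N x" by (rule S_mono[OF nj])
      finally have lo: "- (B * Q + 2) \<le> S N x - \<Phi> N" using j by simp
      have "\<bar>S N x - \<Phi> N\<bar> \<le> B * Q + 2" using up lo by (intro abs_leI) auto
      also have "\<dots> \<le> (B + 2) * Q" using Q1 by (simp add: distrib_right)
      finally show "\<bar>(\<Sum>k=1..N. X k x) - (\<Sum>k=1..N. \<phi> k)\<bar> \<le>
          (sqrt K * (sqrt 2 * 4 powr (3/2 + \<epsilon>)) + 2) *
          ((\<Sum>k=1..N. \<phi> k) powr (1/2) * log_err (\<Sum>k=1..N. \<phi> k) powr (3/2 + \<epsilon>))"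
        by (simp only: S_def \<Phi>_def Q_def L_def B_def)
    qed
  qed
qed


lemma sum_power_diff_le:
  fixes \<theta> :: real
  assumes "0 \<le> \<theta>" "\<theta> < 1" "finite I"
  shows "(\<Sum>j\<in>{j\<in>I. j \<le> k}. \<theta> ^ (k - j)) \<le> 1 / (1 - \<theta>)"
proof -
  have "(\<Sum>j\<in>{j\<in>I. j \<le> k}. \<theta> ^ (k - j)) \<le> (\<Sum>j\<le>k. \<theta> ^ (k - j))"
    using assms by (intro sum_mono2) auto
  also have "\<dots> = (\<Sum>i\<le>k. \<theta> ^ i)"
    by (rule sum.reindex_bij_witness[where i = "\<lambda>i. k - i" and j = "\<lambda>i. k - i"]) auto
  also have "\<dots> \<le> (\<Sum>i. \<theta> ^ i)"
    using assms by (intro sum_le_suminf) auto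
  also have "\<dots> = 1 / (1 - \<theta>)" using assms by (simp add: suminf_geometric)
  finally show ?thesis .
qed

text \<open>Each pair is charged to its later index k, where the geometric series over the earlier
  indices costs \<phi> k / (1 - \<theta>). On the diagonal X^2 \<le> X bounds the second moment by
  \<phi> k. A variance bound calls for upper estimates of covariances, so \<open>cov\<close> is
  one-sided.\<close>

lemma variance_le_of_exponential_decorrelation:
  fixes X :: "nat \<Rightarrow> 'a \<Rightarrow> real" and \<phi> :: "nat \<Rightarrow> real"
  assumes "prob_space M" and X [measurable]: "\<And>k. X k \<in> borel_measurable M"
    and X01: "\<And>k x. 0 \<le> X k x \<and> X k x \<le> 1" and mean: "\<And>k. k \<in> I \<Longrightarrow> (LINT x|M. X k x) = \<phi> k"
    and cov: "\<And>j k. j \<in> I \<Longrightarrow> k \<in> I \<Longrightarrow> j < k \<Longrightarrow> (LINT x|M. X j x * X k x) - \<phi> j * \<phi> k \<le> K * \<theta> ^ (k - j) * \<phi> k"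
    and K: "1 \<le> K" and \<theta>: "0 \<le> \<theta>" "\<theta> < 1" and I: "finite I"
  shows "(LINT x|M. (\<Sum>k\<in>I. X k x - \<phi> k)\<^sup>2) \<le> 2 * K / (1 - \<theta>) * (\<Sum>k\<in>I. \<phi> k)"
proof -
  interpret prob_space M by fact
  have iX [simp]: "integrable M (X k)" for k
    using X01 by (intro integrable_const_bound[where B = 1]) auto
  have iXX [simp]: "integrable M (\<lambda>x. X j x * X k x)" for j k
    using X01 by (intro integrable_const_bound[where B = 1]) (auto simp: abs_mult intro!: mult_le_one)
  have \<phi>0: "0 \<le> \<phi> k" if "k \<in> I" for k
    using X01 by (subst mean[OF that, symmetric]) (intro integral_nonneg_AE, auto)
  \<comment> \<open>The diagonal is included with weight \<phi> k, so that one symmetric bound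
    serves all pairs.\<close>
  define a where "a = (\<lambda>j k. if j \<le> k then \<theta> ^ (k - j) * \<phi> k else 0)"
  have a0: "0 \<le> a j k" if "k \<in> I" for j k using \<theta> \<phi>0[OF that] by (simp add: a_def)
  have prod_eq: "(X j x - \<phi> j) * (X k x - \<phi> k) = X j x * X k x - \<phi> k * X j x - \<phi> j * X k x + \<phi> j * \<phi> k" for j k x
    by (simp add: algebra_simps)
  have iZ: "integrable M (\<lambda>x. (X j x - \<phi> j) * (X k x - \<phi> k))" for j k
    unfolding prod_eq by simp
  have c_eq: "(LINT x|M. (X j x - \<phi> j) * (X k x - \<phi> k)) = (LINT x|M. X j x * X k x) - \<phi> j * \<phi> k"
    if "j \<in> I" "k \<in> I" for j k
    unfolding prod_eq using that by (simp add: mean prob_space)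
  have c_lt: "(LINT x|M. (X j x - \<phi> j) * (X k x - \<phi> k)) \<le> K * a j k" if "j \<in> I" "k \<in> I" "j < k" for j k
    using cov[OF that] that by (simp add: c_eq a_def mult.assoc)
  have c_le: "(LINT x|M. (X j x - \<phi> j) * (X k x - \<phi> k)) \<le> K * a j k + K * a k j" if jk: "j \<in> I" "k \<in> I" for j k
  proof (rule linorder_cases[of j k])
    assume "j < k"
    thus ?thesis using c_lt[OF jk] a0[OF jk(1), of k] K by (simp add: add_increasing2)
  next
    assume "k < j"
    thus ?thesis using c_lt[OF jk(2,1)] a0[OF jk(2), of j] K by (simp add: add_increasing mult.commute)
  next
    assume [simp]: "j = k"
    have "(LINT x|M. X k x * X k x) \<le> (LINT x|M. X k x)"
      using X01 by (intro integral_mono) (auto intro: mult_left_le)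
    hence "(LINT x|M. (X j x - \<phi> j) * (X k x - \<phi> k)) \<le> \<phi> k"
      using c_eq[OF jk] mean[OF jk(2)] zero_le_square[of "\<phi> k"] unfolding \<open>j = k\<close> by linarith
    also have "\<dots> \<le> K * \<phi> k" using K \<phi>0[OF jk(2)] by (simp add: mult_le_cancel_right1)
    also have "\<dots> \<le> K * a j k + K * a k j" using K \<phi>0[OF jk(2)] by (simp add: a_def)
    finally show ?thesis .
  qed
  have suma: "(\<Sum>k\<in>I. \<Sum>j\<in>I. a j k) \<le> 1 / (1 - \<theta>) * (\<Sum>k\<in>I. \<phi> k)"
    unfolding sum_distrib_left
  proof (rule sum_mono)
    fix k assume k: "k \<in> I"
    have "(\<Sum>j\<in>I. a j k) = (\<Sum>j\<in>{j\<in>I. j \<le> k}. \<theta> ^ (k - j)) * \<phi> k"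
      unfolding a_def using I by (simp add: sum.If_cases Int_def sum_distrib_right)
    also have "\<dots> \<le> 1 / (1 - \<theta>) * \<phi> k"
      using sum_power_diff_le[OF \<theta> I] \<phi>0[OF k] by (rule mult_right_mono)
    finally show "(\<Sum>j\<in>I. a j k) \<le> 1 / (1 - \<theta>) * \<phi> k" .
  qed
  have "(LINT x|M. (\<Sum>k\<in>I. X k x - \<phi> k)\<^sup>2) = (\<Sum>j\<in>I. \<Sum>k\<in>I. LINT x|M. (X j x - \<phi> j) * (X k x - \<phi> k))"
    by (simp only: power2_eq_square sum_product Bochner_Integration.integral_sum Bochner_Integration.integrable_sum iZ)
  also have "\<dots> \<le> (\<Sum>j\<in>I. \<Sum>k\<in>I. K * a j k + K * a k j)"
    by (intro sum_mono c_le)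
  also have "\<dots> = K * (\<Sum>j\<in>I. \<Sum>k\<in>I. a j k) + K * (\<Sum>j\<in>I. \<Sum>k\<in>I. a k j)"
    by (simp add: sum.distrib sum_distrib_left)
  also have "(\<Sum>j\<in>I. \<Sum>k\<in>I. a j k) = (\<Sum>k\<in>I. \<Sum>j\<in>I. a j k)" by (rule sum.swap)
  also have "K * (\<Sum>k\<in>I. \<Sum>j\<in>I. a j k) + K * (\<Sum>j\<in>I. \<Sum>k\<in>I. a k j) = 2 * K * (\<Sum>k\<in>I. \<Sum>j\<in>I. a j k)"
    by simp
  also have "\<dots> \<le> 2 * K * (1 / (1 - \<theta>) * (\<Sum>k\<in>I. \<phi> k))"
    using suma K by (intro mult_left_mono) auto
  finally show ?thesis by simp
qed

section \<open>The shrinking target theorem\<close>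

lemma space_circle_measure: "space circle_measure = sphere 0 1"
  by (simp add: circle_measure_def space_restrict_space)

text \<open>The shrinking target set is defined through \<open>Lim\<close>, hence is arbitrary on a
  null set; completeness of the measure makes such a set measurable once it agrees almost everywhere
  with a measurable one.\<close>

lemma circle_measure_set_AE:
  assumes A: "A \<in> sets circle_measure" and W: "W \<subseteq> sphere 0 1"
    and AE: "AE z in circ. z \<in> A \<longleftrightarrow> z \<in> W"
  shows "W \<in> sets circle_measure" "emeasure circle_measure W = emeasure circle_measure A"
proof -
  have AE': "AE z in circle_measure. z \<in> A \<longleftrightarrow> z \<in> W"
    using AE by (simp add: AE_circle_measure_iff)
  show Ws: "W \<in> sets circle_measure"
    using completion.in_sets_AE[of A W] A W AE' unfolding circle_measure_def
    by (simp add: space_restrict_space)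
  show "emeasure circle_measure W = emeasure circle_measure A"
    using AE' A Ws by (intro emeasure_eq_AE) auto
qed

lemma emeasure_circle_measure_sphere: "emeasure circle_measure (sphere 0 1) = 1"
proof -
  have "(\<lambda>t. cis (2 * pi * t)) \<in> uniform_measure lborel {0..1::real} \<rightarrow>\<^sub>M restrict_space borel (sphere 0 1)"
    by (intro measurable_restrict_space2) auto
  hence "prob_space (distr (uniform_measure lborel {0..1}) (restrict_space borel (sphere 0 1)) (\<lambda>t::real. cis (2 * pi * t)))"
    by (intro prob_space.prob_space_distr prob_space_uniform_measure) auto
  from prob_space.emeasure_space_1[OF this] show ?thesis
    by (simp add: circle_measure_def space_restrict_space emeasure_completion main_part_sets sets_restrict_space_iff)
qed

lemma log_err_ge_1: "1 \<le> log_err x"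
  by (simp add: log_err_def)

lemma log_err_mono: "0 < x \<Longrightarrow> x \<le> y \<Longrightarrow> log_err x \<le> log_err y"
  unfolding log_err_def by (intro max.mono) auto

text \<open>The error term is sublinear, so the counting asymptotics force the number of hits to be
  unbounded.\<close>

lemma log_error_eventually_small:
  "eventually (\<lambda>x. b + K * (x powr (1/2) * log_err x powr (3/2 + 1)) < x) at_top"
proof -
  have "eventually (\<lambda>x. b + K * (x powr (1/2) * ln x powr (3/2 + 1)) < x) at_top" by real_asymp
  moreover have "eventually (\<lambda>x::real. x \<ge> exp 1) at_top" by (rule eventually_ge_at_top)
  ultimately show ?thesis
  proof eventually_elim
    case (elim x)
    hence "1 \<le> ln x" using ln_ge_iff[of x 1] less_le_trans[OF exp_gt_zero elim(2)] by simp
    thus ?case using elim(1) by (simp add: log_err_def max_def)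
  qed
qed

lemma measure_circ_sphere: "measure circ (sphere 0 1) = 1"
  using AE_circ_norm by (subst circ.prob_eq_1) (auto elim!: eventually_mono)

lemma AE_boundary_map_eq:
  assumes "radial_boundary f g" shows "AE z in circ. boundary_map f z = g z"
proof -
  have "AE z in circ. ((\<lambda>t. f (complex_of_real t * z)) \<longlongrightarrow> g z) (at_left 1)"
    using assms by (simp add: radial_boundary_def)
  thus ?thesis
    unfolding boundary_map_def by eventually_elim (intro tendsto_Lim trivial_limit_at_left_real)
qed

lemma measure_vimage_circ:
  assumes "radial_boundary f g" "f 0 = 0" and [measurable]: "B \<in> sets borel"
  shows "measure circ (g -` B) = measure circ B"
proof -
  have [measurable]: "g \<in> borel_measurable borel" by (rule radial_boundary_measurable) fact
  have "measure (distr circ borel g) B = measure circ (g -` B)" by (subst measure_distr) auto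
  thus ?thesis by (simp add: distr_circ[OF assms(1,2)])
qed

text \<open>With constant radius 2 every target is the whole circle, the count is N almost surely
  and the sum of the radii is 2 N. This is why the asymptotic formula is stated under the condition
  that some radius is at most 1.\<close>

theorem theorem2:
  fixes f :: "nat \<Rightarrow> complex \<Rightarrow> complex" and c :: "nat \<Rightarrow> complex" and r :: "nat \<Rightarrow> real" and \<alpha> :: real
  assumes "\<And>n. 1 \<le> n \<Longrightarrow> inner_function (f n)"
    and "\<And>n. 1 \<le> n \<Longrightarrow> f n 0 = 0"
    and "\<And>n. 1 \<le> n \<Longrightarrow> norm (deriv (f n) 0) \<le> \<alpha>"
    and "\<alpha> < 1"
    and "\<And>n. 1 \<le> n \<Longrightarrow> c n \<in> sphere 0 1"
    and "\<And>n. 1 \<le> n \<Longrightarrow> 0 < r n"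
    and "\<And>m n. 1 \<le> m \<Longrightarrow> m \<le> n \<Longrightarrow> r n \<le> r m"
  shows "((\<exists>n\<ge>1. r n \<le> 1) \<longrightarrow>
           (\<forall>\<epsilon>>0. AE z in circle_measure.
             (\<lambda>N. real (hitting_count f c r z N) - radius_sum r N) \<in>
               O(\<lambda>N. radius_sum r N powr (1/2) * log_err (radius_sum r N) powr (3/2 + \<epsilon>))))
       \<and> shrinking_target_set f c r \<in> sets circle_measure
       \<and> emeasure circle_measure (shrinking_target_set f c r) =
           (if summable (\<lambda>n. r (Suc n)) then 0 else 1)"
proof -
  have c: "norm (c n) = 1" if "1 \<le> n" for n using assms(5)[OF that] by simp
  have "\<exists>g. \<forall>n\<ge>1. radial_boundary (f n) (g n)"
  proof (intro exI allI impI)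
    fix n :: nat assume "1 \<le> n"
    from inner_function_radial_boundary[OF assms(1)[OF this]]
    obtain h where "radial_boundary (f n) h" .
    thus "radial_boundary (f n) (SOME h. radial_boundary (f n) h)"
      by (rule someI[of "radial_boundary (f n)"])
  qed
  then obtain g where rb: "\<And>n. 1 \<le> n \<Longrightarrow> radial_boundary (f n) (g n)" by auto

  \<comment> \<open>Target events through Borel representatives, and their measures\<close>
  define G where "G = forward_comp g"
  define B where "B = (\<lambda>k. circle_ball (c k) (r k))"
  \<comment> \<open>Capping at 1 makes \<phi> k the measure of the target k, an arc of radius above
    1 being the whole circle. Nothing is assumed at index 0, so it is set to 0; the general counting
    lemmas quantify over all indices.\<close>
  define \<phi> where "\<phi> = (\<lambda>k. if k = 0 then 0 else min (r k) 1)"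
  define X where "X = (\<lambda>k z. if k = 0 then 0 else indicator (B k) (G k z) :: real)"
  define \<theta> where "\<theta> = root 6 ((1 + \<alpha>) / 2)"
  have \<alpha>0: "0 \<le> \<alpha>" using order_trans[OF norm_ge_zero assms(3)[of 1]] by simp
  have \<theta>: "0 \<le> \<theta>" "\<theta> < 1" using \<alpha>0 assms(4) by (auto simp: \<theta>_def)
  have rbG: "radial_boundary (forward_comp f n) (G n)" if "1 \<le> n" for n
    unfolding G_def by (rule radial_boundary_forward_comp[OF rb assms(2) that])
  have F0: "forward_comp f n 0 = 0" for n by (rule forward_comp_fixes_0) (rule assms(2))
  have Gm: "G n \<in> borel_measurable borel" if "1 \<le> n" for n
    using rbG[OF that] by (rule radial_boundary_measurable)
  have Bm: "B n \<in> sets borel" if "1 \<le> n" for n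
    unfolding B_def by (rule circle_ball_measurable[OF c[OF that]])
  have GBm: "G n -` A \<in> sets borel" if "1 \<le> n" "A \<in> sets borel" for n A
    using Gm[OF that(1)] that(2) by (rule measurable_sets_borel)
  have Xm: "X n \<in> borel_measurable circ" for n
  proof (cases "n = 0")
    case False
    have "X n = indicator (G n -` B n)" using False by (auto simp: X_def fun_eq_iff indicator_def)
    thus ?thesis using GBm[of n "B n"] Bm[of n] False by simp
  qed (simp add: X_def)
  have X01: "0 \<le> X k z \<and> X k z \<le> 1" for k z by (simp add: X_def indicator_def)
  have \<phi>01: "0 \<le> \<phi> k \<and> \<phi> k \<le> 1" for k using assms(6)[of k] by (auto simp: \<phi>_def)
  have mB: "measure circ (B k) = \<phi> k" if "1 \<le> k" for k
  proof (cases "r k \<le> 1")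
    case True
    thus ?thesis using that assms(6)[OF that] by (simp add: B_def \<phi>_def measure_circle_ball[OF c[OF that]])
  next
    case False
    thus ?thesis using that by (simp add: B_def \<phi>_def circle_ball_gt_1[OF c[OF that]] measure_circ_sphere)
  qed
  have mean: "(LINT z|circ. X k z) = \<phi> k" if k: "1 \<le> k" for k
  proof -
    have "(LINT z|circ. X k z) = (LINT z|circ. indicator (G k -` B k) z)"
      using k by (simp add: X_def indicator_def)
    also have "\<dots> = measure circ (G k -` B k)" using GBm[OF k Bm[OF k]] by simp
    also have "\<dots> = measure circ (B k)" by (rule measure_vimage_circ[OF rbG[OF k] F0 Bm[OF k]])
    finally show ?thesis using mB[OF k] by simp
  qed

  \<comment> \<open>Covariances and the counting asymptotics for capped radii\<close>
  have cov: "(LINT z|circ. X j z * X k z) - \<phi> j * \<phi> k \<le> 24 * \<theta> ^ (k - j) * \<phi> k"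
    if j: "1 \<le> j" and jk: "j < k" for j k
  proof -
    have k: "1 \<le> k" "1 \<le> k - j" using j jk by auto
    \<comment> \<open>H is the boundary map of the steps after j, which form a sequence of the same
      kind. Since G j preserves \<open>circ\<close>, the joint event has the measure of the part of
      \<open>B j\<close> that H maps into \<open>B k\<close>.\<close>
    define H where "H = forward_comp (\<lambda>i. g (j + i)) (k - j)"
    have G_eq: "G k = H \<circ> G j"
      using forward_comp_add[of g j "k - j"] jk by (simp add: G_def H_def)
    have rbH: "radial_boundary (forward_comp (\<lambda>i. f (j + i)) (k - j)) H"
      unfolding H_def by (rule radial_boundary_forward_comp) (use rb assms(2) k in auto)
    have H0: "forward_comp (\<lambda>i. f (j + i)) (k - j) 0 = 0"
      by (rule forward_comp_fixes_0) (use assms(2) in simp)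
    have HB: "H -` B k \<in> sets borel"
      using radial_boundary_measurable[OF rbH] Bm[OF k(1)] by (rule measurable_sets_borel)
    have "(LINT z|circ. X j z * X k z) = (LINT z|circ. indicator (G j -` (B j \<inter> H -` B k)) z)"
      using j k by (intro Bochner_Integration.integral_cong) (auto simp: X_def G_eq indicator_def)
    also have "\<dots> = measure circ (G j -` (B j \<inter> H -` B k))"
      using GBm[OF j sets.Int[OF Bm[OF j] HB]] by simp
    also have "\<dots> = measure circ (B j \<inter> H -` B k)"
      by (rule measure_vimage_circ[OF rbG[OF j] F0 sets.Int[OF Bm[OF j] HB]])
    also have "\<dots> \<le> \<phi> j * \<phi> k + 24 * \<theta> ^ (k - j) * \<phi> k"
    proof (cases "r j \<le> 1")
      case True
      have "\<bar>measure circ (circle_ball (c j) (r j) \<inter> H -` B k) - r j * measure circ (B k)\<bar> \<le> 24 * \<theta> ^ (k - j) * measure circ (B k)"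
        unfolding H_def \<theta>_def
        by (rule mixing_forward_comp[where f = "\<lambda>i. f (j + i)"])
          (use rb assms(2,3,4) c[OF j] assms(6)[OF j] True k Bm in auto)
      thus ?thesis using True j mB[OF k(1)] by (simp add: B_def \<phi>_def abs_le_iff)
    next
      case False
      \<comment> \<open>A target of radius above 1 has \<phi> j = 1, so the product is just \<phi> k
        and invariance under H suffices.\<close>
      have "measure circ (B j \<inter> H -` B k) \<le> measure circ (H -` B k)"
        using HB by (intro circ.finite_measure_mono) auto
      also have "\<dots> = \<phi> j * \<phi> k"
        using False j mB[OF k(1)] measure_vimage_circ[OF rbH H0 Bm[OF k(1)]] by (simp add: \<phi>_def)
      also have "\<dots> \<le> \<phi> j * \<phi> k + 24 * \<theta> ^ (k - j) * \<phi> k" using \<theta> \<phi>01[of k] by simp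
      finally show ?thesis .
    qed
    finally show ?thesis by simp
  qed
  have var: "(LINT z|circ. (\<Sum>k\<in>{m<..n}. X k z - \<phi> k)\<^sup>2) \<le> 2 * 24 / (1 - \<theta>) * (\<Sum>k\<in>{m<..n}. \<phi> k)" for m n
    by (rule variance_le_of_exponential_decorrelation[OF circ.prob_space_axioms Xm X01])
      (use mean cov \<theta> in auto)
  have counting: "AE z in circ. \<exists>K. \<forall>N. 1 \<le> (\<Sum>k=1..N. \<phi> k) \<longrightarrow>
    \<bar>(\<Sum>k=1..N. X k z) - (\<Sum>k=1..N. \<phi> k)\<bar> \<le>
      K * ((\<Sum>k=1..N. \<phi> k) powr (1/2) * log_err (\<Sum>k=1..N. \<phi> k) powr (3/2 + \<epsilon>))"
    if "\<not> summable (\<lambda>k. \<phi> (Suc k))" "\<epsilon> > 0" for \<epsilon>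
    by (rule counting_from_variance[OF circ.prob_space_axioms Xm X01 \<phi>01 var _ that]) (use \<theta> in auto)

  \<comment> \<open>Identification of the actual hits with the Borel events\<close>
  have "AE z in circ. \<forall>n. 1 \<le> n \<longrightarrow> boundary_map (forward_comp f n) z = G n z"
    unfolding AE_all_countable
  proof
    fix n
    show "AE z in circ. 1 \<le> n \<longrightarrow> boundary_map (forward_comp f n) z = G n z"
      using AE_boundary_map_eq[OF rbG[of n]] by (cases "1 \<le> n") auto
  qed
  hence hits: "AE z in circ. hits f c r z = {n. 1 \<le> n \<and> G n z \<in> B n}"
    by eventually_elim (auto simp: hits_def B_def)
  have count: "real (hitting_count f c r z N) = (\<Sum>k=1..N. X k z)"
    if "hits f c r z = {n. 1 \<le> n \<and> G n z \<in> B n}" for z N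
  proof -
    have "(\<Sum>k=1..N. X k z) = (\<Sum>k\<in>{1..N}. if G k z \<in> B k then 1 else 0)"
      by (intro sum.cong) (auto simp: X_def)
    also have "\<dots> = real (card {k \<in> {1..N}. G k z \<in> B k})"
      by (subst sum.inter_filter[symmetric]) auto
    also have "{k \<in> {1..N}. G k z \<in> B k} = hits f c r z \<inter> {1..N}" unfolding that by auto
    finally show ?thesis by (simp add: hitting_count_def)
  qed
  have count_le: "real (hitting_count f c r z N) \<le> real (card (hits f c r z))"
    if "finite (hits f c r z)" for z N
    unfolding hitting_count_def using that by (intro of_nat_mono card_mono) auto
  have \<phi>_le: "\<phi> k \<le> r k" if "1 \<le> k" for k using that by (simp add: \<phi>_def)
  \<comment> \<open>The cap does not affect convergence: if the capped series converges, its terms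
    tend to 0, so the cap is inactive from some index on.\<close>
  have summable_iff: "summable (\<lambda>n. r (Suc n)) \<longleftrightarrow> summable (\<lambda>n. \<phi> (Suc n))"
  proof
    assume "summable (\<lambda>n. r (Suc n))"
    thus "summable (\<lambda>n. \<phi> (Suc n))"
      by (rule summable_comparison_test'[where N = 0]) (use \<phi>01 \<phi>_le in auto)
  next
    assume s: "summable (\<lambda>n. \<phi> (Suc n))"
    hence "(\<lambda>n. \<phi> (Suc n)) \<longlonglongrightarrow> 0" by (rule summable_LIMSEQ_zero)
    hence "eventually (\<lambda>n. \<phi> (Suc n) < 1) sequentially" by (rule order_tendstoD) simp
    hence "eventually (\<lambda>n. \<phi> (Suc n) = r (Suc n)) sequentially"
      by eventually_elim (auto simp: \<phi>_def)
    thus "summable (\<lambda>n. r (Suc n))" using s summable_cong by metis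
  qed
  have shift: "(\<Sum>k=1..N. h k) = (\<Sum>k<N. h (Suc k))" for h :: "nat \<Rightarrow> real" and N
    by (induction N) auto

  \<comment> \<open>The zero-one law\<close>
  have finite_hits: "AE z in circ. finite (hits f c r z)" if s: "summable (\<lambda>n. \<phi> (Suc n))"
  proof -
    have "AE z in circ. eventually (\<lambda>n. z \<in> space circ - G (Suc n) -` B (Suc n)) sequentially"
    proof (rule borel_cantelli_AE1)
      show "G (Suc n) -` B (Suc n) \<in> sets circ" for n using GBm[OF _ Bm] by simp
      have "measure circ (G (Suc n) -` B (Suc n)) = \<phi> (Suc n)" for n
        using measure_vimage_circ[OF rbG F0 Bm, of "Suc n" "Suc n"] mB[of "Suc n"] by simp
      thus "summable (\<lambda>n. measure circ (G (Suc n) -` B (Suc n)))" using s by simp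
    qed (simp add: less_top[symmetric])
    thus ?thesis using hits
    proof eventually_elim
      case (elim z)
      from elim(1) obtain n0 where n0: "\<And>n. n0 \<le> n \<Longrightarrow> G (Suc n) z \<notin> B (Suc n)"
        by (auto simp: eventually_sequentially)
      have "hits f c r z \<subseteq> {..n0}"
      proof
        fix n assume "n \<in> hits f c r z"
        hence n: "1 \<le> n" "G n z \<in> B n" using elim(2) by auto
        show "n \<in> {..n0}" using n n0[of "n - 1"] by (cases "n0 \<le> n - 1") auto
      qed
      thus ?case by (rule finite_subset) simp
    qed
  qed
  have \<Phi>_at_top: "filterlim (\<lambda>N. \<Sum>k=1..N. \<phi> k) at_top sequentially"
    if "\<not> summable (\<lambda>n. \<phi> (Suc n))"
    unfolding shift
  proof -
    have "\<exists>N. b \<le> (\<Sum>k<N. \<phi> (Suc k))" for b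
    proof (rule ccontr)
      assume "\<nexists>N. b \<le> (\<Sum>k<N. \<phi> (Suc k))"
      hence "(\<Sum>k<N. \<phi> (Suc k)) \<le> b" for N by (simp add: not_le less_imp_le)
      hence "(\<Sum>k\<le>N. \<phi> (Suc k)) \<le> b" for N unfolding lessThan_Suc_atMost[symmetric] .
      hence "summable (\<lambda>k. \<phi> (Suc k))"
        using \<phi>01 by (intro bounded_imp_summable[of _ b]) auto
      thus False using that by simp
    qed
    moreover have "mono (\<lambda>N. \<Sum>k<N. \<phi> (Suc k))"
      using \<phi>01 by (intro monoI sum_mono2) auto
    ultimately show "filterlim (\<lambda>N. \<Sum>k<N. \<phi> (Suc k)) at_top sequentially"
      unfolding filterlim_at_top eventually_sequentially mono_def by (meson order_trans)
  qed
  \<comment> \<open>The counting estimate is used with \<epsilon> = 1, any positive value serving: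
    finitely many hits would leave the main term larger than a bounded count plus the error.\<close>
  have infinite_hits: "AE z in circ. infinite (hits f c r z)" if ns: "\<not> summable (\<lambda>n. \<phi> (Suc n))"
    using counting[OF ns zero_less_one] hits
  proof eventually_elim
    case (elim z)
    then obtain K where K: "\<And>N. 1 \<le> (\<Sum>k=1..N. \<phi> k) \<Longrightarrow>
      \<bar>(\<Sum>k=1..N. X k z) - (\<Sum>k=1..N. \<phi> k)\<bar> \<le>
      K * ((\<Sum>k=1..N. \<phi> k) powr (1/2) * log_err (\<Sum>k=1..N. \<phi> k) powr (3/2 + 1))" by blast
    show ?case
    proof
      assume fin: "finite (hits f c r z)"
      define b where "b = real (card (hits f c r z))"
      have "eventually (\<lambda>x. b + K * (x powr (1/2) * log_err x powr (3/2 + 1)) < x \<and> 1 \<le> x) at_top"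
        using log_error_eventually_small eventually_ge_at_top by (rule eventually_conj)
      from eventually_compose_filterlim[OF this \<Phi>_at_top[OF ns]]
      obtain N where N: "b + K * ((\<Sum>k=1..N. \<phi> k) powr (1/2) * log_err (\<Sum>k=1..N. \<phi> k) powr (3/2 + 1)) < (\<Sum>k=1..N. \<phi> k)"
        "1 \<le> (\<Sum>k=1..N. \<phi> k)"
        unfolding eventually_sequentially by blast
      have "(\<Sum>k=1..N. X k z) \<le> b"
        using count_le[OF fin, of N] count[OF elim(2), of N] by (simp add: b_def)
      thus False using K[OF N(2)] N(1) by linarith
    qed
  qed
  have sub: "shrinking_target_set f c r \<subseteq> sphere 0 1" by (auto simp: shrinking_target_set_def)
  have set_eq: "shrinking_target_set f c r \<in> sets circle_measure \<and>
    emeasure circle_measure (shrinking_target_set f c r) = (if summable (\<lambda>n. r (Suc n)) then 0 else 1)"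
  proof (cases "summable (\<lambda>n. r (Suc n))")
    case True
    have AE: "AE z in circ. z \<in> {} \<longleftrightarrow> z \<in> shrinking_target_set f c r"
      using finite_hits True[unfolded summable_iff]
      by (auto elim!: eventually_mono simp: shrinking_target_set_def)
    show ?thesis
      using circle_measure_set_AE[OF sets.empty_sets sub AE] True by simp
  next
    case False
    have AE: "AE z in circ. z \<in> sphere 0 1 \<longleftrightarrow> z \<in> shrinking_target_set f c r"
      using infinite_hits[OF False[unfolded summable_iff]]
      by eventually_elim (simp add: shrinking_target_set_def)
    have "sphere 0 1 \<in> sets circle_measure"
      using sets.top[of circle_measure] by (simp add: space_circle_measure)
    from circle_measure_set_AE[OF this sub AE] show ?thesis
      using False emeasure_circle_measure_sphere by simp
  qed

  \<comment> \<open>The counting formula for the original radii\<close>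
  have asymptotics: "AE z in circle_measure.
      (\<lambda>N. real (hitting_count f c r z N) - radius_sum r N) \<in>
        O(\<lambda>N. radius_sum r N powr (1/2) * log_err (radius_sum r N) powr (3/2 + \<epsilon>))"
    if ex: "\<exists>n\<ge>1. r n \<le> 1" and \<epsilon>: "\<epsilon> > 0" for \<epsilon>
    unfolding AE_circle_measure_iff
  proof (cases "summable (\<lambda>n. \<phi> (Suc n))")
    case True
    define R where "R = (\<Sum>n. r (Suc n))"
    \<comment> \<open>Here counts and sums of radii stay bounded, so it is enough that the error
      term is at least q from N = 1 on; this holds because the sums are at least r 1 and
      \<open>log_err\<close> is at least 1.\<close>
    define q where "q = r 1 powr (1/2)"
    have q: "q > 0" using assms(6)[of 1] by (simp add: q_def)
    have r0: "0 \<le> r (Suc n)" for n using assms(6)[of "Suc n"] by simp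
    have R: "0 \<le> radius_sum r N" "radius_sum r N \<le> R" for N
      unfolding radius_sum_def shift R_def using True[folded summable_iff] r0
      by (auto intro!: sum_nonneg sum_le_suminf)
    show "AE z in circ. (\<lambda>N. real (hitting_count f c r z N) - radius_sum r N) \<in>
        O(\<lambda>N. radius_sum r N powr (1/2) * log_err (radius_sum r N) powr (3/2 + \<epsilon>))"
      using finite_hits[OF True]
    proof eventually_elim
      case (elim z)
      define b where "b = real (card (hits f c r z))"
      show ?case
      proof (rule bigoI[where c = "(b + R) / q"])
        show "eventually (\<lambda>N. norm (real (hitting_count f c r z N) - radius_sum r N) \<le>
          (b + R) / q * norm (radius_sum r N powr (1/2) * log_err (radius_sum r N) powr (3/2 + \<epsilon>))) sequentially"
          using eventually_ge_at_top[of 1]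
        proof eventually_elim
          case (elim N)
          have "r 1 \<le> radius_sum r N"
            unfolding radius_sum_def using elim assms(6) by (intro member_le_sum) (auto intro: less_imp_le)
          hence "q * 1 \<le> radius_sum r N powr (1/2) * log_err (radius_sum r N) powr (3/2 + \<epsilon>)"
            unfolding q_def using assms(6)[of 1] \<epsilon> log_err_ge_1
            by (intro mult_mono powr_mono2 ge_one_powr_ge_zero) auto
          hence "1 \<le> (radius_sum r N powr (1/2) * log_err (radius_sum r N) powr (3/2 + \<epsilon>)) / q"
            using q by (simp add: le_divide_eq)
          hence "(b + R) * 1 \<le> (b + R) * ((radius_sum r N powr (1/2) * log_err (radius_sum r N) powr (3/2 + \<epsilon>)) / q)"
            using R[of 0] by (intro mult_left_mono) (auto simp: b_def)
          moreover have "norm (real (hitting_count f c r z N) - radius_sum r N) \<le> b + R"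
            using R[of N] count_le[OF \<open>finite (hits f c r z)\<close>, of N] by (auto simp: b_def abs_le_iff)
          ultimately show ?case by simp
        qed
      qed
    qed
  next
    case False
    obtain n0 where n0: "1 \<le> n0" "r n0 \<le> 1" using ex by blast
    define \<Phi> where "\<Phi> = (\<lambda>N. \<Sum>k=1..N. \<phi> k)"
    \<comment> \<open>The total excess of the radii over their caps: decreasing radii stay at most 1
      from n0 on, so no later index contributes. This constant is absorbed by the error term, which
      is at least 1 as soon as \<Phi> N is.\<close>
    define \<delta> where "\<delta> = (\<Sum>k=1..n0. r k - \<phi> k)"
    have \<delta>0: "0 \<le> \<delta>" unfolding \<delta>_def using \<phi>_le by (intro sum_nonneg) auto
    have \<phi>_eq: "\<phi> k = r k" if "n0 \<le> k" for k
      using assms(7)[OF n0(1) that] n0 that by (auto simp: \<phi>_def)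
    have lower: "\<Phi> N \<le> radius_sum r N" for N
      unfolding \<Phi>_def radius_sum_def using \<phi>_le by (intro sum_mono) auto
    have upper: "radius_sum r N \<le> \<Phi> N + \<delta>" for N
    proof -
      have "radius_sum r N - \<Phi> N = (\<Sum>k=1..N. r k - \<phi> k)"
        by (simp add: radius_sum_def \<Phi>_def sum_subtractf)
      also have "\<dots> = (\<Sum>k\<in>{1..N} \<inter> {1..n0}. r k - \<phi> k)"
        using \<phi>_eq by (intro sum.mono_neutral_right) auto
      also have "\<dots> \<le> \<delta>" unfolding \<delta>_def using \<phi>_le by (intro sum_mono2) auto
      finally show ?thesis by simp
    qed
    have ev: "eventually (\<lambda>N. 1 \<le> \<Phi> N) sequentially"
      using \<Phi>_at_top[OF False] unfolding \<Phi>_def filterlim_at_top by blast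
    show "AE z in circ. (\<lambda>N. real (hitting_count f c r z N) - radius_sum r N) \<in>
        O(\<lambda>N. radius_sum r N powr (1/2) * log_err (radius_sum r N) powr (3/2 + \<epsilon>))"
      using counting[OF False \<epsilon>] hits
    proof eventually_elim
      case (elim z)
      then obtain K where K: "\<And>N. 1 \<le> \<Phi> N \<Longrightarrow> \<bar>(\<Sum>k=1..N. X k z) - \<Phi> N\<bar> \<le>
        K * (\<Phi> N powr (1/2) * log_err (\<Phi> N) powr (3/2 + \<epsilon>))" unfolding \<Phi>_def by blast
      show ?case
      proof (rule bigoI[where c = "\<bar>K\<bar> + \<delta>"])
        show "eventually (\<lambda>N. norm (real (hitting_count f c r z N) - radius_sum r N) \<le>
          (\<bar>K\<bar> + \<delta>) * norm (radius_sum r N powr (1/2) * log_err (radius_sum r N) powr (3/2 + \<epsilon>))) sequentially"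
          using ev
        proof eventually_elim
          case (elim N)
          define Q where "Q = \<Phi> N powr (1/2) * log_err (\<Phi> N) powr (3/2 + \<epsilon>)"
          define Q' where "Q' = radius_sum r N powr (1/2) * log_err (radius_sum r N) powr (3/2 + \<epsilon>)"
          have "1 * 1 \<le> Q"
            unfolding Q_def using elim \<epsilon> log_err_ge_1 by (intro mult_mono ge_one_powr_ge_zero) auto
          hence Q1: "1 \<le> Q" by simp
          have L0: "0 \<le> log_err x" for x using log_err_ge_1[of x] by linarith
          have QQ': "Q \<le> Q'"
            unfolding Q_def Q'_def using elim lower[of N] \<epsilon> L0
            by (intro mult_mono powr_mono2 log_err_mono) auto
          have "\<bar>(\<Sum>k=1..N. X k z) - \<Phi> N\<bar> \<le> K * Q" unfolding Q_def by (rule K[OF elim])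
          also have "\<dots> \<le> \<bar>K\<bar> * Q" using Q1 by (intro mult_right_mono) auto
          finally have "\<bar>(\<Sum>k=1..N. X k z) - radius_sum r N\<bar> \<le> \<bar>K\<bar> * Q + \<delta>"
            using lower[of N] upper[of N] by linarith
          also have "\<dots> \<le> \<bar>K\<bar> * Q' + \<delta> * Q'"
            using QQ' Q1 \<delta>0 mult_left_mono[of 1 Q' \<delta>] by (intro add_mono mult_left_mono) auto
          also have "\<dots> = (\<bar>K\<bar> + \<delta>) * norm Q'" using QQ' Q1 by (simp add: distrib_right)
          finally show ?case
            unfolding Q'_def count[OF \<open>hits f c r z = {n. 1 \<le> n \<and> G n z \<in> B n}\<close>] by simp
        qed
      qed
    qed
  qed
  show ?thesis using set_eq asymptotics by blast
qed

end
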